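(* Assume Selberg's conjectures (A), (B), (C) stated in the context. Then $\mathcal{S}$ has unique factorization: every $F\in\mathcal{S}$ can be written as a finite product of primitive elements of $\mathcal{S}$ (the empty product for $F=1$), and this factorization is unique up to the order of the factors.
   Context: Write $\sigma=\Re s$, and for a function $\Phi$ put $\overline{\Phi}(s)=\overline{\Phi(\overline{s})}$. The Selberg class $\mathcal{S}$ is the set of Dirichlet series $F(s)=\sum_{n=1}^{\infty} a_n n^{-s}$ satisfying: (1) Analyticity: $(s-1)^mF(s)$ is (continues to) an entire function of finite order for some non-negative integer $m$. (2) Ramanujan hypothesis: $a_n\ll_\epsilon n^{\epsilon}$ for any fixed $\epsilon>0$. (3) Functional equation: there is a function $\gamma_F(s)=\epsilon Q^s\prod_{i=1}^{k}\Gamma(w_is+\mu_i)$ with $|\epsilon|=1$, $Q>0$, $w_i>0$, $\Re\mu_i\ge 0$ (the product of gamma functions may be empty) such that $\Phi(s)=\gamma_F(s)F(s)$ satisfies $\Phi(s)=\overline{\Phi}(1-s)$. (4) Euler product: $a_1=1$ and $\log F(s)=\sum_{n=1}^{\infty} b_n n^{-s}$ (for $\sigma>1$), where $b_n=0$ unless $n$ is a positive power of a prime, and $b_n\ll n^{\theta}$ for some $\theta<1/2$. $F\in\mathcal{S}$, $F\ne 1$, is primitive if $F=F_1F_2$ with $F_1,F_2\in\mathcal{S}$ implies $F_1=1$ or $F_2=1$. For a primitive Dirichlet character $\chi$, $F^\chi(s)=\sum_{n\ge1} a_n\chi(n)n^{-s}$. Sums over $p$ are over primes. Selberg's conjectures: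 (A) Regularity of distribution: for each $F\in\mathcal{S}$ with coefficients $a_n$ there is an integer $n_F$ such that $\sum_{p\le x}|a_p|^2/p=n_F\log\log x+O(1)$. (B) Orthonormality: if $F$ and $F'$ (with coefficients $a_n$ and $a'_n$) are distinct and primitive, then $n_F=1$ and $\sum_{p\le x}a_p\overline{a'_p}/p=O(1)$. (C) $GL(1)$ twists: if $\chi$ is a primitive Dirichlet character, $F$ and $F^\chi$ are in $\mathcal{S}$, and $F=\prod_{i=1}^kF_i$ with the $F_i$ primitive, then $F^\chi=\prod_{i=1}^kF_i^\chi$ and the $F_i^\chi$ are also primitive elements of $\mathcal{S}$. *)

theory Defs
  imports
    "HOL-Complex_Analysis.Complex_Analysis"
    "HOL-Number_Theory.Prime_Powers"
    "HOL-Library.Landau_Symbols"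
    "HOL-Library.Multiset"
begin

section \<open>Dirichlet series\<close>

text \<open>
  A Dirichlet series is given by its coefficients \<open>a :: nat \<Rightarrow> complex\<close>. Only the indices
  \<open>n \<ge> 1\<close> matter: the summand for \<open>n = 0\<close> below is \<open>a 0 / 0 = 0\<close>, and elements of the Selberg
  class are normalised by \<open>a 0 = 0\<close>, so that equality of series is equality of functions
  \<open>nat \<Rightarrow> complex\<close>.
\<close>

definition dseries :: "(nat \<Rightarrow> complex) \<Rightarrow> complex \<Rightarrow> complex" where
  "dseries a s = (\<Sum>n. a n / of_nat n powr s)"

definition one_coeffs :: "nat \<Rightarrow> complex" where
  "one_coeffs n = (if n = 1 then 1 else 0)"

text \<open>
  \<open>F = \<Prod>F\<^sub>i\<close> as functions on the half-plane of absolute convergence (of the series in the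
  Selberg class); the finite family of factors is a multiset, and the empty product is \<open>1\<close>.
\<close>

definition is_product_of :: "(nat \<Rightarrow> complex) \<Rightarrow> (nat \<Rightarrow> complex) multiset \<Rightarrow> bool" where
  "is_product_of a M \<longleftrightarrow>
     (\<forall>s. Re s > 1 \<longrightarrow> dseries a s = (\<Prod>f\<in>#M. dseries f s))"

section \<open>The Selberg class\<close>

definition entire_finite_order :: "(complex \<Rightarrow> complex) \<Rightarrow> bool" where
  "entire_finite_order G \<longleftrightarrow> G holomorphic_on UNIV \<and>
     (\<exists>\<rho>::real. (\<lambda>z. norm (G z)) \<in> O[at_infinity](\<lambda>z. exp (norm z powr \<rho>)))"

text \<open>
  \<open>F\<close> is the analytic continuation of the series with coefficients \<open>a\<close>. Its value at \<open>s = 1\<close> is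
  left unspecified.
\<close>

definition selberg_analyticity :: "(nat \<Rightarrow> complex) \<Rightarrow> (complex \<Rightarrow> complex) \<Rightarrow> bool" where
  "selberg_analyticity a F \<longleftrightarrow>
     (\<forall>s. Re s > 1 \<longrightarrow> F s = dseries a s) \<and>
     (\<exists>m::nat. \<exists>G. entire_finite_order G \<and> (\<forall>s. s \<noteq> 1 \<longrightarrow> G s = (s - 1) ^ m * F s))"

definition ramanujan_hypothesis :: "(nat \<Rightarrow> complex) \<Rightarrow> bool" where
  "ramanujan_hypothesis a \<longleftrightarrow>
     (\<forall>\<epsilon>>0. (\<lambda>n. norm (a n)) \<in> O(\<lambda>n. real n powr \<epsilon>))"

definition gamma_factor ::
  "complex \<Rightarrow> real \<Rightarrow> nat \<Rightarrow> (nat \<Rightarrow> real) \<Rightarrow> (nat \<Rightarrow> complex) \<Rightarrow> complex \<Rightarrow> complex" where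
  "gamma_factor \<epsilon> Q k w \<mu> s = \<epsilon> * of_real Q powr s * (\<Prod>i<k. Gamma (of_real (w i) * s + \<mu> i))"

text \<open>
  The functional equation is an identity of meromorphic functions. Here it is required at every
  point where neither \<open>F\<close> nor a Gamma factor has a singularity on either side (the library's
  \<open>Gamma\<close> takes the value \<open>0\<close> at its poles). Note that \<open>cnj (\<Phi> (1 - cnj s))\<close> is the value of
  the conjugate function of \<open>\<Phi>\<close> at \<open>1 - s\<close>.
\<close>

definition selberg_functional_equation :: "(complex \<Rightarrow> complex) \<Rightarrow> bool" where
  "selberg_functional_equation F \<longleftrightarrow>
     (\<exists>\<epsilon> Q k w \<mu>. norm \<epsilon> = 1 \<and> Q > 0 \<and> (\<forall>i<k. w i > 0 \<and> Re (\<mu> i) \<ge> 0) \<and>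
        (let \<Phi> = (\<lambda>s. gamma_factor \<epsilon> Q k w \<mu> s * F s) in
         \<forall>s. s \<noteq> 0 \<longrightarrow> s \<noteq> 1 \<longrightarrow>
           (\<forall>i<k. of_real (w i) * s + \<mu> i \<notin> \<int>\<^sub>\<le>\<^sub>0 \<and>
                  of_real (w i) * (1 - cnj s) + \<mu> i \<notin> \<int>\<^sub>\<le>\<^sub>0) \<longrightarrow>
           \<Phi> s = cnj (\<Phi> (1 - cnj s))))"

text \<open>
  The identity for \<open>log F\<close> is stated in exponentiated form; the branch is the one that tends
  to \<open>0\<close> as \<open>Re s\<close> tends to infinity, since \<open>b 1 = 0\<close>.
\<close>

definition selberg_euler_product :: "(nat \<Rightarrow> complex) \<Rightarrow> bool" where
  "selberg_euler_product a \<longleftrightarrow> a 1 = 1 \<and>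
     (\<exists>b :: nat \<Rightarrow> complex.
        (\<forall>s. Re s > 1 \<longrightarrow> summable (\<lambda>n. b n / of_nat n powr s) \<and>
                          exp (dseries b s) = dseries a s) \<and>
        (\<forall>n. \<not> primepow n \<longrightarrow> b n = 0) \<and>
        (\<exists>\<theta><1/2. (\<lambda>n. norm (b n)) \<in> O(\<lambda>n. real n powr \<theta>)))"

definition selberg_class :: "(nat \<Rightarrow> complex) set" where
  "selberg_class = {a. a 0 = 0 \<and>
     (\<exists>F. selberg_analyticity a F \<and> selberg_functional_equation F) \<and>
     ramanujan_hypothesis a \<and> selberg_euler_product a}"

definition selberg_primitive :: "(nat \<Rightarrow> complex) \<Rightarrow> bool" where
  "selberg_primitive a \<longleftrightarrow> a \<in> selberg_class \<and> a \<noteq> one_coeffs \<and>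
     (\<forall>a1\<in>selberg_class. \<forall>a2\<in>selberg_class.
        is_product_of a {#a1, a2#} \<longrightarrow> a1 = one_coeffs \<or> a2 = one_coeffs)"

section \<open>Primitive Dirichlet characters and twists\<close>

definition dirichlet_character :: "nat \<Rightarrow> (nat \<Rightarrow> complex) \<Rightarrow> bool" where
  "dirichlet_character q \<psi> \<longleftrightarrow> q > 0 \<and>
     (\<forall>n. \<psi> (n + q) = \<psi> n) \<and> (\<forall>m n. \<psi> (m * n) = \<psi> m * \<psi> n) \<and>
     (\<forall>n. \<psi> n \<noteq> 0 \<longleftrightarrow> coprime n q)"

text \<open>A character is primitive if no proper divisor of its modulus is an induced modulus.\<close>

definition primitive_dirichlet_character :: "nat \<Rightarrow> (nat \<Rightarrow> complex) \<Rightarrow> bool" where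
  "primitive_dirichlet_character q \<psi> \<longleftrightarrow> dirichlet_character q \<psi> \<and>
     \<not> (\<exists>d. d dvd q \<and> d < q \<and> (\<forall>n. coprime n q \<longrightarrow> n mod d = 1 mod d \<longrightarrow> \<psi> n = 1))"

definition twist :: "(nat \<Rightarrow> complex) \<Rightarrow> (nat \<Rightarrow> complex) \<Rightarrow> nat \<Rightarrow> complex" where
  "twist \<psi> a n = a n * \<psi> n"

section \<open>Selberg's conjectures\<close>

text \<open>\<open>n\<^sub>F = n\<close>; there is at most one such \<open>n\<close>, as \<open>ln (ln x)\<close> is unbounded.\<close>

definition has_selberg_number :: "(nat \<Rightarrow> complex) \<Rightarrow> int \<Rightarrow> bool" where
  "has_selberg_number a n \<longleftrightarrow>
     (\<lambda>x::real. (\<Sum>p | prime p \<and> real p \<le> x. (norm (a p))\<^sup>2 / real p) - of_int n * ln (ln x))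
       \<in> O[at_top](\<lambda>_. 1)"

definition selberg_conjecture_A :: bool where
  "selberg_conjecture_A \<longleftrightarrow> (\<forall>a\<in>selberg_class. \<exists>n::int. has_selberg_number a n)"

definition selberg_conjecture_B :: bool where
  "selberg_conjecture_B \<longleftrightarrow>
     (\<forall>a a'. selberg_primitive a \<longrightarrow> selberg_primitive a' \<longrightarrow> a \<noteq> a' \<longrightarrow>
        has_selberg_number a 1 \<and>
        (\<lambda>x::real. \<Sum>p | prime p \<and> real p \<le> x. a p * cnj (a' p) / of_nat p)
          \<in> O[at_top](\<lambda>_. 1))"

definition selberg_conjecture_C :: bool where
  "selberg_conjecture_C \<longleftrightarrow>
     (\<forall>q \<psi> a M. primitive_dirichlet_character q \<psi> \<longrightarrow>
        a \<in> selberg_class \<longrightarrow> twist \<psi> a \<in> selberg_class \<longrightarrow>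
        (\<forall>f\<in>#M. selberg_primitive f) \<longrightarrow> is_product_of a M \<longrightarrow>
        is_product_of (twist \<psi> a) (image_mset (twist \<psi>) M) \<and>
        (\<forall>f\<in>#M. selberg_primitive (twist \<psi> f)))"

end

theory Submission
  imports
    Defs
    "HOL-Analysis.Kronecker_Approximation_Theorem"
    "HOL-Computational_Algebra.Fundamental_Theorem_Algebra"
    "HOL-Probability.Sinc_Integral"
    "HOL-Real_Asymp.Real_Asymp"
begin

text \<open>
  Uniqueness: the coefficients at primes add up under multiplication, so two different
  factorizations give an integral linear relation between the sequences \<open>f p\<close> of distinct primitive
  \<open>f\<close>; with two or more terms it contradicts orthonormality, because \<open>ln (ln x)\<close> is unbounded, and with
  a single term some power of a primitive \<open>f\<close> would be \<open>1\<close>.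

  Existence holds unconditionally. Let the weight of an element be \<open>\<Sum>i<k. w i\<close> for its Gamma
  factors. Counting trivial zeros shows that weights are superadditive, so it suffices that an element
  of weight at most \<open>1 / 100\<close> is \<open>1\<close>. For small weight, \<open>F\<close> grows so slowly to the left that shifting
  the integral of \<open>(s - 1)\<^sup>m F(s) N\<^sup>s\<close> against the kernel \<open>exp (- cos ((s - 1) / T))\<close> to
  \<open>Re s = 1 - T\<close>, with \<open>T = N\<^sup>2\<close>, shows that \<open>a N\<close> decays faster than any power of \<open>N\<close>. The series then
  converges absolutely everywhere and is almost periodic, which is incompatible with trivial
  zeros, so there is no Gamma factor. In that case \<open>F\<close> is a Dirichlet polynomial; if \<open>q\<close> is its length,
  the functional equation gives \<open>norm (a q) \<ge> sqrt q\<close>, whereas the Euler product gives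
  \<open>norm (a q) \<le> q powr \<theta>\<close> with \<open>\<theta> < 1 / 2\<close>, so \<open>q = 1\<close>.
\<close>

section \<open>Dirichlet series\<close>


text \<open>Existence needs a positive lower bound for the weight of every element other than 1, for
  otherwise a splitting process need not stop. This is the phenomenon that the Selberg class has no
  elements of small positive degree (the degree is twice the weight). Any positive threshold will
  do, so crude estimates suffice, with \<open>x powr x\<close> in place of Stirling's formula. The
  kernel is chosen because the real part of \<open>cos (c + \<i> * y)\<close> is
  \<open>cos c * cosh y\<close>: for \<open>\<bar>c\<bar> \<le> 1\<close> it decays doubly
  exponentially and dominates every function of finite order, so contours can be shifted without any
  convexity bound in the critical strip. In the variable \<open>v\<close> with
  \<open>s = 1 + T * v\<close>, a shift of length \<open>2 * T\<close> stays in this fixed strip for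
  every \<open>T\<close>. The functional equation is used only for \<open>Re s < 0\<close>. There
  \<open>1 - s\<close> lies in the half-plane of absolute convergence, and the zeros of
  \<open>F\<close> are exactly those of the reciprocal Gamma factors.\<close>

definition abs_conv :: "(nat \<Rightarrow> complex) \<Rightarrow> real \<Rightarrow> bool" where
  "abs_conv a \<sigma> \<longleftrightarrow> summable (\<lambda>n. norm (a n) / real n powr \<sigma>)"

text \<open>Dirichlet convolution. For \<open>n = 0\<close> every \<open>d\<close> is a divisor, so
  the index set is infinite and the sum has the default value 0.\<close>

definition conv :: "(nat \<Rightarrow> complex) \<Rightarrow> (nat \<Rightarrow> complex) \<Rightarrow> nat \<Rightarrow> complex" where
  "conv a b n = (\<Sum>d | d dvd n. a d * b (n div d))"

lemma norm_of_nat_powr: "norm (of_nat n powr s :: complex) = real n powr Re s"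
proof (cases "n = 0")
  case False
  then show ?thesis using norm_powr_real[of "of_nat n" s] by (simp add: powr_def)
qed auto

lemma norm_dseries_term: "norm (a n / of_nat n powr s :: complex) = norm (a n) / real n powr Re s"
  by (simp add: norm_divide norm_of_nat_powr)

lemma dseries_term_mono:
  assumes "\<sigma> \<le> \<sigma>'"
  shows "norm (a n :: complex) / real n powr \<sigma>' \<le> norm (a n) / real n powr \<sigma>"
proof (cases "n = 0")
  case False
  then show ?thesis using assms
    by (intro divide_left_mono powr_mono) auto
qed auto

lemma abs_conv_mono: "abs_conv a \<sigma> \<Longrightarrow> \<sigma> \<le> \<sigma>' \<Longrightarrow> abs_conv a \<sigma>'"
  unfolding abs_conv_def
  by (rule summable_comparison_test'[of _ 0]) (auto intro: dseries_term_mono)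

lemma abs_conv_iff_norm_summable:
  "abs_conv a (Re s) \<longleftrightarrow> summable (\<lambda>n. norm (a n / of_nat n powr s))"
  by (simp add: abs_conv_def norm_dseries_term)

lemma abs_conv_summable:
  assumes "abs_conv a \<sigma>" "\<sigma> \<le> Re s"
  shows "summable (\<lambda>n. a n / of_nat n powr s)"
  using abs_conv_mono[OF assms] by (simp add: abs_conv_iff_norm_summable summable_norm_cancel)

lemma norm_dseries_le:
  assumes "abs_conv a \<sigma>" "\<sigma> \<le> Re s"
  shows "norm (dseries a s) \<le> (\<Sum>n. norm (a n) / real n powr \<sigma>)"
proof -
  have "norm (dseries a s) \<le> (\<Sum>n. norm (a n / of_nat n powr s))"
    unfolding dseries_def
    using abs_conv_mono[OF assms] by (intro summable_norm) (simp add: abs_conv_iff_norm_summable)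
  also have "\<dots> \<le> (\<Sum>n. norm (a n) / real n powr \<sigma>)"
    using abs_conv_mono[OF assms] assms
    by (intro suminf_le) (auto simp: norm_dseries_term abs_conv_def intro: dseries_term_mono)
  finally show ?thesis .
qed

lemma abs_conv_bigo:
  assumes "(\<lambda>n. norm (a n)) \<in> O(\<lambda>n. real n powr A)" "\<sigma> > A + 1"
  shows "abs_conv a \<sigma>"
proof -
  obtain C where C: "C > 0" "eventually (\<lambda>n. norm (a n) \<le> C * real n powr A) at_top"
    using landau_o.bigE[OF assms(1)] by (auto simp: abs_mult)
  then obtain M where M: "\<And>n. n \<ge> M \<Longrightarrow> norm (a n) \<le> C * real n powr A"
    by (auto simp: eventually_at_top_linorder)
  have s: "summable (\<lambda>n. C * real n powr (A - \<sigma>))"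
    using assms(2) by (intro summable_mult) (simp add: summable_real_powr_iff)
  show ?thesis unfolding abs_conv_def
  proof (rule summable_comparison_test'[OF s, of M])
    fix n :: nat assume "n \<ge> M"
    then show "norm (norm (a n) / real n powr \<sigma>) \<le> C * real n powr (A - \<sigma>)"
      using M[of n] by (cases "n = 0") (auto simp: powr_diff divide_right_mono)
  qed
qed

lemma abs_conv_diff:
  assumes "abs_conv a \<sigma>" "abs_conv b \<sigma>"
  shows "abs_conv (\<lambda>n. a n - b n) \<sigma>"
  unfolding abs_conv_def
proof (rule summable_comparison_test'[of _ 0])
  show "summable (\<lambda>n. norm (a n) / real n powr \<sigma> + norm (b n) / real n powr \<sigma>)"
    using assms by (auto simp: abs_conv_def intro: summable_add)
qed (auto simp: add_divide_distrib[symmetric] intro!: divide_right_mono norm_triangle_ineq4)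

lemma abs_conv_mult_ln:
  assumes "abs_conv a \<sigma>" "\<sigma> < \<sigma>'"
  shows "abs_conv (\<lambda>n. a n * of_real (ln (real n))) \<sigma>'"
proof -
  define d where "d = \<sigma>' - \<sigma>"
  have d: "d > 0" using assms by (simp add: d_def)
  have s: "summable (\<lambda>n. (norm (a n) / real n powr \<sigma>) * (1/d))"
    using assms(1) unfolding abs_conv_def by (intro summable_mult2)
  show ?thesis unfolding abs_conv_def
  proof (rule summable_comparison_test'[OF s, of 0])
    fix n :: nat
    show "norm (norm (a n * of_real (ln (real n))) / real n powr \<sigma>') \<le> (norm (a n) / real n powr \<sigma>) * (1/d)"
    proof (cases "n = 0")
      case False
      have "ln (real n) \<le> real n powr d / d"
        using ln_powr_bound[of "real n" d] d False by simp
      then have *: "ln (real n) / real n powr d \<le> 1 / d"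
        using False d by (simp add: field_simps)
      have "norm (norm (a n * of_real (ln (real n))) / real n powr \<sigma>')
          = (norm (a n) / real n powr \<sigma>) * (ln (real n) / real n powr d)"
        using False by (simp add: norm_mult d_def powr_diff ln_ge_zero)
      also have "\<dots> \<le> (norm (a n) / real n powr \<sigma>) * (1/d)"
        by (intro mult_left_mono *) auto
      finally show ?thesis .
    qed auto
  qed
qed

lemma dseries_has_field_derivative:
  assumes "abs_conv a \<sigma>" "\<sigma> < Re s"
  shows "(dseries a has_field_derivative - dseries (\<lambda>n. a n * of_real (ln (real n))) s) (at s)"
proof -
  define S where "S = {s. \<sigma> < Re s}"
  have S: "open S" by (simp add: S_def open_halfspace_Re_gt)
  let ?f' = "\<lambda>n s. - (a n * of_real (ln (real n)) / of_nat n powr s)"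
    have "\<exists>g g'. \<forall>x\<in>S. ((\<lambda>n. a n / of_nat n powr x) sums g x) \<and> ((\<lambda>n. ?f' n x) sums g' x)
      \<and> (g has_field_derivative g' x) (at x)"
    proof (rule series_and_derivative_comparison_complex[OF S])
      fix n x assume "x \<in> S"
      show "((\<lambda>x. a n / of_nat n powr x) has_field_derivative ?f' n x) (at x)"
      proof (cases "n = 0")
        case False
        then show ?thesis
          by (auto intro!: derivative_eq_intros simp: field_simps power2_eq_square)
      qed auto
    next
      fix x assume "x \<in> S"
      show "\<exists>d h. 0 < d \<and> summable h \<and> range h \<subseteq> \<real>\<^sub>\<ge>\<^sub>0 \<and>
        (\<forall>\<^sub>F n in sequentially. \<forall>y\<in>ball x d \<inter> S. cmod (a n / of_nat n powr y) \<le> cmod (h n))"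
      proof (rule exI[of _ 1], rule exI[of _ "\<lambda>n. complex_of_real (norm (a n) / real n powr \<sigma>)"], intro conjI)
        show "summable (\<lambda>n. complex_of_real (norm (a n) / real n powr \<sigma>))"
          using assms(1) unfolding abs_conv_def by (rule summable_of_real)
        show "\<forall>\<^sub>F n in sequentially. \<forall>y\<in>ball x 1 \<inter> S.
            cmod (a n / of_nat n powr y) \<le> cmod (complex_of_real (norm (a n) / real n powr \<sigma>))"
        proof (intro always_eventually allI ballI)
          fix n y assume "y \<in> ball x 1 \<inter> S"
          then have "norm (a n) / real n powr Re y \<le> norm (a n) / real n powr \<sigma>"
            by (intro dseries_term_mono) (simp add: S_def)
          then show "cmod (a n / of_nat n powr y) \<le> cmod (complex_of_real (norm (a n) / real n powr \<sigma>))"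
            unfolding norm_dseries_term norm_of_real by simp
        qed
        show "range (\<lambda>n. complex_of_real (norm (a n) / real n powr \<sigma>)) \<subseteq> \<real>\<^sub>\<ge>\<^sub>0"
          unfolding image_subset_iff nonneg_Reals_of_real_iff by simp
      qed (rule zero_less_one)
    qed
  then obtain g g' where gg: "\<forall>x\<in>S. ((\<lambda>n. a n / of_nat n powr x) sums g x) \<and> ((\<lambda>n. ?f' n x) sums g' x)
      \<and> (g has_field_derivative g' x) (at x)" by (elim exE)
  have g: "(\<lambda>n. a n / of_nat n powr x) sums g x" "(\<lambda>n. ?f' n x) sums g' x" "(g has_field_derivative g' x) (at x)"
    if "x \<in> S" for x using bspec[OF gg that] by simp_all
  have s: "s \<in> S" using assms by (simp add: S_def)
  have "(dseries a has_field_derivative g' s) (at s)"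
    using g(3)[OF s]
    by (rule has_field_derivative_transform_within_open[OF _ S s])
       (use g(1) in \<open>auto simp: dseries_def sums_iff\<close>)
  also have "g' s = - dseries (\<lambda>n. a n * of_real (ln (real n))) s"
    using sums_minus[OF g(2)[OF s]] unfolding dseries_def by (simp add: sums_iff)
  finally show ?thesis .
qed

text \<open>Split the exponent \<open>x\<close> into \<open>x - \<sigma>\<close> and
  \<open>\<sigma>\<close>. Every index in the tail is at least \<open>Suc N\<close>, so the first
  part is at most \<open>(N / Suc N) powr (x - \<sigma>)\<close>, which is geometric decay in
  \<open>x\<close>; the second part leaves the convergent series at \<open>\<sigma>\<close>.\<close>

lemma dseries_tail_le:
  assumes "abs_conv a \<sigma>" "\<sigma> \<le> x" "N > 0"
  shows "summable (\<lambda>n. norm (a (n + Suc N)) * (real N / real (n + Suc N)) powr x)"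
    "(\<Sum>n. norm (a (n + Suc N)) * (real N / real (n + Suc N)) powr x)
      \<le> (real N / real (Suc N)) powr (x - \<sigma>) * (real N powr \<sigma> * (\<Sum>n. norm (a n) / real n powr \<sigma>))"
proof -
  let ?q = "(real N / real (Suc N)) powr (x - \<sigma>)"
  have le: "norm (a (n + Suc N)) * (real N / real (n + Suc N)) powr x
      \<le> ?q * (real N powr \<sigma> * (norm (a (n + Suc N)) / real (n + Suc N) powr \<sigma>))" for n
  proof -
    have "(real N / real (n + Suc N)) powr x
        = (real N / real (n + Suc N)) powr (x - \<sigma>) * (real N / real (n + Suc N)) powr \<sigma>"
      by (simp add: powr_add[symmetric])
    also have "\<dots> \<le> ?q * (real N / real (n + Suc N)) powr \<sigma>"
      using assms by (intro mult_right_mono powr_mono2 divide_left_mono) auto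
    also have "\<dots> = ?q * (real N powr \<sigma> / real (n + Suc N) powr \<sigma>)"
      by (subst powr_divide) auto
    finally show ?thesis
      using mult_left_mono[of _ _ "norm (a (n + Suc N))"] by (fastforce simp: mult_ac)
  qed
  have s: "summable (\<lambda>n. norm (a n) / real n powr \<sigma>)"
    using assms(1) by (simp add: abs_conv_def)
  have s': "summable (\<lambda>n. ?q * (real N powr \<sigma> * (norm (a (n + Suc N)) / real (n + Suc N) powr \<sigma>)))"
    by (intro summable_mult summable_ignore_initial_segment s)
  show *: "summable (\<lambda>n. norm (a (n + Suc N)) * (real N / real (n + Suc N)) powr x)"
    by (rule summable_comparison_test'[OF s', of 0]) (use le in auto)
  have "(\<Sum>n. norm (a (n + Suc N)) * (real N / real (n + Suc N)) powr x)
     \<le> (\<Sum>n. ?q * (real N powr \<sigma> * (norm (a (n + Suc N)) / real (n + Suc N) powr \<sigma>)))"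
    by (intro suminf_le le * s')
  also have "\<dots> = ?q * (real N powr \<sigma> * (\<Sum>n. norm (a (n + Suc N)) / real (n + Suc N) powr \<sigma>))"
    using summable_ignore_initial_segment[OF s, of "Suc N"]
    by (simp only: suminf_mult summable_mult)
  also have "\<dots> \<le> ?q * (real N powr \<sigma> * (\<Sum>n. norm (a n) / real n powr \<sigma>))"
    using suminf_split_initial_segment[OF s, of "Suc N"]
    by (intro mult_left_mono) (simp_all del: sum.lessThan_Suc add: sum_nonneg)
  finally show "(\<Sum>n. norm (a (n + Suc N)) * (real N / real (n + Suc N)) powr x) \<le> \<dots>" .
qed

lemma dseries_split:
  assumes "abs_conv a \<sigma>" "\<sigma> \<le> Re s" "N > 0"
  shows "norm (of_nat N powr s * (dseries a s - (\<Sum>n\<le>N. a n / of_nat n powr s)))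
    \<le> (\<Sum>n. norm (a (n + Suc N)) * (real N / real (n + Suc N)) powr Re s)"
proof -
  note s = abs_conv_summable[OF assms(1,2)]
  have "dseries a s - (\<Sum>n\<le>N. a n / of_nat n powr s) = (\<Sum>n. a (n + Suc N) / of_nat (n + Suc N) powr s)"
    unfolding dseries_def suminf_split_initial_segment[OF s, of "Suc N"] lessThan_Suc_atMost by simp
  then have eq: "of_nat N powr s * (dseries a s - (\<Sum>n\<le>N. a n / of_nat n powr s))
      = (\<Sum>n. of_nat N powr s * (a (n + Suc N) / of_nat (n + Suc N) powr s))"
    by (simp only: suminf_mult[OF summable_ignore_initial_segment[OF s]])
  have n: "norm (of_nat N powr s * (a (n + Suc N) / of_nat (n + Suc N) powr s))
      = norm (a (n + Suc N)) * (real N / real (n + Suc N)) powr Re s" for n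
    unfolding norm_mult norm_dseries_term norm_of_nat_powr
    by (subst powr_divide) auto
  show ?thesis unfolding eq
    using summable_norm[of "\<lambda>n. of_nat N powr s * (a (n + Suc N) / of_nat (n + Suc N) powr s)"]
      dseries_tail_le(1)[OF assms]
    unfolding n by blast
qed

text \<open>After multiplication by \<open>N powr x\<close> the term at \<open>N\<close> is
  constant, and the tail is at most a constant times
  \<open>(N / Suc N) powr (x - \<sigma>)\<close>.\<close>

lemma dseries_leading_coeff:
  assumes "abs_conv a \<sigma>" "N > 0" "\<And>n. 0 < n \<Longrightarrow> n < N \<Longrightarrow> a n = 0"
  shows "((\<lambda>x. of_nat N powr of_real x * dseries a (of_real x)) \<longlongrightarrow> a N) at_top"
proof -
  let ?K = "real N powr \<sigma> * (\<Sum>n. norm (a n) / real n powr \<sigma>)"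
  let ?q = "real N / real (Suc N)"
  have sm: "(\<Sum>n\<le>N. a n / of_nat n powr s) = a N / of_nat N powr s" for s
  proof -
    have "(\<Sum>n\<in>{..N}. a n / of_nat n powr s) = (\<Sum>n\<in>{N}. a n / of_nat n powr s)"
    proof (rule sum.mono_neutral_right)
      show "\<forall>i\<in>{..N} - {N}. a i / of_nat i powr s = 0"
      proof
        fix i assume "i \<in> {..N} - {N}"
        then show "a i / of_nat i powr s = 0" using assms(3)[of i] by (cases "i = 0") auto
      qed
    qed auto
    then show ?thesis by simp
  qed
  have "((\<lambda>x. of_nat N powr of_real x * dseries a (of_real x) - a N) \<longlongrightarrow> 0) at_top"
  proof (rule Lim_null_comparison)
    show "\<forall>\<^sub>F x in at_top. norm (of_nat N powr of_real x * dseries a (of_real x) - a N) \<le> ?q powr (x - \<sigma>) * ?K"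
      using eventually_ge_at_top[of \<sigma>]
    proof eventually_elim
      case (elim x)
      have "of_nat N powr of_real x * dseries a (of_real x) - a N
          = of_nat N powr of_real x * (dseries a (of_real x) - (\<Sum>n\<le>N. a n / of_nat n powr of_real x))"
        unfolding sm using assms(2) by (simp add: algebra_simps)
      also have "norm \<dots> \<le> ?q powr (x - \<sigma>) * ?K"
        using dseries_split[OF assms(1) _ assms(2), of "of_real x"] dseries_tail_le(2)[OF assms(1) elim assms(2)] elim
        by simp
      finally show ?case .
    qed
    have "((\<lambda>x. ?q powr (x - \<sigma>)) \<longlongrightarrow> 0) at_top"
    proof -
      have "?q powr (x - \<sigma>) = exp ((x - \<sigma>) * ln ?q)" for x
        using assms(2) by (simp add: powr_def)
      moreover have "ln ?q < 0" using assms(2) by simp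
      then have "((\<lambda>x. exp ((x - \<sigma>) * ln ?q)) \<longlongrightarrow> 0) at_top"
        by real_asymp
      ultimately show ?thesis by simp
    qed
    then show "((\<lambda>x. ?q powr (x - \<sigma>) * ?K) \<longlongrightarrow> 0) at_top"
      by (rule tendsto_mult_left_zero)
  qed
  then show ?thesis by (simp add: LIM_zero_iff)
qed

lemma dseries_tendsto_at_1:
  assumes "abs_conv a \<sigma>"
  shows "((\<lambda>x. dseries a (of_real x)) \<longlongrightarrow> a 1) at_top"
  using dseries_leading_coeff[OF assms, of 1] by simp

text \<open>Let \<open>N\<close> be the least positive index where the coefficients differ. The
  difference series then has the nonzero leading coefficient \<open>c N\<close>, yet it vanishes for
  all large real arguments.\<close>

lemma dseries_unique:
  assumes "abs_conv a \<sigma>" "abs_conv b \<sigma>" "eventually (\<lambda>x. dseries a (of_real x) = dseries b (of_real x)) at_top" "n > 0"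
  shows "a n = b n"
proof (rule ccontr)
  assume "a n \<noteq> b n"
  define c where "c = (\<lambda>n. a n - b n)"
  define N where "N = (LEAST n. n > 0 \<and> c n \<noteq> 0)"
  have N: "N > 0 \<and> c N \<noteq> 0" unfolding N_def
    by (rule LeastI[of _ n]) (use \<open>a n \<noteq> b n\<close> assms(4) in \<open>auto simp: c_def\<close>)
  have N': "c m = 0" if "0 < m" "m < N" for m
    using not_less_Least[of m "\<lambda>n. n > 0 \<and> c n \<noteq> 0"] that unfolding N_def by auto
  have ac: "abs_conv c \<sigma>" unfolding c_def by (rule abs_conv_diff[OF assms(1,2)])
  have "((\<lambda>x. of_nat N powr of_real x * dseries c (of_real x)) \<longlongrightarrow> c N) at_top"
    using dseries_leading_coeff[OF ac] N N' by blast
  moreover have "((\<lambda>x. of_nat N powr of_real x * dseries c (of_real x)) \<longlongrightarrow> 0) at_top"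
  proof (rule tendsto_eventually)
    show "\<forall>\<^sub>F x in at_top. of_nat N powr of_real x * dseries c (of_real x) = 0"
      using assms(3) eventually_ge_at_top[of \<sigma>]
    proof eventually_elim
      case (elim x)
      have "dseries c (of_real x) = dseries a (of_real x) - dseries b (of_real x)"
        unfolding dseries_def c_def diff_divide_distrib
        by (rule suminf_diff[symmetric]) (use elim abs_conv_summable[OF assms(1)] abs_conv_summable[OF assms(2)] in auto)
      then show ?case using elim by simp
    qed
  qed
  ultimately have "c N = 0" by (rule tendsto_unique[OF trivial_limit_at_top_linorder])
  with N show False by simp
qed

text \<open>The absolutely summable family over pairs \<open>(d, e)\<close> of positive integers is
  regrouped by the product \<open>d * e\<close>. Unconditional summation yields the identity and the
  absolute convergence from the same rearrangement.\<close>

lemma dseries_conv: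
  assumes "abs_conv a \<sigma>" "abs_conv b \<sigma>" "\<sigma> \<le> Re s"
  shows "abs_conv (conv a b) \<sigma>" "dseries (conv a b) s = dseries a s * dseries b s"
proof -
  have gen: "summable (\<lambda>n. norm (conv a b n / of_nat n powr s)) \<and> dseries (conv a b) s = dseries a s * dseries b s"
    if "\<sigma> \<le> Re s" for s
  proof -
    define f where "f = (\<lambda>n. a n / of_nat n powr s)"
    define g where "g = (\<lambda>n. b n / of_nat n powr s)"
    let ?P = "{0::nat<..}"
    have fs: "summable (\<lambda>n. norm (f n))" and gs: "summable (\<lambda>n. norm (g n))"
      using abs_conv_mono[OF assms(1) that] abs_conv_mono[OF assms(2) that]
      by (simp_all add: f_def g_def abs_conv_iff_norm_summable)
    have f0: "f 0 = 0" "g 0 = 0" by (simp_all add: f_def g_def)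
    have fa: "(\<lambda>n. norm (f n)) summable_on UNIV" "(\<lambda>n. norm (g n)) summable_on UNIV"
      using fs gs by (simp_all add: summable_on_UNIV_nonneg_real_iff)
    have fh: "(f has_sum dseries a s) UNIV" "(g has_sum dseries b s) UNIV"
      using norm_summable_imp_has_sum[OF fs, of "dseries a s"] norm_summable_imp_has_sum[OF gs, of "dseries b s"]
        abs_conv_summable[OF assms(1) that] abs_conv_summable[OF assms(2) that]
      by (simp_all add: f_def g_def dseries_def summable_sums)
    have fP: "(f has_sum dseries a s) ?P" "(g has_sum dseries b s) ?P"
      using f0 by (auto intro!: has_sum_cong_neutral[THEN iffD1, OF _ _ _ fh(1)]
          has_sum_cong_neutral[THEN iffD1, OF _ _ _ fh(2)] gr0I)
    have faP: "(\<lambda>n. norm (f n)) summable_on ?P" "(\<lambda>n. norm (g n)) summable_on ?P"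
      using fa summable_on_subset_banach by blast+
    have prod_abs: "(\<lambda>x. norm ((\<lambda>(d,e). f d * g e) x)) summable_on ?P \<times> ?P"
    proof (rule summable_on_SigmaI)
      fix d
      show "((\<lambda>e. norm ((\<lambda>(d,e). f d * g e) (d, e))) has_sum (norm (f d) * infsum (\<lambda>e. norm (g e)) ?P)) ?P"
        using has_sum_cmult_right[OF has_sum_infsum[OF faP(2)], of "norm (f d)"] by (simp add: norm_mult)
    next
      show "(\<lambda>d. norm (f d) * infsum (\<lambda>e. norm (g e)) ?P) summable_on ?P"
        by (rule summable_on_cmult_left[OF faP(1)])
    qed simp
    have prod_sum: "((\<lambda>(d,e). f d * g e) has_sum (dseries a s * dseries b s)) (?P \<times> ?P)"
    proof (rule has_sum_SigmaI)
      fix d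
      show "((\<lambda>e. (\<lambda>(d,e). f d * g e) (d, e)) has_sum (f d * dseries b s)) ?P"
        using has_sum_cmult_right[OF fP(2), of "f d"] by simp
    next
      show "((\<lambda>d. f d * dseries b s) has_sum (dseries a s * dseries b s)) ?P"
        by (rule has_sum_cmult_left[OF fP(1)])
    next
      show "(\<lambda>(d,e). f d * g e) summable_on ?P \<times> ?P"
        by (rule abs_summable_summable[OF prod_abs])
    qed
    \<comment> \<open>A pair \<open>(d, e)\<close> becomes \<open>(d * e, d)\<close>, so the fibre
      over \<open>n\<close> is the set of divisors of \<open>n\<close>; excluding 0 keeps the fibres
      finite.\<close>
    let ?S = "SIGMA n:?P. {d. d dvd n}"
    let ?h = "\<lambda>(n,d). f d * g (n div d)"
    have bij: "bij_betw (\<lambda>(d,e). (d * e, d)) (?P \<times> ?P) ?S"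
      by (rule bij_betwI[where g = "\<lambda>(n,d). (d, n div d)"]) (auto simp: dvd_div_eq_0_iff elim!: dvdE)
    have S_sum: "(?h has_sum (dseries a s * dseries b s)) ?S"
      using prod_sum
      by (subst has_sum_reindex_bij_betw[OF bij, symmetric]) (auto elim!: has_sum_cong[THEN iffD1, rotated])
    have S_abs: "(\<lambda>x. norm (?h x)) summable_on ?S"
      using prod_abs
      by (subst summable_on_reindex_bij_betw[OF bij, symmetric]) (auto elim!: summable_on_cong[THEN iffD1, rotated])
    have trm: "(\<Sum>d | d dvd n. f d * g (n div d)) = conv a b n / of_nat n powr s" if "n > 0" for n
      unfolding conv_def sum_divide_distrib
    proof (rule sum.cong)
      fix d assume "d \<in> {d. d dvd n}"
      then obtain e where e: "n = d * e" by (auto elim: dvdE)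
      with that have "d > 0" "e > 0" by auto
      then show "f d * g (n div d) = a d * b (n div d) / of_nat n powr s"
        unfolding f_def g_def e by (simp add: powr_times_real)
    qed simp
    have fin: "finite {d. d dvd n}" if "n \<in> ?P" for n using that by simp
    have S1: "((\<lambda>n. conv a b n / of_nat n powr s) has_sum (dseries a s * dseries b s)) ?P"
    proof (rule has_sum_Sigma'[OF S_sum])
      fix n assume "n \<in> ?P"
      then show "((\<lambda>d. ?h (n, d)) has_sum conv a b n / of_nat n powr s) {d. d dvd n}"
        using has_sum_finite[OF fin[OF \<open>n \<in> ?P\<close>], of "\<lambda>d. f d * g (n div d)"] trm[of n] by simp
    qed
    have S2: "(\<lambda>n. norm (conv a b n / of_nat n powr s)) summable_on ?P"
    proof (rule summable_on_comparison_test)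
      show "(\<lambda>n. infsum (\<lambda>d. norm (?h (n,d))) {d. d dvd n}) summable_on ?P"
        using summable_on_Sigma_banach[of "\<lambda>n d. norm (?h (n,d))" ?P "\<lambda>n. {d. d dvd n}"] S_abs
        by (simp add: case_prod_unfold)
      fix n assume n: "n \<in> ?P"
      show "norm (conv a b n / of_nat n powr s) \<le> infsum (\<lambda>d. norm (?h (n,d))) {d. d dvd n}"
        using n trm[of n] by (simp add: infsum_finite[OF fin[OF n]]) (metis (no_types, lifting) norm_sum sum.cong)
    qed auto
    have z: "conv a b n / of_nat n powr s = 0" if "n \<notin> ?P" for n using that by simp
    have S2': "(\<lambda>n. norm (conv a b n / of_nat n powr s)) summable_on UNIV"
      using S2 by (rule summable_on_cong_neutral[THEN iffD1, rotated -1]) auto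
    have S1': "((\<lambda>n. conv a b n / of_nat n powr s) has_sum (dseries a s * dseries b s)) UNIV"
      using S1 by (rule has_sum_cong_neutral[THEN iffD1, rotated -1]) auto
    show ?thesis
      using S2' has_sum_imp_sums[OF S1'] by (simp add: summable_on_UNIV_nonneg_real_iff sums_iff dseries_def)
  qed
  show "abs_conv (conv a b) \<sigma>"
    using gen[of "of_real \<sigma>"] abs_conv_iff_norm_summable[of "conv a b" "of_real \<sigma>"] by simp
  show "dseries (conv a b) s = dseries a s * dseries b s"
    using gen[OF assms(3)] by simp
qed

section \<open>Integrals along vertical lines\<close>


text \<open>Finite-order growth in a form closed under sums, products and affine substitution: the
  bound holds on the whole plane, and the base \<open>1 + norm z\<close> is at least 1, so that the
  exponent \<open>j\<close> can always be enlarged.\<close>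

definition exp_growth :: "(complex \<Rightarrow> complex) \<Rightarrow> bool" where
  "exp_growth f \<longleftrightarrow> (\<exists>C j. C \<ge> 0 \<and> (\<forall>z. norm (f z) \<le> exp (C * (1 + norm z) ^ j)))"

text \<open>The contour integral over \<open>Re z = c\<close> against the kernel, up to the factor
  \<open>\<i>\<close>.\<close>

definition line_int :: "(complex \<Rightarrow> complex) \<Rightarrow> real \<Rightarrow> complex" where
  "line_int f c = (LINT y|lborel. f (Complex c y) * exp (- cos (Complex c y)))"

lemma exp_growth_mult:
  assumes "exp_growth f" "exp_growth g"
  shows "exp_growth (\<lambda>z. f z * g z)"
proof -
  obtain C j where f: "C \<ge> 0" "\<And>z. norm (f z) \<le> exp (C * (1 + norm z) ^ j)"
    using assms(1) by (auto simp: exp_growth_def)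
  obtain D k where g: "D \<ge> 0" "\<And>z. norm (g z) \<le> exp (D * (1 + norm z) ^ k)"
    using assms(2) by (auto simp: exp_growth_def)
  have "norm (f z * g z) \<le> exp ((C + D) * (1 + norm z) ^ (j + k))" for z
  proof -
    have "norm (f z * g z) \<le> exp (C * (1 + norm z) ^ j) * exp (D * (1 + norm z) ^ k)"
      unfolding norm_mult using f(2) g(2) by (intro mult_mono) auto
    also have "\<dots> \<le> exp (C * (1 + norm z) ^ (j + k)) * exp (D * (1 + norm z) ^ (j + k))"
      using f(1) g(1) by (intro mult_mono iffD2[OF exp_le_cancel_iff] mult_left_mono power_increasing) auto
    finally show ?thesis by (simp add: exp_add[symmetric] algebra_simps)
  qed
  then show ?thesis using f(1) g(1) unfolding exp_growth_def
    by (intro exI[of _ "C + D"] exI[of _ "j + k"]) auto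
qed

lemma exp_growth_const: "exp_growth (\<lambda>_. c)"
proof -
  have "norm c \<le> exp (norm c * (1 + norm (z::complex)) ^ 0)" for z
    using exp_ge_add_one_self[of "norm c"] by (simp del: exp_ge_add_one_self)
  then show ?thesis unfolding exp_growth_def by (metis norm_ge_zero)
qed

lemma exp_growth_ident: "exp_growth (\<lambda>z. z)"
proof -
  have "norm z \<le> exp (1 * (1 + norm (z::complex)) ^ 1)" for z
    using exp_ge_add_one_self[of "1 + norm z"] by simp
  then show ?thesis unfolding exp_growth_def by (metis zero_le_one)
qed

lemma exp_growth_power: "exp_growth f \<Longrightarrow> exp_growth (\<lambda>z. f z ^ n)"
  by (induction n) (auto intro: exp_growth_mult exp_growth_const)

lemma exp_growth_add:
  assumes "exp_growth f" "exp_growth g"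
  shows "exp_growth (\<lambda>z. f z + g z)"
proof -
  obtain C j where f: "C \<ge> 0" "\<And>z. norm (f z) \<le> exp (C * (1 + norm z) ^ j)"
    using assms(1) by (auto simp: exp_growth_def)
  obtain D k where g: "D \<ge> 0" "\<And>z. norm (g z) \<le> exp (D * (1 + norm z) ^ k)"
    using assms(2) by (auto simp: exp_growth_def)
  have "norm (f z + g z) \<le> exp ((C + D + 1) * (1 + norm z) ^ (j + k))" for z
  proof -
    define X where "X = (1 + norm z) ^ (j + k)"
    have X: "(1 + norm z) ^ j \<le> X" "(1 + norm z) ^ k \<le> X" "1 \<le> X"
      unfolding X_def by (intro power_increasing one_le_power; simp)+
    have "C * (1 + norm z) ^ j \<le> (C + D) * X" "D * (1 + norm z) ^ k \<le> (C + D) * X"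
      using f(1) g(1) X by (intro mult_mono; simp)+
    then have "norm (f z) \<le> exp ((C + D) * X)" "norm (g z) \<le> exp ((C + D) * X)"
      using f(2)[of z] g(2)[of z] by (meson exp_le_cancel_iff order_trans)+
    then have "norm (f z + g z) \<le> 2 * exp ((C + D) * X)"
      using norm_triangle_ineq[of "f z" "g z"] by linarith
    also have "\<dots> \<le> exp X * exp ((C + D) * X)"
      using exp_ge_add_one_self[of X] X(3) by (intro mult_right_mono) (linarith, simp)
    finally show ?thesis by (simp add: X_def exp_add[symmetric] algebra_simps)
  qed
  then show ?thesis using f(1) g(1) unfolding exp_growth_def
    by (intro exI[of _ "C + D + 1"] exI[of _ "j + k"]) auto
qed

lemma exp_growth_sum:
  assumes "\<And>n. n \<in> A \<Longrightarrow> exp_growth (f n)"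
  shows "exp_growth (\<lambda>z. \<Sum>n\<in>A. f n z)"
  using assms
  by (induction A rule: infinite_finite_induct) (auto intro: exp_growth_add exp_growth_const)

lemma exp_growth_uminus: "exp_growth f \<Longrightarrow> exp_growth (\<lambda>z. - f z)"
  by (simp add: exp_growth_def)

lemma exp_growth_affine:
  assumes "exp_growth f"
  shows "exp_growth (\<lambda>z. f (a + b * z))"
proof -
  obtain C j where f: "C \<ge> 0" "\<And>z. norm (f z) \<le> exp (C * (1 + norm z) ^ j)"
    using assms(1) by (auto simp: exp_growth_def)
  let ?M = "1 + norm a + norm b"
  have "norm (f (a + b * z)) \<le> exp ((C * ?M ^ j) * (1 + norm z) ^ j)" for z
  proof -
    have "norm b * norm z \<ge> 0" "norm a * norm z \<ge> 0" by simp_all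
    then have "1 + norm (a + b * z) \<le> ?M * (1 + norm z)"
      using norm_triangle_ineq[of a "b * z"] norm_ge_zero[of b] norm_ge_zero[of z]
      unfolding norm_mult distrib_left distrib_right mult_1_left mult_1_right by linarith
    then have "(1 + norm (a + b * z)) ^ j \<le> (?M * (1 + norm z)) ^ j" by (intro power_mono) auto
    then have "C * (1 + norm (a + b * z)) ^ j \<le> (C * ?M ^ j) * (1 + norm z) ^ j"
      using mult_left_mono[OF _ f(1)] by (simp add: power_mult_distrib mult.assoc)
    then show ?thesis using f(2)[of "a + b * z"] by (meson exp_le_cancel_iff order_trans)
  qed
  then show ?thesis using f(1) unfolding exp_growth_def
    by (intro exI[of _ "C * ?M ^ j"] exI[of _ j]) auto
qed

lemma exp_growth_exp_linear: "exp_growth (\<lambda>z. exp (c * z))"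
proof -
  have "norm (exp (c * z)) \<le> exp (norm c * (1 + norm z) ^ 1)" for z
  proof -
    have "Re (c * z) \<le> norm c * norm z" using complex_Re_le_cmod[of "c * z"] by (simp add: norm_mult)
    also have "\<dots> \<le> norm c * (1 + norm z)" by (intro mult_left_mono) auto
    finally show ?thesis by simp
  qed
  then show ?thesis unfolding exp_growth_def by (metis norm_ge_zero)
qed

lemma entire_finite_order_imp_exp_growth:
  assumes "entire_finite_order G"
  shows "exp_growth G"
proof -
  have hol: "G holomorphic_on UNIV" using assms by (simp add: entire_finite_order_def)
  obtain \<rho> :: real where "(\<lambda>z. norm (G z)) \<in> O[at_infinity](\<lambda>z. exp (norm z powr \<rho>))"
    using assms by (auto simp: entire_finite_order_def)
  then obtain c where c: "c > 0" "eventually (\<lambda>z. norm (G z) \<le> c * exp (norm z powr \<rho>)) at_infinity"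
    using landau_o.bigE by force
  then obtain R where R: "\<And>z. norm z \<ge> R \<Longrightarrow> norm (G z) \<le> c * exp (norm z powr \<rho>)" "R \<ge> 1"
    unfolding eventually_at_infinity by (metis max.cobounded2 max.boundedE)
  have "compact (cball 0 R :: complex set)" by simp
  then have "bounded (G ` cball 0 R)"
    by (intro compact_imp_bounded compact_continuous_image holomorphic_on_imp_continuous_on
        holomorphic_on_subset[OF hol]) auto
  then obtain B where B: "\<And>z. norm z \<le> R \<Longrightarrow> norm (G z) \<le> B"
    unfolding bounded_iff by (metis imageI mem_cball_0)
  define j where "j = nat \<lceil>\<rho>\<rceil>"
  have j: "\<rho> \<le> real j" unfolding j_def by linarith
  \<comment> \<open>\<open>\<bar>B\<bar>\<close> serves the disc of radius \<open>R\<close>; outside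
    it, \<open>c\<close> absorbs the factor \<open>c \<le> exp c\<close> and the summand 1 covers
    the exponent \<open>norm z powr \<rho>\<close>.\<close>
  define C where "C = \<bar>B\<bar> + c + 1"
  have C: "C > 0" using c by (simp add: C_def)
  have "norm (G z) \<le> exp (C * (1 + norm z) ^ j)" for z
  proof -
    have p: "(1 + norm z) ^ j \<ge> 1" by simp
    show ?thesis
    proof (cases "norm z \<le> R")
      case True
      have "norm (G z) \<le> C" using B[OF True] c by (simp add: C_def)
      also have "C \<le> exp (C * 1)" using exp_ge_add_one_self[of C] unfolding mult_1_right by linarith
      also have "\<dots> \<le> exp (C * (1 + norm z) ^ j)"
        using p C by (intro iffD2[OF exp_le_cancel_iff] mult_left_mono) auto
      finally show ?thesis .
    next
      case False
      have "norm z powr \<rho> \<le> (1 + norm z) ^ j"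
      proof (cases "\<rho> \<ge> 0")
        case True
        have "norm z powr \<rho> \<le> (1 + norm z) powr \<rho>" using True by (intro powr_mono2) auto
        also have "\<dots> \<le> (1 + norm z) powr real j" using j by (intro powr_mono) auto
        finally show ?thesis by (simp add: powr_realpow add_pos_nonneg)
      next
        case F: False
        have "norm z powr \<rho> \<le> norm z powr 0" using F False R(2) by (intro powr_mono) auto
        also have "\<dots> \<le> (1 + norm z) ^ j" using p by simp
        finally show ?thesis .
      qed
      then have "c * exp (norm z powr \<rho>) \<le> exp c * exp ((1 + norm z) ^ j)"
        using c exp_ge_add_one_self[of c] by (intro mult_mono) (linarith, auto)
      also have "\<dots> = exp (c * 1 + 1 * (1 + norm z) ^ j)" by (simp add: exp_add)
      also have "\<dots> \<le> exp (C * (1 + norm z) ^ j)"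
      proof (rule iffD2[OF exp_le_cancel_iff])
        have "c * 1 \<le> c * (1 + norm z) ^ j" using p c by (intro mult_left_mono) auto
        moreover have "0 \<le> \<bar>B\<bar> * (1 + norm z) ^ j" by simp
        ultimately show "c * 1 + 1 * (1 + norm z) ^ j \<le> C * (1 + norm z) ^ j"
          unfolding C_def distrib_right by linarith
      qed
      finally show ?thesis using R(1)[of z] False by linarith
    qed
  qed
  then show ?thesis using C unfolding exp_growth_def by (meson less_imp_le)
qed

section \<open>Domination by the kernel and contour shifts\<close>

lemma lborel_integrable_inverse_square: "integrable lborel (\<lambda>y::real. inverse (1 + y\<^sup>2))"
  using Sinc_Integral.integrable_inverse_1_plus_square by (simp add: set_integrable_def)

lemma one_plus_sq_le_exp: "1 + (y::real)\<^sup>2 \<le> 2 * exp \<bar>y\<bar>"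
proof -
  have "exp \<bar>y\<bar> \<ge> 1 + \<bar>y\<bar> + \<bar>y\<bar>\<^sup>2 / 2" by (rule exp_lower_Taylor_quadratic) simp
  then show ?thesis by simp
qed

lemma power_le_exp:
  assumes "(x::real) \<ge> 0" shows "x ^ j \<le> fact j * exp x"
proof -
  have "(\<Sum>n\<in>{j}. inverse (fact n) * x ^ n) \<le> (\<Sum>n. inverse (fact n) * x ^ n)"
    using assms summable_exp[of x] by (intro sum_le_suminf) auto
  then show ?thesis by (simp add: exp_def field_simps)
qed

lemma exp_le_cosh: "exp \<bar>y\<bar> \<le> 2 * cosh (y::real)"
  by (auto simp: cosh_def abs_if)

text \<open>The real part of the cosine is \<open>cos c * cosh y\<close>. As
  \<open>\<bar>c\<bar> \<le> 1 < pi / 3\<close>, the first factor is at least \<open>1 / 2\<close>,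
  and the second is at least \<open>exp \<bar>y\<bar> / 2\<close>.\<close>

lemma norm_kernel_le:
  assumes "\<bar>c\<bar> \<le> 1"
  shows "norm (exp (- cos (Complex c y))) \<le> exp (- (exp \<bar>y\<bar> / 4))"
proof -
  have "Re (cos (Complex c y)) = cos c * cosh y"
    by (simp add: Re_cos cosh_def field_simps)
  have "cos \<bar>c\<bar> \<ge> cos (pi / 3)"
    using assms pi_gt3 by (intro cos_monotone_0_pi_le) auto
  then have "1 / 2 \<le> cos c" by (simp add: cos_60)
  then have "1 / 2 * (exp \<bar>y\<bar> / 2) \<le> cos c * cosh y"
    using exp_le_cosh[of y] by (intro mult_mono) auto
  then show ?thesis using \<open>Re (cos (Complex c y)) = cos c * cosh y\<close> by simp
qed

lemma norm_Complex_le: "\<bar>c\<bar> \<le> 1 \<Longrightarrow> norm (Complex c y) \<le> 1 + \<bar>y\<bar>"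
  using cmod_le[of "Complex c y"] by simp

text \<open>With \<open>X = exp (\<bar>y\<bar> / 2)\<close>, the polynomial exponent of the growth
  bound is at most \<open>D * X\<close>, whereas the kernel contributes \<open>- X ^ 2 / 4\<close>.
  Completing the square leaves a constant minus \<open>2 * X\<close>, and
  \<open>2 * X \<ge> \<bar>y\<bar>\<close>. The bound is uniform in \<open>c\<close>, as the
  horizontal segments of a contour shift require.\<close>

lemma kernel_bound:
  assumes "exp_growth f"
  obtains K where "K \<ge> 0" "\<And>c y. \<bar>c\<bar> \<le> 1 \<Longrightarrow>
    norm (f (Complex c y) * exp (- cos (Complex c y))) \<le> K * inverse (1 + y\<^sup>2)"
proof -
  obtain C j where f: "C \<ge> 0" "\<And>z. norm (f z) \<le> exp (C * (1 + norm z) ^ j)"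
    using assms(1) by (auto simp: exp_growth_def)
  define D where "D = C * (2 ^ j * fact j * exp 1)"
  have D: "D \<ge> 0" using f(1) by (simp add: D_def)
  define K where "K = 2 * exp ((D + 2)\<^sup>2)"
  have "norm (f (Complex c y) * exp (- cos (Complex c y))) \<le> K * inverse (1 + y\<^sup>2)" if c: "\<bar>c\<bar> \<le> 1" for c y
  proof -
    define X where "X = exp (\<bar>y\<bar> / 2)"
    have X1: "X \<ge> 1 + \<bar>y\<bar> / 2" unfolding X_def by (rule exp_ge_add_one_self)
    have X2: "exp \<bar>y\<bar> = X\<^sup>2" unfolding X_def by (simp add: power2_eq_square flip: exp_add)
    have "(1 + norm (Complex c y)) ^ j \<le> (2 + \<bar>y\<bar>) ^ j"
      using norm_Complex_le[OF c, of y] by (intro power_mono) auto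
    also have "\<dots> = 2 ^ j * (1 + \<bar>y\<bar> / 2) ^ j" by (simp flip: power_mult_distrib)
    also have "\<dots> \<le> 2 ^ j * (fact j * exp (1 + \<bar>y\<bar> / 2))"
      by (intro mult_left_mono power_le_exp) auto
    also have "\<dots> = (2 ^ j * fact j * exp 1) * X" by (simp add: X_def exp_add)
    finally have "C * (1 + norm (Complex c y)) ^ j \<le> D * X"
      using mult_left_mono[OF _ f(1)] unfolding D_def by (metis mult.assoc)
    then have "norm (f (Complex c y)) \<le> exp (D * X)"
      using f(2)[of "Complex c y"] by (meson exp_le_cancel_iff order_trans)
    then have "norm (f (Complex c y) * exp (- cos (Complex c y))) \<le> exp (D * X) * exp (- (exp \<bar>y\<bar> / 4))"
      unfolding norm_mult using norm_kernel_le[OF c, of y] by (intro mult_mono) auto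
    also have "\<dots> = exp (D * X - X\<^sup>2 / 4)" unfolding X2 exp_add[symmetric] by simp
    also have "\<dots> \<le> exp ((D + 2)\<^sup>2 - \<bar>y\<bar>)"
    proof (rule iffD2[OF exp_le_cancel_iff])
      have "\<bar>y\<bar> \<le> 2 * X" using X1 by linarith
      moreover have "(D + 2) * X - X\<^sup>2 / 4 \<le> (D + 2)\<^sup>2"
        using zero_le_power2[of "X / 2 - (D + 2)"] by (simp add: power2_eq_square algebra_simps)
      ultimately show "D * X - X\<^sup>2 / 4 \<le> (D + 2)\<^sup>2 - \<bar>y\<bar>" by (simp add: algebra_simps)
    qed
    also have "\<dots> = exp ((D + 2)\<^sup>2) * inverse (exp \<bar>y\<bar>)" by (simp add: exp_diff divide_inverse)
    also have "\<dots> \<le> exp ((D + 2)\<^sup>2) * (2 * inverse (1 + y\<^sup>2))"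
    proof (intro mult_left_mono)
      have "1 + y\<^sup>2 > 0" by (simp add: add_pos_nonneg)
      then show "inverse (exp \<bar>y\<bar>) \<le> 2 * inverse (1 + y\<^sup>2)"
        using one_plus_sq_le_exp[of y] by (simp add: field_simps)
    qed auto
    finally show ?thesis by (simp add: K_def)
  qed
  moreover have "K \<ge> 0" by (simp add: K_def)
  ultimately show ?thesis using that by blast
qed

lemma continuous_on_Complex [continuous_intros]: "continuous_on A (\<lambda>y. Complex c y)"
  unfolding complex_eq_iff Complex_eq by (intro continuous_intros)

lemma line_integrand_continuous:
  assumes "f holomorphic_on UNIV"
  shows "continuous_on UNIV (\<lambda>y. f (Complex c y) * exp (- cos (Complex c y)))"
  by (intro continuous_intros continuous_on_compose2[OF holomorphic_on_imp_continuous_on[OF assms]]) auto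

lemma integrable_line:
  assumes "f holomorphic_on UNIV" "exp_growth f" "\<bar>c\<bar> \<le> 1"
  shows "integrable lborel (\<lambda>y. f (Complex c y) * exp (- cos (Complex c y)))"
proof -
  obtain K where K: "K \<ge> 0" "\<And>c y. \<bar>c\<bar> \<le> 1 \<Longrightarrow>
    norm (f (Complex c y) * exp (- cos (Complex c y))) \<le> K * inverse (1 + y\<^sup>2)"
    using kernel_bound[OF assms(2)] by blast
  show ?thesis
  proof (rule Bochner_Integration.integrable_bound)
    show "integrable lborel (\<lambda>y. K * inverse (1 + y\<^sup>2))"
      by (intro integrable_mult_right lborel_integrable_inverse_square)
    show "(\<lambda>y. f (Complex c y) * exp (- cos (Complex c y))) \<in> borel_measurable lborel"
      using borel_measurable_continuous_onI[OF line_integrand_continuous[OF assms(1)]] by simp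
    show "AE y in lborel. norm (f (Complex c y) * exp (- cos (Complex c y))) \<le> norm (K * inverse (1 + y\<^sup>2))"
      using order_trans[OF K(2)[OF assms(3)] abs_ge_self] by (intro AE_I2) (simp only: real_norm_def)
  qed
qed

text \<open>Cauchy's theorem by way of an entire primitive \<open>P\<close> of the integrand:
  truncated vertical integrals are increments of \<open>P\<close>, and those on two lines differ by
  increments of \<open>P\<close> along horizontal segments at heights \<open>R\<close> and
  \<open>- R\<close>, which tend to 0 by the uniform kernel bound.\<close>

lemma line_int_shift:
  assumes hol: "f holomorphic_on UNIV" and gr: "exp_growth f" and c: "\<bar>c\<bar> \<le> 1" and c': "\<bar>c'\<bar> \<le> 1"
  shows "line_int f c = line_int f c'"
proof -
  define g where "g = (\<lambda>z. f z * exp (- cos z))"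
  have "g holomorphic_on UNIV" unfolding g_def by (intro holomorphic_intros hol)
  then obtain P where P: "\<And>z. (P has_field_derivative g z) (at z)"
    using holomorphic_convex_primitive'[of UNIV g] by auto
  obtain K where K: "K \<ge> 0" "\<And>c y. \<bar>c\<bar> \<le> 1 \<Longrightarrow> norm (g (Complex c y)) \<le> K * inverse (1 + y\<^sup>2)"
    using kernel_bound[OF gr] unfolding g_def by blast
  define I where "I = (\<lambda>c R. LINT y|lborel. indicator {-R..R} y *\<^sub>R g (Complex c y))"
  have I: "I c R = (P (Complex c R) - P (Complex c (- R))) / \<i>" if "R \<ge> 0" for c R
  proof -
    have "((\<lambda>y. g (Complex c y)) has_integral (P (Complex c R) / \<i> - P (Complex c (-R)) / \<i>)) {-R..R}"
    proof (rule fundamental_theorem_of_calculus)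
      fix y assume "y \<in> {-R..R}"
      have "((\<lambda>y. Complex c y) has_vector_derivative \<i>) (at y within {-R..R})"
        unfolding Complex_eq by (auto intro!: derivative_eq_intros)
      from field_vector_diff_chain_within[OF this, of P "g (Complex c y)"] P
      have "((\<lambda>y. P (Complex c y)) has_vector_derivative \<i> * g (Complex c y)) (at y within {-R..R})"
        by (auto simp: o_def intro: has_field_derivative_at_within)
      from has_vector_derivative_divide[OF this, of \<i>]
      show "((\<lambda>y. P (Complex c y) / \<i>) has_vector_derivative g (Complex c y)) (at y within {-R..R})"
        by simp
    qed (use that in auto)
    moreover have "set_integrable lborel {-R..R} (\<lambda>y. g (Complex c y))"
      unfolding g_def
      by (rule borel_integrable_atLeastAtMost') (rule continuous_on_subset[OF line_integrand_continuous[OF hol]], simp)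
    ultimately show ?thesis
      unfolding I_def using set_borel_integral_eq_integral(2) integral_unique
      by (metis diff_divide_distrib set_lebesgue_integral_def)
  qed
  have lim: "((\<lambda>R. I c R) \<longlongrightarrow> line_int f c) at_top" if "\<bar>c\<bar> \<le> 1" for c
    unfolding I_def line_int_def
  proof (rule integral_dominated_convergence_at_top[where w = "\<lambda>y. K * inverse (1 + y\<^sup>2)"])
    show "integrable lborel (\<lambda>y. K * inverse (1 + y\<^sup>2))"
      by (intro integrable_mult_right lborel_integrable_inverse_square)
    show "(\<lambda>y. f (Complex c y) * exp (- cos (Complex c y))) \<in> borel_measurable lborel"
      using borel_measurable_continuous_onI[OF line_integrand_continuous[OF hol]] by simp
    then have [measurable]: "(\<lambda>y. g (Complex c y)) \<in> borel_measurable borel" by (simp add: g_def)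
    show "(\<lambda>y. indicator {-R..R} y *\<^sub>R g (Complex c y)) \<in> borel_measurable lborel" for R by simp
    show "\<forall>\<^sub>F R in at_top. AE y in lborel. norm (indicator {-R..R} y *\<^sub>R g (Complex c y)) \<le> K * inverse (1 + y\<^sup>2)"
    proof (intro always_eventually allI AE_I2)
      fix R y :: real
      have "norm (indicator {-R..R} y *\<^sub>R g (Complex c y)) \<le> norm (g (Complex c y))"
        by (simp split: split_indicator)
      then show "norm (indicator {-R..R} y *\<^sub>R g (Complex c y)) \<le> K * inverse (1 + y\<^sup>2)"
        using K(2)[OF that, of y] by linarith
    qed
    show "AE y in lborel. ((\<lambda>R. indicator {-R..R} y *\<^sub>R g (Complex c y)) \<longlongrightarrow> f (Complex c y) * exp (- cos (Complex c y))) at_top"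
    proof (intro AE_I2 tendsto_eventually)
      fix y :: real
      show "\<forall>\<^sub>F R in at_top. indicator {-R..R} y *\<^sub>R g (Complex c y) = f (Complex c y) * exp (- cos (Complex c y))"
        using eventually_ge_at_top[of "\<bar>y\<bar>"] by eventually_elim (auto simp: g_def indicator_def)
    qed
  qed
  have horiz: "norm (P (Complex c R) - P (Complex c' R)) \<le> K * inverse (1 + R\<^sup>2) * 2" for R
  proof -
    let ?S = "{z. Re z \<ge> -1} \<inter> {z. Re z \<le> 1} \<inter> {z. Im z = R}"
    have "norm (P (Complex c R) - P (Complex c' R)) \<le> (K * inverse (1 + R\<^sup>2)) * norm (Complex c R - Complex c' R)"
    proof (rule field_differentiable_bound[of ?S P g])
      show "convex ?S"
        by (intro convex_Int convex_halfspace_Re_ge convex_halfspace_Re_le)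
           (auto simp: convex_alt algebra_simps)
      fix z assume z: "z \<in> ?S"
      show "(P has_field_derivative g z) (at z within ?S)" by (rule has_field_derivative_at_within[OF P])
      show "norm (g z) \<le> K * inverse (1 + R\<^sup>2)"
        using K(2)[of "Re z" "Im z"] z by (simp add: abs_le_iff)
    qed (use c c' in auto)
    also have "\<dots> \<le> K * inverse (1 + R\<^sup>2) * 2"
    proof (rule mult_left_mono)
      have "Complex c R - Complex c' R = of_real (c - c')" by (simp add: complex_eq_iff)
      then show "norm (Complex c R - Complex c' R) \<le> 2" using c c' by (simp only: norm_of_real)
    qed (use K in auto)
    finally show ?thesis .
  qed
  have "((\<lambda>R. I c R - I c' R) \<longlongrightarrow> 0) at_top"
  proof (rule Lim_null_comparison)
    show "\<forall>\<^sub>F R in at_top. norm (I c R - I c' R) \<le> K * inverse (1 + R\<^sup>2) * 4"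
      using eventually_ge_at_top[of 0]
    proof eventually_elim
      case (elim R)
      have "I c R - I c' R = ((P (Complex c R) - P (Complex c' R)) - (P (Complex c (-R)) - P (Complex c' (-R)))) / \<i>"
        unfolding I[OF elim] by (simp add: field_simps)
      then have "norm (I c R - I c' R) \<le> norm (P (Complex c R) - P (Complex c' R)) + norm (P (Complex c (-R)) - P (Complex c' (-R)))"
        by (simp only: norm_divide norm_ii div_by_1 norm_triangle_ineq4)
      then show ?case using horiz[of R] horiz[of "-R"] by simp
    qed
    show "((\<lambda>R. K * inverse (1 + R\<^sup>2) * 4) \<longlongrightarrow> 0) at_top" by real_asymp
  qed
  moreover have "((\<lambda>R. I c R - I c' R) \<longlongrightarrow> line_int f c - line_int f c') at_top"
    by (intro tendsto_diff lim c c')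
  ultimately have "line_int f c - line_int f c' = 0"
    using tendsto_unique trivial_limit_at_top_linorder by blast
  then show ?thesis by simp
qed

lemma line_int_sum:
  assumes "\<And>n. n \<in> A \<Longrightarrow> f n holomorphic_on UNIV" "\<And>n. n \<in> A \<Longrightarrow> exp_growth (f n)" "\<bar>c\<bar> \<le> 1"
  shows "line_int (\<lambda>z. \<Sum>n\<in>A. f n z) c = (\<Sum>n\<in>A. line_int (f n) c)"
  unfolding line_int_def sum_distrib_right
  by (rule Bochner_Integration.integral_sum) (intro integrable_line assms)

text \<open>Half of the kernel's exponent \<open>exp \<bar>y\<bar> / 4\<close> is kept here as an
  integrable weight; the other half is spent on absorbing a factor
  \<open>exp (A * \<bar>y\<bar>)\<close>.\<close>

definition wt :: "nat \<Rightarrow> real \<Rightarrow> real" where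
  "wt m y = (1 + \<bar>y\<bar>) ^ m * exp (- (exp \<bar>y\<bar> / 8))"

lemma integrable_wt: "integrable lborel (wt m)"
proof (rule Bochner_Integration.integrable_bound)
  define K where "K = fact (m + 2) * exp 1 * (8::real)"
  show "integrable lborel (\<lambda>y. K * inverse (1 + y\<^sup>2))"
    by (intro integrable_mult_right lborel_integrable_inverse_square)
  show "wt m \<in> borel_measurable lborel" unfolding wt_def by measurable
  have "norm (wt m y) \<le> norm (K * inverse (1 + y\<^sup>2))" for y
  proof -
    have pos: "1 + y\<^sup>2 > 0" by (simp add: add_pos_nonneg)
    have "1 + y\<^sup>2 \<le> (1 + \<bar>y\<bar>)\<^sup>2" by (simp add: power2_eq_square algebra_simps)
    then have "wt m y * (1 + y\<^sup>2) \<le> wt m y * (1 + \<bar>y\<bar>)\<^sup>2"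
      by (intro mult_left_mono) (auto simp: wt_def)
    also have "\<dots> = (1 + \<bar>y\<bar>) ^ (m + 2) * exp (- (exp \<bar>y\<bar> / 8))" by (simp add: wt_def power_add power2_eq_square)
    also have "\<dots> \<le> (fact (m + 2) * exp (1 + \<bar>y\<bar>)) * exp (- (exp \<bar>y\<bar> / 8))"
      by (intro mult_right_mono power_le_exp) auto
    also have "\<dots> = fact (m + 2) * exp 1 * (exp \<bar>y\<bar> * exp (- (exp \<bar>y\<bar> / 8)))" by (simp add: exp_add)
    also have "\<dots> \<le> fact (m + 2) * exp 1 * 8"
    proof (intro mult_left_mono)
      have "exp \<bar>y\<bar> / 8 \<le> exp (exp \<bar>y\<bar> / 8)" using exp_ge_add_one_self[of "exp \<bar>y\<bar> / 8"] by linarith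
      then show "exp \<bar>y\<bar> * exp (- (exp \<bar>y\<bar> / 8)) \<le> 8" by (simp add: exp_minus field_simps)
    qed auto
    finally have "wt m y * (1 + y\<^sup>2) \<le> K" by (simp add: K_def)
    then have "wt m y \<le> K * inverse (1 + y\<^sup>2)" using pos by (simp add: field_simps)
    moreover have "wt m y \<ge> 0" by (simp add: wt_def)
    ultimately show ?thesis by simp
  qed
  then show "AE y in lborel. norm (wt m y) \<le> norm (K * inverse (1 + y\<^sup>2))" by simp
qed

text \<open>The point is that \<open>A * \<bar>y\<bar> - exp \<bar>y\<bar> / 8\<close> is at most
  \<open>A * ln (8 * A + 8)\<close>. This follows from \<open>ln t \<le> t\<close> at
  \<open>t = exp \<bar>y\<bar> / (8 * A + 8)\<close>, where the added 8 covers \<open>A = 0\<close>.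
  The loss, superexponential in \<open>A\<close>, is the price of stretching the kernel.\<close>

lemma norm_line_int_le:
  assumes "f holomorphic_on UNIV" "exp_growth f" "\<bar>c\<bar> \<le> 1" "A \<ge> 0"
    and "\<And>y. norm (f (Complex c y)) \<le> B * (1 + \<bar>y\<bar>) ^ m * exp (A * \<bar>y\<bar>)"
  shows "norm (line_int f c) \<le> B * exp (A * ln (8 * A + 8)) * (LINT y|lborel. wt m y)"
proof -
  have "norm (line_int f c) \<le> (LINT y|lborel. norm (f (Complex c y) * exp (- cos (Complex c y))))"
    unfolding line_int_def by simp
  also have "\<dots> \<le> (LINT y|lborel. B * exp (A * ln (8 * A + 8)) * wt m y)"
  proof (rule integral_mono)
    show "integrable lborel (\<lambda>y. norm (f (Complex c y) * exp (- cos (Complex c y))))"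
      by (intro integrable_norm integrable_line assms)
    show "integrable lborel (\<lambda>y. B * exp (A * ln (8 * A + 8)) * wt m y)"
      by (intro integrable_mult_right integrable_wt)
    fix y :: real
    define X where "X = exp \<bar>y\<bar>"
    have B: "B \<ge> 0"
      using order_trans[OF norm_ge_zero assms(5)[of 0]] by simp
    have "ln (X / (8 * A + 8)) \<le> X / (8 * A + 8)"
      using assms(4) ln_le_minus_one[of "X / (8 * A + 8)"] by (simp add: X_def)
    then have "\<bar>y\<bar> - ln (8 * A + 8) \<le> X / (8 * A + 8)"
      using assms(4) by (simp add: ln_div X_def)
    then have "A * \<bar>y\<bar> \<le> A * (ln (8 * A + 8) + X / (8 * A + 8))"
      using assms(4) by (intro mult_left_mono) auto
    also have "\<dots> = A * ln (8 * A + 8) + (A / (A + 1)) * (X / 8)"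
      using assms(4) by (simp add: divide_simps) (simp add: algebra_simps)
    also have "\<dots> \<le> A * ln (8 * A + 8) + 1 * (X / 8)"
      using assms(4) by (intro add_left_mono mult_right_mono) (auto simp: X_def)
    finally have Ay: "A * \<bar>y\<bar> \<le> A * ln (8 * A + 8) + X / 8" by simp
    have "norm (f (Complex c y) * exp (- cos (Complex c y)))
        \<le> (B * (1 + \<bar>y\<bar>) ^ m * exp (A * \<bar>y\<bar>)) * exp (- (X / 4))"
      unfolding norm_mult X_def using assms(5)[of y] norm_kernel_le[OF assms(3), of y] B
      by (intro mult_mono) auto
    also have "\<dots> = B * (1 + \<bar>y\<bar>) ^ m * exp (A * \<bar>y\<bar> - X / 4)"
      unfolding mult.assoc exp_add[symmetric] by simp
    also have "\<dots> \<le> B * (1 + \<bar>y\<bar>) ^ m * exp (A * ln (8 * A + 8) - X / 8)"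
      using B Ay by (intro mult_left_mono) auto
    also have "\<dots> = B * exp (A * ln (8 * A + 8)) * wt m y"
    proof -
      have "exp (A * ln (8 * A + 8) - X / 8) = exp (A * ln (8 * A + 8)) * exp (- (X / 8))"
        by (simp flip: exp_add)
      then show ?thesis unfolding wt_def X_def by (simp only: mult_ac)
    qed
    finally show "norm (f (Complex c y) * exp (- cos (Complex c y))) \<le> B * exp (A * ln (8 * A + 8)) * wt m y" .
  qed
  also have "\<dots> = B * exp (A * ln (8 * A + 8)) * (LINT y|lborel. wt m y)" by simp
  finally show ?thesis .
qed

text \<open>On the imaginary axis \<open>v ^ (2 * m)\<close> is
  \<open>(-1) ^ m * y ^ (2 * m)\<close> and the kernel is \<open>exp (- cosh y) > 0\<close>, so
  nothing cancels. This is why the pole at 1 is removed by an even power of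
  \<open>s - 1\<close>.\<close>

lemma line_int_even_power_nonzero: "line_int (\<lambda>v. v ^ (2 * m)) 0 \<noteq> 0"
proof -
  define h where "h = (\<lambda>y::real. y ^ (2 * m) * exp (- cosh y))"
  have eq: "Complex 0 y ^ (2 * m) * exp (- cos (Complex 0 y)) = (-1) ^ m * of_real (h y)" for y
  proof -
    have 1: "Complex 0 y = \<i> * of_real y" by (simp add: complex_eq_iff)
    have "Complex 0 y ^ (2 * m) = (-1) ^ m * of_real (y ^ (2 * m))"
      unfolding 1 power_mult_distrib by (simp add: power_mult)
    moreover have "cos (Complex 0 y) = of_real (cosh y)"
      by (simp add: complex_eq_iff Re_cos Im_cos cosh_def field_simps)
    ultimately show ?thesis by (simp add: h_def exp_of_real flip: of_real_minus)
  qed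
  have hol: "(\<lambda>v::complex. v ^ (2 * m)) holomorphic_on UNIV" by (intro holomorphic_intros)
  have gr: "exp_growth (\<lambda>v. v ^ (2 * m))" by (intro exp_growth_power exp_growth_ident)
  have li: "line_int (\<lambda>v. v ^ (2 * m)) 0 = (-1) ^ m * of_real (LINT y|lborel. h y)"
    unfolding line_int_def eq by simp
  have "integrable lborel (\<lambda>y. norm (Complex 0 y ^ (2 * m) * exp (- cos (Complex 0 y))))"
    by (intro integrable_norm integrable_line hol gr) simp
  then have int: "integrable lborel h"
    unfolding eq by (simp add: norm_mult norm_power h_def abs_mult power_even_abs)
  \<comment> \<open>On \<open>{1..2}\<close> the power is at least 1 and
    \<open>cosh y \<le> cosh 2\<close>, which bounds the integral away from 0.\<close>
  have "(LINT y|lborel. exp (- cosh (2::real)) * indicator {1..2::real} y) \<le> (LINT y|lborel. h y)"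
  proof (rule integral_mono)
    show "integrable lborel (\<lambda>y. exp (- cosh (2::real)) * indicator {1..2::real} y)" by simp
    fix y :: real
    show "exp (- cosh (2::real)) * indicator {1..2} y \<le> h y"
    proof (cases "y \<in> {1..2}")
      case True
      then have "cosh y \<le> cosh 2" by (simp add: cosh_real_nonneg_le_iff)
      then have "1 * exp (- cosh 2) \<le> y ^ (2 * m) * exp (- cosh y)"
        using True by (intro mult_mono) auto
      then show ?thesis using True by (simp add: h_def)
    qed (simp add: h_def)
  qed (rule int)
  then have "exp (- cosh (2::real)) \<le> (LINT y|lborel. h y)" by simp
  with exp_gt_zero[of "- cosh (2::real)"] have "(LINT y|lborel. h y) > 0" by linarith
  then show ?thesis unfolding li by simp
qed

text \<open>The contribution of the \<open>N\<close>-th term is isolated by shifting the terms with \<open>n < N\<close> to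
  \<open>Re v = - 1\<close>, the \<open>N\<close>-th term to \<open>Re v = 0\<close>, and keeping the others at \<open>Re v = 1\<close>.\<close>

lemma coefficient_bound:
  assumes ac: "abs_conv a 2" and hol: "G holomorphic_on UNIV" and gr: "exp_growth G"
    and G: "\<forall>s. Re s \<ge> 2 \<longrightarrow> G s = (s - 1) ^ (2 * m) * dseries a s"
  shows "\<exists>c>0. \<exists>K\<ge>0. \<forall>N>0. \<forall>T\<ge>1. \<forall>A\<ge>0. \<forall>D\<ge>0.
    (\<forall>y. norm (G (Complex (1 - T) (T * y))) \<le> T ^ (2 * m) * D * (1 + \<bar>y\<bar>) ^ (2 * m) * exp (A * \<bar>y\<bar>)) \<longrightarrow>
    c * norm (a N) \<le> K * (real N ^ 3 * (real N / real (Suc N)) powr (T - 1)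
       + real N * (real N powr (- T) * D * exp (A * ln (8 * A + 8))))"
proof -
  define c where "c = norm (line_int (\<lambda>v. v ^ (2 * m)) 0)"
  have c: "c > 0" using line_int_even_power_nonzero[of m] by (simp add: c_def)
  define W where "W = (LINT y|lborel. wt (2 * m) y)"
  have W: "W \<ge> 0" unfolding W_def by (intro integral_nonneg_AE) (auto simp: wt_def)
  define S where "S = (\<Sum>n. norm (a n) / real n powr 2)"
  have sumS: "summable (\<lambda>n. norm (a n) / real n powr 2)" using ac by (simp add: abs_conv_def)
  have S: "S \<ge> 0" unfolding S_def by (intro suminf_nonneg sumS) auto
  \<comment> \<open>The terms below \<open>N\<close> and the tail above \<open>N\<close> each
    contribute \<open>S\<close>; the shifted integral of \<open>ff\<close> contributes 1.\<close>
  define K where "K = W * (2 * S + 1)"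
  have main: "c * norm (a N) \<le> K * (real N ^ 3 * (real N / real (Suc N)) powr (T - 1)
       + real N * (real N powr (- T) * D * exp (A * ln (8 * A + 8))))"
    if N: "N > 0" and T: "T \<ge> 1" and A: "A \<ge> 0" and D: "D \<ge> 0"
      and GD: "\<And>y. norm (G (Complex (1 - T) (T * y))) \<le> T ^ (2 * m) * D * (1 + \<bar>y\<bar>) ^ (2 * m) * exp (A * \<bar>y\<bar>)"
    for N T A D
  proof -
    define q where "q = real N / real (Suc N)"
    \<comment> \<open>Under \<open>s = 1 + T * v\<close>, \<open>ff v\<close> is
      \<open>G s * N powr (s - 1)\<close>, and \<open>t n v\<close> is what the \<open>n\<close>-th
      term of the series contributes to it, with \<open>(N / n) powr (T * v)\<close> written as an
      exponential. The remainder \<open>r\<close> is entire because it is defined by subtraction; it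
      is identified with the tail of the series only on \<open>Re v = 1\<close>.\<close>
    define L where "L = complex_of_real (T * ln (real N))"
    define ff where "ff = (\<lambda>v. G (1 + of_real T * v) * exp (L * v))"
    define cf where "cf = (\<lambda>n. complex_of_real (T * (ln (real N) - ln (real n))))"
    define t where "t = (\<lambda>n v. (of_real T * v) ^ (2 * m) * (a n / of_nat n) * exp (cf n * v))"
    define r where "r = (\<lambda>v. ff v + (- (\<Sum>n\<in>{1..N}. t n v)))"
    have hff: "ff holomorphic_on UNIV" unfolding ff_def
      by (intro holomorphic_intros holomorphic_on_compose_gen[OF _ hol, unfolded o_def]) auto
    have gff: "exp_growth ff" unfolding ff_def
      by (intro exp_growth_mult exp_growth_affine[OF gr] exp_growth_exp_linear)
    have ht: "t n holomorphic_on UNIV" for n unfolding t_def by (intro holomorphic_intros)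
    have gt: "exp_growth (t n)" for n unfolding t_def
      by (intro exp_growth_mult exp_growth_const exp_growth_power exp_growth_ident exp_growth_exp_linear)
    have nt: "norm (t n (Complex x y)) \<le> T ^ (2 * m) * (norm (a n) / real n) * exp (T * (ln (real N) - ln (real n)) * x) * (1 + \<bar>y\<bar>) ^ (2 * m) * exp (0 * \<bar>y\<bar>)"
      if "\<bar>x\<bar> \<le> 1" for n x y
    proof -
      have "norm (Complex x y) ^ (2 * m) \<le> (1 + \<bar>y\<bar>) ^ (2 * m)"
        by (intro power_mono norm_Complex_le that) auto
      then have "(T * norm (Complex x y)) ^ (2 * m) * (norm (a n) / real n) * exp (T * (ln (real N) - ln (real n)) * x)
         \<le> (T ^ (2 * m) * (1 + \<bar>y\<bar>) ^ (2 * m)) * (norm (a n) / real n) * exp (T * (ln (real N) - ln (real n)) * x)"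
        using T unfolding power_mult_distrib by (intro mult_right_mono mult_left_mono) auto
      then show ?thesis using T
        by (simp add: t_def cf_def norm_mult norm_divide norm_power mult_ac)
    qed
    have split: "line_int ff 1 = (\<Sum>n\<in>{1..N}. line_int (t n) 1) + line_int r 1"
    proof -
      have "line_int r 1 = line_int ff 1 - line_int (\<lambda>v. \<Sum>n\<in>{1..N}. t n v) 1"
      proof -
        have i2: "integrable lborel (\<lambda>y. (\<Sum>n\<in>{1..N}. t n (Complex 1 y)) * exp (- cos (Complex 1 y)))"
          unfolding sum_distrib_right by (intro Bochner_Integration.integrable_sum integrable_line ht gt) simp
        have i1: "integrable lborel (\<lambda>y. ff (Complex 1 y) * exp (- cos (Complex 1 y)))"
          by (intro integrable_line hff gff) simp
        show ?thesis unfolding line_int_def r_def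
          using Bochner_Integration.integral_diff[OF i1 i2] by (simp add: algebra_simps)
      qed
      then show ?thesis by (simp add: line_int_sum[OF ht gt])
    qed
    have tN: "line_int (t N) 1 = of_real T ^ (2 * m) * (a N / of_nat N) * line_int (\<lambda>v. v ^ (2 * m)) 0"
    proof -
      have "line_int (t N) 1 = line_int (t N) 0" by (rule line_int_shift[OF ht gt]) auto
      also have "\<dots> = of_real T ^ (2 * m) * (a N / of_nat N) * line_int (\<lambda>v. v ^ (2 * m)) 0"
        unfolding line_int_def t_def cf_def power_mult_distrib
        by (simp add: mult_ac flip: integral_mult_right_zero)
      finally show ?thesis .
    qed
    have sn: "norm (a n) \<le> (real n)\<^sup>2 * (norm (a n) / real n powr 2)" if "n > 0" for n
      using that by (simp add: powr_numeral)
    \<comment> \<open>On \<open>Re v = - 1\<close> the factor \<open>N powr (s - 1)\<close> has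
      modulus \<open>N powr (- T)\<close>. This is the gain from the shift.\<close>
    have b1: "norm (line_int ff (-1)) \<le> T ^ (2 * m) * (real N powr (- T) * D * exp (A * ln (8 * A + 8))) * W"
    proof -
      have "norm (line_int ff (-1)) \<le> T ^ (2 * m) * D * real N powr (- T) * exp (A * ln (8 * A + 8)) * (LINT y|lborel. wt (2 * m) y)"
      proof (rule norm_line_int_le[OF hff gff _ A])
        fix y
        have eq: "1 + of_real T * Complex (-1) y = Complex (1 - T) (T * y)" by (simp add: complex_eq_iff)
        have "norm (exp (L * Complex (-1) y)) = real N powr (- T)"
          using N by (simp add: L_def powr_def)
        then have "norm (ff (Complex (-1) y)) = norm (G (Complex (1 - T) (T * y))) * real N powr (- T)"
          by (simp add: ff_def norm_mult eq)
        also have "\<dots> \<le> (T ^ (2 * m) * D * (1 + \<bar>y\<bar>) ^ (2 * m) * exp (A * \<bar>y\<bar>)) * real N powr (- T)"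
          by (intro mult_right_mono GD) auto
        finally show "norm (ff (Complex (-1) y)) \<le> T ^ (2 * m) * D * real N powr (- T) * (1 + \<bar>y\<bar>) ^ (2 * m) * exp (A * \<bar>y\<bar>)"
          by (simp add: mult_ac)
      qed simp
      then show ?thesis by (simp add: W_def mult_ac)
    qed
    have b2: "norm (\<Sum>n\<in>{1..<N}. line_int (t n) (-1)) \<le> T ^ (2 * m) * (S * real N ^ 2 * q powr (T - 1)) * W"
    proof -
      have each: "norm (line_int (t n) (-1)) \<le> T ^ (2 * m) * (real N ^ 2 * q powr (T - 1)) * W * (norm (a n) / real n powr 2)"
        if n: "n \<in> {1..<N}" for n
      proof -
        let ?e = "exp (T * (ln (real N) - ln (real n)) * (-1))"
        have "norm (line_int (t n) (-1)) \<le> T ^ (2 * m) * (norm (a n) / real n) * ?e * exp (0 * ln (8 * 0 + 8)) * (LINT y|lborel. wt (2 * m) y)"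
          by (rule norm_line_int_le[OF ht gt]) (use nt[of "-1" n] in auto)
        also have "\<dots> = T ^ (2 * m) * (norm (a n) / real n * ?e) * W" by (simp add: W_def)
        also have "\<dots> \<le> T ^ (2 * m) * (real N ^ 2 * (norm (a n) / real n powr 2) * q powr (T - 1)) * W"
        proof (intro mult_right_mono mult_left_mono mult_mono)
          have "norm (a n) / real n \<le> norm (a n) / 1" using n by (intro divide_left_mono) auto
          also have "\<dots> = norm (a n)" by simp
          also have "\<dots> \<le> (real n)\<^sup>2 * (norm (a n) / real n powr 2)" using n by (intro sn) auto
          also have "\<dots> \<le> (real N)\<^sup>2 * (norm (a n) / real n powr 2)" using n by (intro mult_right_mono power_mono) auto
          finally show "norm (a n) / real n \<le> (real N)\<^sup>2 * (norm (a n) / real n powr 2)" .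
          \<comment> \<open>Here \<open>n / N \<le> (N - 1) / N \<le> q\<close> because
            \<open>(N - 1) * (N + 1) \<le> N * N\<close>. Lowering the exponent to
            \<open>T - 1\<close> matches the estimate of the tail.\<close>
          have "?e = (real n / real N) powr T"
            using n N by (simp add: powr_def ln_div algebra_simps)
          also have "\<dots> \<le> q powr T"
          proof (rule powr_mono2)
            have "real n * real (Suc N) \<le> real (N - 1) * real (Suc N)" using n by (intro mult_right_mono) auto
            also have "\<dots> \<le> real N * real N" using N by (simp add: of_nat_diff algebra_simps)
            finally show "real n / real N \<le> q" using N by (simp add: q_def field_simps)
          qed (use T in auto)
          also have "\<dots> \<le> q powr (T - 1)" using N by (intro powr_mono') (auto simp: q_def)
          finally show "?e \<le> q powr (T - 1)" .
        qed (use T W in auto)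
        finally show ?thesis by (simp add: mult_ac)
      qed
      have "norm (\<Sum>n\<in>{1..<N}. line_int (t n) (-1)) \<le> (\<Sum>n\<in>{1..<N}. T ^ (2 * m) * (real N ^ 2 * q powr (T - 1)) * W * (norm (a n) / real n powr 2))"
        by (rule sum_norm_le[OF each])
      also have "\<dots> = T ^ (2 * m) * (real N ^ 2 * q powr (T - 1)) * W * (\<Sum>n\<in>{1..<N}. norm (a n) / real n powr 2)"
        by (simp only: sum_distrib_left)
      also have "\<dots> \<le> T ^ (2 * m) * (real N ^ 2 * q powr (T - 1)) * W * S"
        unfolding S_def using T W by (intro mult_left_mono sum_le_suminf sumS) auto
      finally show ?thesis by (simp add: mult_ac)
    qed
    \<comment> \<open>On \<open>Re v = 1\<close> one has \<open>Re s = 1 + T\<close>; comparing the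
      tail with the series at abscissa 2 leaves the exponent \<open>1 + T - 2\<close>.\<close>
    have b3: "norm (line_int r 1) \<le> T ^ (2 * m) * (S * real N ^ 2 * q powr (T - 1)) * W"
    proof -
      have hr: "r holomorphic_on UNIV" unfolding r_def by (intro holomorphic_intros hff ht)
      have fr: "norm (r (Complex 1 y)) \<le> T ^ (2 * m) * (S * real N ^ 2 * q powr (T - 1)) * (1 + \<bar>y\<bar>) ^ (2 * m)" for y
      proof -
        define v where "v = Complex 1 y"
        define s where "s = 1 + of_real T * v"
        have Re_s: "Re s = 1 + T" by (simp add: s_def v_def)
        have Nv: "exp (L * v) = of_nat N powr (s - 1)"
          using N by (simp add: L_def s_def powr_def mult_ac Ln_of_nat)
        have tn: "t n v = (s - 1) ^ (2 * m) * (of_nat N powr (s - 1) * (a n / of_nat n powr s))" if "n > 0" for n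
        proof -
          have "exp (cf n * v) = exp (L * v) / exp (of_real T * v * of_real (ln (real n)))"
            by (simp add: exp_diff[symmetric] L_def cf_def algebra_simps)
          also have "exp (of_real T * v * of_real (ln (real n))) = of_nat n powr (s - 1)"
            using that by (simp add: s_def powr_def mult_ac Ln_of_nat)
          also have "\<dots> = of_nat n powr s / of_nat n" using that by (simp add: powr_diff)
          finally show ?thesis using that
            by (simp add: t_def Nv[symmetric]) (simp add: s_def mult_ac)
        qed
        have "r v = (s - 1) ^ (2 * m) * (of_nat N powr (s - 1) * (dseries a s - (\<Sum>n\<in>{1..N}. a n / of_nat n powr s)))"
        proof -
          have Gs: "G (1 + of_real T * v) = (s - 1) ^ (2 * m) * dseries a s"
            unfolding s_def[symmetric] using G[rule_format, of s] T Re_s by simp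
          have ts: "(\<Sum>n\<in>{1..N}. t n v) = (s - 1) ^ (2 * m) * (of_nat N powr (s - 1) * (\<Sum>n\<in>{1..N}. a n / of_nat n powr s))"
            unfolding sum_distrib_left by (intro sum.cong tn) auto
          have ring: "x * d * p + - (x * (p * e)) = x * (p * (d - e))" for x d p e :: complex
            by (simp add: algebra_simps)
          show ?thesis unfolding r_def ff_def Nv Gs ts by (rule ring)
        qed
        also have "(\<Sum>n\<in>{1..N}. a n / of_nat n powr s) = (\<Sum>n\<le>N. a n / of_nat n powr s)"
          by (rule sum.mono_neutral_left) (auto simp: not_le)
        also have "of_nat N powr (s - 1) = of_nat N powr s / of_nat N"
          using N by (simp add: powr_diff)
        finally have "norm (r v) = norm (s - 1) ^ (2 * m) * (norm (of_nat N powr s * (dseries a s - (\<Sum>n\<le>N. a n / of_nat n powr s))) / real N)"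
          by (simp add: norm_mult norm_divide norm_power)
        also have "\<dots> \<le> (T * (1 + \<bar>y\<bar>)) ^ (2 * m) * (q powr (1 + T - 2) * (real N powr 2 * S) / 1)"
        proof (intro mult_mono power_mono frac_le)
          show "norm (s - 1) \<le> T * (1 + \<bar>y\<bar>)"
            using norm_Complex_le[of 1 y] T by (simp add: s_def v_def norm_mult)
          show "norm (of_nat N powr s * (dseries a s - (\<Sum>n\<le>N. a n / of_nat n powr s))) \<le> q powr (1 + T - 2) * (real N powr 2 * S)"
            unfolding q_def S_def
          proof (rule order_trans)
            have s2: "2 \<le> Re s" "2 \<le> 1 + T" using Re_s T by auto
            show "norm (of_nat N powr s * (dseries a s - (\<Sum>n\<le>N. a n / of_nat n powr s)))
               \<le> (\<Sum>n. norm (a (n + Suc N)) * (real N / real (n + Suc N)) powr (1 + T))"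
              using dseries_split[OF ac s2(1) N] unfolding Re_s .
            show "(\<Sum>n. norm (a (n + Suc N)) * (real N / real (n + Suc N)) powr (1 + T))
               \<le> (real N / real (Suc N)) powr (1 + T - 2) * (real N powr 2 * (\<Sum>n. norm (a n) / real n powr 2))"
              by (rule dseries_tail_le(2)[OF ac s2(2) N])
          qed
        qed (use N T S in \<open>auto simp: q_def\<close>)
        also have "\<dots> = T ^ (2 * m) * (S * real N ^ 2 * q powr (T - 1)) * (1 + \<bar>y\<bar>) ^ (2 * m)"
          using N by (simp add: power_mult_distrib powr_numeral mult_ac)
        finally show ?thesis by (simp add: v_def)
      qed
      have gr: "exp_growth r" unfolding r_def sum_negf[symmetric]
        by (intro exp_growth_add exp_growth_sum gff exp_growth_uminus gt)
      have "norm (line_int r 1) \<le> T ^ (2 * m) * (S * real N ^ 2 * q powr (T - 1)) * exp (0 * ln (8 * 0 + 8)) * (LINT y|lborel. wt (2 * m) y)"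
        by (rule norm_line_int_le[OF hr gr]) (use fr in auto)
      then show ?thesis by (simp add: W_def)
    qed
    have "of_real T ^ (2 * m) * (a N / of_nat N) * line_int (\<lambda>v. v ^ (2 * m)) 0
        = line_int ff (-1) - (\<Sum>n\<in>{1..<N}. line_int (t n) (-1)) - line_int r 1"
    proof -
      have "line_int ff 1 = line_int ff (-1)" by (rule line_int_shift[OF hff gff]) auto
      moreover have "(\<Sum>n\<in>{1..N}. line_int (t n) 1) = (\<Sum>n\<in>{1..<N}. line_int (t n) (-1)) + line_int (t N) 1"
      proof -
        have "{1..N} = insert N {1..<N}" using N by auto
        moreover have "line_int (t n) 1 = line_int (t n) (-1)" for n by (rule line_int_shift[OF ht gt]) auto
        ultimately show ?thesis by simp
      qed
      ultimately show ?thesis using split unfolding tN by (simp add: algebra_simps)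
    qed
    then have "norm (of_real T ^ (2 * m) * (a N / of_nat N) * line_int (\<lambda>v. v ^ (2 * m)) 0)
       \<le> norm (line_int ff (-1)) + norm (\<Sum>n\<in>{1..<N}. line_int (t n) (-1)) + norm (line_int r 1)"
      by (metis (no_types, lifting) add_right_mono norm_triangle_ineq4 order_trans)
    also have "\<dots> \<le> T ^ (2 * m) * (real N powr (- T) * D * exp (A * ln (8 * A + 8))) * W
       + T ^ (2 * m) * (S * real N ^ 2 * q powr (T - 1)) * W + T ^ (2 * m) * (S * real N ^ 2 * q powr (T - 1)) * W"
      by (intro add_mono b1 b2 b3)
    also have "\<dots> = T ^ (2 * m) * (W * (2 * S * (real N ^ 2 * q powr (T - 1)) + real N powr (- T) * D * exp (A * ln (8 * A + 8))))"
      by (simp add: algebra_simps)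
    also have "\<dots> \<le> T ^ (2 * m) * (K * (real N ^ 2 * q powr (T - 1) + real N powr (- T) * D * exp (A * ln (8 * A + 8))))"
      (is "_ * (W * (2 * S * ?x + ?y)) \<le> _")
    proof (rule mult_left_mono)
      have xy: "?x \<ge> 0" "?y \<ge> 0" using D by auto
      have "2 * S * ?x \<le> (2 * S + 1) * ?x" "1 * ?y \<le> (2 * S + 1) * ?y"
        using xy S by (intro mult_right_mono; simp)+
      then have "2 * S * ?x + ?y \<le> (2 * S + 1) * (?x + ?y)" unfolding distrib_left mult_1_left by (rule add_mono)
      then show "W * (2 * S * ?x + ?y) \<le> K * (?x + ?y)"
        unfolding K_def mult.assoc using W by (rule mult_left_mono)
    qed (use T in auto)
    finally have "T ^ (2 * m) * (norm (a N) / real N * c) \<le> T ^ (2 * m) * (K * (real N ^ 2 * q powr (T - 1) + real N powr (- T) * D * exp (A * ln (8 * A + 8))))"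
      using T by (simp add: norm_mult norm_divide norm_power c_def mult.assoc)
    then have "norm (a N) / real N * c \<le> K * (real N ^ 2 * q powr (T - 1) + real N powr (- T) * D * exp (A * ln (8 * A + 8)))"
      by (rule mult_left_le_imp_le) (use T in auto)
    then have "real N * (norm (a N) / real N * c) \<le> real N * (K * (real N ^ 2 * q powr (T - 1) + real N powr (- T) * D * exp (A * ln (8 * A + 8))))"
      by (rule mult_left_mono) auto
    then show ?thesis using N by (simp add: q_def algebra_simps power2_eq_square power3_eq_cube)
  qed
  have "K \<ge> 0" using W S by (simp add: K_def)
  with c main show ?thesis by (intro exI[of _ c] conjI exI[of _ K] allI impI) auto
qed

section \<open>Trivial zeros\<close>


lemma selberg_abs_conv:
  assumes "a \<in> selberg_class" "\<sigma> > 1"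
  shows "abs_conv a \<sigma>"
proof -
  have "(\<lambda>n. norm (a n)) \<in> O(\<lambda>n. real n powr ((\<sigma> - 1) / 2))"
    using assms by (auto simp: selberg_class_def ramanujan_hypothesis_def)
  then show ?thesis by (rule abs_conv_bigo) (use assms(2) in \<open>simp add: field_simps\<close>)
qed

lemma selberg_coeff_1: "a \<in> selberg_class \<Longrightarrow> a 1 = 1"
  by (simp add: selberg_class_def selberg_euler_product_def)

lemma selberg_dseries_nonzero: "a \<in> selberg_class \<Longrightarrow> Re s > 1 \<Longrightarrow> dseries a s \<noteq> 0"
proof -
  assume "a \<in> selberg_class" "Re s > 1"
  then obtain b where "exp (dseries b s) = dseries a s"
    unfolding selberg_class_def selberg_euler_product_def by auto
  then show ?thesis by (metis exp_not_eq_zero)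
qed

section \<open>The functional equation and the zeros for \<open>Re s < 0\<close>\<close>

lemma cnj_dseries:
  assumes "abs_conv a \<sigma>" "\<sigma> \<le> Re s"
  shows "cnj (dseries a s) = dseries (\<lambda>n. cnj (a n)) (cnj s)"
proof -
  have "(\<lambda>n. a n / of_nat n powr s) sums dseries a s"
    unfolding dseries_def by (rule summable_sums[OF abs_conv_summable[OF assms]])
  then have "(\<lambda>n. cnj (a n / of_nat n powr s)) sums cnj (dseries a s)" by (simp only: sums_cnj)
  then show ?thesis by (simp add: dseries_def sums_iff cnj_powr)
qed

lemma abs_conv_cnj: "abs_conv (\<lambda>n. cnj (a n)) \<sigma> \<longleftrightarrow> abs_conv a \<sigma>"
  by (simp add: abs_conv_def)

text \<open>The functional equation solved for \<open>F s\<close>, with the reciprocal Gamma factors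
  at \<open>s\<close> left out. For \<open>Re s < 0\<close> the remaining Gamma arguments have
  positive real part and \<open>1 - s\<close> lies in the half-plane of absolute convergence, so
  this part is holomorphic and has no zeros.\<close>

definition dual_factor ::
  "(nat \<Rightarrow> complex) \<Rightarrow> complex \<Rightarrow> real \<Rightarrow> nat \<Rightarrow> (nat \<Rightarrow> real) \<Rightarrow> (nat \<Rightarrow> complex) \<Rightarrow> complex \<Rightarrow> complex" where
  "dual_factor a \<epsilon> Q k w \<mu> s = cnj \<epsilon> / \<epsilon> * of_real Q powr (1 - 2 * s) *
     (\<Prod>i<k. Gamma (of_real (w i) * (1 - s) + cnj (\<mu> i))) * dseries (\<lambda>n. cnj (a n)) (1 - s)"

text \<open>The solved functional equation on all of \<open>Re s < 0\<close>, with no exceptional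
  points. The data are a choice: one element may admit several.\<close>

definition selberg_data ::
  "(nat \<Rightarrow> complex) \<Rightarrow> (complex \<Rightarrow> complex) \<Rightarrow> complex \<Rightarrow> real \<Rightarrow> nat \<Rightarrow> (nat \<Rightarrow> real) \<Rightarrow> (nat \<Rightarrow> complex) \<Rightarrow> bool" where
  "selberg_data a F \<epsilon> Q k w \<mu> \<longleftrightarrow> norm \<epsilon> = 1 \<and> Q > 0 \<and> (\<forall>i<k. w i > 0 \<and> Re (\<mu> i) \<ge> 0) \<and>
     F holomorphic_on - {1} \<and> (\<forall>s. Re s > 1 \<longrightarrow> F s = dseries a s) \<and>
     (\<forall>s. Re s < 0 \<longrightarrow> F s = dual_factor a \<epsilon> Q k w \<mu> s * (\<Prod>i<k. rGamma (of_real (w i) * s + \<mu> i)))"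

lemma Re_pos_notin_nonpos_Ints: "Re z > 0 \<Longrightarrow> z \<notin> \<int>\<^sub>\<le>\<^sub>0"
  by (auto elim!: nonpos_Ints_cases)

lemma dual_factor_Gamma_arg:
  assumes "(w :: real) > 0" "Re \<mu> \<ge> 0" "Re s < 0"
  shows "of_real w * (1 - s) + cnj \<mu> \<notin> \<int>\<^sub>\<le>\<^sub>0"
  by (rule Re_pos_notin_nonpos_Ints) (use assms in \<open>simp add: add_pos_nonneg\<close>)

lemma dual_factor_holomorphic:
  assumes "a \<in> selberg_class" "Q > 0" "\<forall>i<k. w i > 0 \<and> Re (\<mu> i) \<ge> 0"
  shows "dual_factor a \<epsilon> Q k w \<mu> holomorphic_on {s. Re s < 0}"
proof -
  have "dseries (\<lambda>n. cnj (a n)) holomorphic_on {s. 1 < Re s}"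
  proof (rule holomorphic_onI)
    fix s :: complex assume s: "s \<in> {s. 1 < Re s}"
    then have "abs_conv (\<lambda>n. cnj (a n)) ((1 + Re s) / 2)"
      using selberg_abs_conv[OF assms(1), of "(1 + Re s) / 2"] by (simp add: abs_conv_cnj)
    from dseries_has_field_derivative[OF this, of s]
    show "dseries (\<lambda>n. cnj (a n)) field_differentiable at s within {s. 1 < Re s}"
      using s by (auto simp: field_differentiable_def intro: has_field_derivative_at_within)
  qed
  then have "(\<lambda>s. dseries (\<lambda>n. cnj (a n)) (1 - s)) holomorphic_on {s. Re s < 0}"
    by (rule holomorphic_on_compose_gen[where g = "dseries (\<lambda>n. cnj (a n))" and f = "\<lambda>s. 1 - s", unfolded o_def, rotated])
       (auto intro!: holomorphic_intros)
  moreover have "(\<lambda>s. Gamma (of_real (w i) * (1 - s) + cnj (\<mu> i))) holomorphic_on {s. Re s < 0}" if "i < k" for i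
    using dual_factor_Gamma_arg[of "w i" "\<mu> i"] assms(3) that
    by (intro holomorphic_intros) auto
  ultimately show ?thesis unfolding dual_factor_def
    by (intro holomorphic_on_mult holomorphic_on_prod holomorphic_on_powr_right holomorphic_on_const
        holomorphic_on_diff holomorphic_on_ident) (use assms(2) in auto)
qed

lemma dual_factor_nonzero:
  assumes "a \<in> selberg_class" "norm \<epsilon> = 1" "Q > 0" "\<forall>i<k. w i > 0 \<and> Re (\<mu> i) \<ge> 0" "Re s < 0"
  shows "dual_factor a \<epsilon> Q k w \<mu> s \<noteq> 0"
proof -
  have "dseries (\<lambda>n. cnj (a n)) (1 - s) = cnj (dseries a (1 - cnj s))"
    using cnj_dseries[OF selberg_abs_conv[OF assms(1), of "1 - Re s"], of "1 - cnj s"] assms(5) by simp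
  moreover have "dseries a (1 - cnj s) \<noteq> 0" using selberg_dseries_nonzero[OF assms(1)] assms(5) by simp
  ultimately show ?thesis
    using assms dual_factor_Gamma_arg[of "w _" "\<mu> _"]
    by (auto simp: dual_factor_def Gamma_eq_zero_iff)
qed

lemma selberg_analyticityD:
  assumes "selberg_analyticity a F"
  obtains m G where "G holomorphic_on UNIV" "exp_growth G" "\<And>s. s \<noteq> 1 \<Longrightarrow> G s = (s - 1) ^ m * F s"
    "F holomorphic_on - {1}" "\<And>s. Re s > 1 \<Longrightarrow> F s = dseries a s"
proof -
  obtain m G where G: "entire_finite_order G" "\<And>s. s \<noteq> 1 \<Longrightarrow> G s = (s - 1) ^ m * F s"
    using assms unfolding selberg_analyticity_def by blast
  have hol: "G holomorphic_on UNIV" using G(1) by (simp add: entire_finite_order_def)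
  have "(\<lambda>s. G s / (s - 1) ^ m) holomorphic_on - {1}"
    by (intro holomorphic_intros holomorphic_on_subset[OF hol]) auto
  then have "F holomorphic_on - {1}"
    by (rule holomorphic_transform) (use G(2) in auto)
  moreover have "F s = dseries a s" if "Re s > 1" for s
    using assms that by (simp add: selberg_analyticity_def)
  ultimately show ?thesis
    using that[OF hol entire_finite_order_imp_exp_growth[OF G(1)] G(2)] by simp
qed

text \<open>The functional equation is given off the poles of the Gamma factors. Written with
  \<open>rGamma\<close>, both sides of the solved form are continuous on \<open>Re s < 0\<close>, so
  the exceptional points follow by a limit.\<close>

lemma selberg_class_data:
  assumes "a \<in> selberg_class"
  obtains F G m \<epsilon> Q k w \<mu> where "G holomorphic_on UNIV" "exp_growth G"
    "\<And>s. s \<noteq> 1 \<Longrightarrow> G s = (s - 1) ^ m * F s" "selberg_data a F \<epsilon> Q k w \<mu>"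
proof -
  obtain F where F: "selberg_analyticity a F" "selberg_functional_equation F"
    using assms by (auto simp: selberg_class_def)
  obtain m G where G: "G holomorphic_on UNIV" "exp_growth G" "\<And>s. s \<noteq> 1 \<Longrightarrow> G s = (s - 1) ^ m * F s"
    and hF: "F holomorphic_on - {1}" and dF: "\<And>s. Re s > 1 \<Longrightarrow> F s = dseries a s"
    by (rule selberg_analyticityD[OF F(1)]) (rule that; assumption)
  obtain \<epsilon> Q k w \<mu> where eQ: "norm \<epsilon> = 1" "Q > 0" "\<forall>i<k. w i > 0 \<and> Re (\<mu> i) \<ge> 0"
    and fe: "\<forall>s. s \<noteq> 0 \<longrightarrow> s \<noteq> 1 \<longrightarrow>
           (\<forall>i<k. of_real (w i) * s + \<mu> i \<notin> \<int>\<^sub>\<le>\<^sub>0 \<and>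
                  of_real (w i) * (1 - cnj s) + \<mu> i \<notin> \<int>\<^sub>\<le>\<^sub>0) \<longrightarrow>
           gamma_factor \<epsilon> Q k w \<mu> s * F s = cnj (gamma_factor \<epsilon> Q k w \<mu> (1 - cnj s) * F (1 - cnj s))"
    using F(2) unfolding selberg_functional_equation_def Let_def by (elim exE conjE) (rule that; assumption)
  let ?R = "\<lambda>s. dual_factor a \<epsilon> Q k w \<mu> s * (\<Prod>i<k. rGamma (of_real (w i) * s + \<mu> i))"
  have eps: "\<epsilon> \<noteq> 0" using eQ(1) by auto
  have generic: "F s = ?R s" if s: "Re s < 0" and n: "\<forall>i<k. of_real (w i) * s + \<mu> i \<notin> \<int>\<^sub>\<le>\<^sub>0" for s
  proof -
    let ?g = "\<Prod>i<k. Gamma (of_real (w i) * s + \<mu> i)"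
    let ?h = "\<Prod>i<k. Gamma (of_real (w i) * (1 - s) + cnj (\<mu> i))"
    have g0: "?g \<noteq> 0" using n by (simp add: Gamma_eq_zero_iff)
    have "\<forall>i<k. of_real (w i) * (1 - cnj s) + \<mu> i \<notin> \<int>\<^sub>\<le>\<^sub>0"
    proof (intro allI impI Re_pos_notin_nonpos_Ints)
      fix i assume "i < k"
      then have "w i * (1 - Re s) > 0" "Re (\<mu> i) \<ge> 0" using eQ(3) s by auto
      then show "0 < Re (of_real (w i) * (1 - cnj s) + \<mu> i)" by simp
    qed
    then have "gamma_factor \<epsilon> Q k w \<mu> s * F s = cnj (gamma_factor \<epsilon> Q k w \<mu> (1 - cnj s) * F (1 - cnj s))"
      using s n by (intro fe[rule_format]) auto
    also have "F (1 - cnj s) = dseries a (1 - cnj s)" using s by (intro dF) simp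
    also have "cnj (gamma_factor \<epsilon> Q k w \<mu> (1 - cnj s) * dseries a (1 - cnj s))
        = cnj \<epsilon> * of_real Q powr (1 - s) * ?h * dseries (\<lambda>n. cnj (a n)) (1 - s)"
      using cnj_dseries[OF selberg_abs_conv[OF assms, of "1 - Re s"], of "1 - cnj s"] s eQ(2)
      by (simp add: gamma_factor_def cnj_powr cnj_Gamma)
    finally have "\<epsilon> * of_real Q powr s * ?g * F s = cnj \<epsilon> * of_real Q powr (1 - s) * ?h * dseries (\<lambda>n. cnj (a n)) (1 - s)"
      by (simp add: gamma_factor_def)
    then have "F s = cnj \<epsilon> * of_real Q powr (1 - s) * ?h * dseries (\<lambda>n. cnj (a n)) (1 - s) / (\<epsilon> * of_real Q powr s * ?g)"
      using g0 eps eQ(2) by (simp add: field_simps)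
    also have "\<dots> = cnj \<epsilon> / \<epsilon> * (of_real Q powr (1 - s) / of_real Q powr s) * ?h * dseries (\<lambda>n. cnj (a n)) (1 - s) * inverse ?g"
      by (simp add: divide_inverse mult_ac)
    also have "of_real Q powr (1 - s) / of_real Q powr s = of_real Q powr (1 - 2 * s)"
      by (simp flip: powr_diff)
    also have "inverse ?g = (\<Prod>i<k. rGamma (of_real (w i) * s + \<mu> i))"
      by (simp add: rGamma_inverse_Gamma prod_inversef[symmetric])
    finally show ?thesis by (simp add: dual_factor_def)
  qed
  have hR: "?R holomorphic_on {s. Re s < 0}"
    by (intro holomorphic_intros dual_factor_holomorphic[OF assms eQ(2,3)])
  have "F s = ?R s" if s: "Re s < 0" for s
  proof -
    \<comment> \<open>Approach \<open>s\<close> from above: each \<open>w i * ?p t + \<mu> i\<close>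
      is real for at most one \<open>t\<close>, so the poles are avoided for small
      \<open>t > 0\<close>.\<close>
    let ?p = "\<lambda>t::real. s + \<i> * of_real t"
    have ev: "\<forall>\<^sub>F t in at_right 0. F (?p t) = ?R (?p t)"
    proof -
      have "\<forall>\<^sub>F t in at_right 0. \<forall>i\<in>{..<k}. of_real (w i) * ?p t + \<mu> i \<notin> \<int>\<^sub>\<le>\<^sub>0"
      proof (intro eventually_ball_finite ballI)
        fix i assume "i \<in> {..<k}"
        then have w: "w i > 0" using eQ(3) by auto
        have "\<forall>\<^sub>F t in at_right 0. t \<noteq> - Im (of_real (w i) * s + \<mu> i) / w i"
          by (rule eventually_neq_at_within)
        then show "\<forall>\<^sub>F t in at_right 0. of_real (w i) * ?p t + \<mu> i \<notin> \<int>\<^sub>\<le>\<^sub>0"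
        proof eventually_elim
          case (elim t)
          show ?case
          proof
            assume "of_real (w i) * ?p t + \<mu> i \<in> \<int>\<^sub>\<le>\<^sub>0"
            then obtain n where "of_real (w i) * ?p t + \<mu> i = of_int n" by (rule nonpos_Ints_cases)
            then have "Im (of_real (w i) * ?p t + \<mu> i) = 0" by (simp only: complex_Im_of_int)
            then have "t * w i = - Im (of_real (w i) * s + \<mu> i)" by (simp add: algebra_simps)
            then show False using elim w by (simp add: field_simps)
          qed
        qed
      qed simp
      then show ?thesis by eventually_elim (use s in \<open>auto intro!: generic\<close>)
    qed
    have p: "(?p \<longlongrightarrow> s) (at_right 0)" by (auto intro!: tendsto_eq_intros)
    have open_L: "open {s. Re s < 0}" by (simp add: open_halfspace_Re_lt)
    have "isCont F s"
      using holomorphic_on_imp_continuous_on[OF hF] s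
      by (intro continuous_on_interior[of "- {1}" F]) (auto simp: interior_open open_Compl)
    then have 1: "((\<lambda>t. F (?p t)) \<longlongrightarrow> F s) (at_right 0)" using p by (rule isCont_tendsto_compose)
    have "isCont ?R s"
      using holomorphic_on_imp_continuous_on[OF hR] s open_L
      by (intro continuous_on_interior[of "{s. Re s < 0}" ?R]) (auto simp: interior_open)
    then have 2: "((\<lambda>t. ?R (?p t)) \<longlongrightarrow> ?R s) (at_right 0)" using p by (rule isCont_tendsto_compose)
    show ?thesis
      by (rule tendsto_unique[OF _ 1 Lim_transform_eventually[OF 2]])
         (simp, rule eventually_mono[OF ev], rule sym)
  qed
  then have "selberg_data a F \<epsilon> Q k w \<mu>" using eQ hF dF by (simp add: selberg_data_def)
  with G show ?thesis by (rule that)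
qed

text \<open>All zeros of \<open>rGamma\<close> are integers, and two integers at distance less than
  1 coincide; hence the zeros are isolated.\<close>

lemma eventually_rGamma_affine_nonzero:
  assumes "w \<noteq> 0"
  shows "\<forall>\<^sub>F z in at s. rGamma (w * z + \<mu> :: complex) \<noteq> 0"
proof (cases "w * s + \<mu> \<in> \<int>")
  case True
  have "\<forall>\<^sub>F z in at s. dist (w * z + \<mu>) (w * s + \<mu>) < 1"
    by (rule tendstoD) (auto intro!: tendsto_intros)
  moreover have "\<forall>\<^sub>F z in at s. z \<noteq> s" by (rule eventually_neq_at_within)
  ultimately show ?thesis
  proof eventually_elim
    case (elim z)
    show ?case
    proof
      assume "rGamma (w * z + \<mu>) = 0"
      then have "w * z + \<mu> \<in> \<int>" by (auto simp: rGamma_eq_zero_iff elim!: nonpos_Ints_cases)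
      from Ints_diff[OF this True] obtain n where n: "(w * z + \<mu>) - (w * s + \<mu>) = of_int n"
        by (rule Ints_cases)
      have "norm (of_int n :: complex) < 1" using elim(1) unfolding dist_norm n .
      then have "n = 0" by simp
      then have "w * z + \<mu> = w * s + \<mu>" using n by simp
      then show False using elim(2) assms by simp
    qed
  qed
next
  case False
  then have "rGamma (w * s + \<mu>) \<noteq> 0" by (auto simp: rGamma_eq_zero_iff elim!: nonpos_Ints_cases)
  moreover have "((\<lambda>z. rGamma (w * z + \<mu>)) \<longlongrightarrow> rGamma (w * s + \<mu>)) (at s)"
    by (intro isContD continuous_intros)
  ultimately show ?thesis by (intro tendsto_imp_eventually_ne)
qed

text \<open>The zeros of \<open>rGamma\<close> are simple: its derivative at \<open>- n\<close> is
  \<open>(-1) ^ n * fact n\<close>.\<close>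

lemma zorder_rGamma_affine:
  assumes "w \<noteq> 0"
  shows "zorder (\<lambda>z. rGamma (w * z + \<mu>)) s = (if w * s + \<mu> \<in> \<int>\<^sub>\<le>\<^sub>0 then 1 else 0)"
proof (cases "w * s + \<mu> \<in> \<int>\<^sub>\<le>\<^sub>0")
  case True
  then obtain n where n: "w * s + \<mu> = - of_nat n" by (auto elim!: nonpos_Ints_cases')
  have d: "((\<lambda>z. rGamma (w * z + \<mu>)) has_field_derivative ((-1) ^ n * fact n) * w) (at s)"
    by (rule DERIV_chain2[OF _ , of rGamma]) (unfold n, auto intro!: derivative_eq_intros)
  have "zorder (\<lambda>z. rGamma (w * z + \<mu>)) s = 1"
  proof (rule zorder_zero_eqI[of _ UNIV])
    show "(\<lambda>z. rGamma (w * z + \<mu>)) holomorphic_on UNIV" by (intro holomorphic_intros)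
    show "(deriv ^^ nat 1) (\<lambda>z. rGamma (w * z + \<mu>)) s \<noteq> 0" using DERIV_imp_deriv[OF d] assms by simp
    show "(deriv ^^ i) (\<lambda>z. rGamma (w * z + \<mu>)) s = 0" if "i < nat 1" for i
      using that True by (simp add: rGamma_eq_zero_iff)
  qed auto
  then show ?thesis using True by simp
next
  case False
  have "zorder (\<lambda>z. rGamma (w * z + \<mu>)) s = 0"
    by (rule zorder_eq_0I) (use False in \<open>auto simp: rGamma_eq_zero_iff intro!: analytic_intros\<close>)
  then show ?thesis using False by simp
qed

text \<open>The dual factor is nonzero, so the order of \<open>F\<close> is the sum of the orders of
  the reciprocal Gamma factors, each 0 or 1. Counting indices \<open>i\<close> records the
  multiplicity when several of them vanish at the same point.\<close>

lemma selberg_data_left: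
  assumes a: "a \<in> selberg_class" and d: "selberg_data a F \<epsilon> Q k w \<mu>" and s: "Re s < 0"
  shows "F analytic_on {s}" "\<forall>\<^sub>F z in at s. F z \<noteq> 0"
    "zorder F s = int (card {i. i < k \<and> of_real (w i) * s + \<mu> i \<in> \<int>\<^sub>\<le>\<^sub>0})"
proof -
  note d' = d[unfolded selberg_data_def]
  have w: "w i \<noteq> 0" if "i < k" for i using d' that by auto
  show "F analytic_on {s}"
    using d' s by (intro analytic_at[THEN iffD2] exI[of _ "- {1}"]) auto
  let ?D = "dual_factor a \<epsilon> Q k w \<mu>" and ?P = "\<lambda>z. \<Prod>i<k. rGamma (of_real (w i) * z + \<mu> i)"
  have L: "open {s. Re s < 0}" by (simp add: open_halfspace_Re_lt)
  have evL: "\<forall>\<^sub>F z in at s. Re z < 0" using eventually_at_in_open'[OF L] s by simp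
  then have evF: "\<forall>\<^sub>F z in at s. F z = ?D z * ?P z" by eventually_elim (use d' in auto)
  have evP: "\<forall>\<^sub>F z in at s. ?P z \<noteq> 0"
  proof -
    have "\<forall>\<^sub>F z in at s. \<forall>i\<in>{..<k}. rGamma (of_real (w i) * z + \<mu> i) \<noteq> 0"
      by (intro eventually_ball_finite ballI eventually_rGamma_affine_nonzero) (use w in auto)
    then show ?thesis by eventually_elim auto
  qed
  have D0: "?D z \<noteq> 0" if "Re z < 0" for z using dual_factor_nonzero[OF a _ _ _ that] d' by blast
  have ev: "\<forall>\<^sub>F z in at s. ?D z * ?P z \<noteq> 0"
    using evP evL by eventually_elim (use D0 in auto)
  then show "\<forall>\<^sub>F z in at s. F z \<noteq> 0" using evF by eventually_elim auto
  have aD: "?D analytic_on {s}"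
    using dual_factor_holomorphic[OF a, of Q k w \<mu> \<epsilon>] d' s L by (intro analytic_at[THEN iffD2]) blast
  have "zorder F s = zorder (\<lambda>z. ?D z * ?P z) s" by (rule zorder_cong[OF evF refl])
  also have "\<dots> = zorder ?D s + zorder ?P s"
    by (rule zorder_times_analytic[OF aD _ ev]) (intro analytic_intros)
  also have "zorder ?D s = 0" by (rule zorder_eq_0I[OF aD D0[OF s]])
  also have "zorder ?P s = (\<Sum>i<k. zorder (\<lambda>z. rGamma (of_real (w i) * z + \<mu> i)) s)"
    by (rule zorder_prod_analytic[OF _ evP]) (intro analytic_intros)
  also have "\<dots> = (\<Sum>i<k. if of_real (w i) * s + \<mu> i \<in> \<int>\<^sub>\<le>\<^sub>0 then 1 else 0)"
    by (intro sum.cong refl zorder_rGamma_affine) (use w in auto)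
  also have "\<dots> = int (card {i. i < k \<and> of_real (w i) * s + \<mu> i \<in> \<int>\<^sub>\<le>\<^sub>0})"
    by (simp add: sum.If_cases Int_def lessThan_def)
  finally show "zorder F s = int (card {i. i < k \<and> of_real (w i) * s + \<mu> i \<in> \<int>\<^sub>\<le>\<^sub>0})" by simp
qed

section \<open>Counting trivial zeros in vertical strips\<close>

definition trivial_zeros :: "real \<Rightarrow> complex \<Rightarrow> real \<Rightarrow> complex set" where
  "trivial_zeros w \<mu> R = {s. - R < Re s \<and> Re s < 0 \<and> of_real w * s + \<mu> \<in> \<int>\<^sub>\<le>\<^sub>0}"

text \<open>The zeros are the points \<open>- (n + \<mu>) / w\<close>, and they lie in the strip
  exactly when \<open>n + Re \<mu>\<close> lies strictly between 0 and \<open>w * R\<close>.\<close>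

lemma trivial_zeros_card:
  assumes "w > 0" "Re \<mu> \<ge> 0" "R > 0"
  shows "finite (trivial_zeros w \<mu> R)" "real (card (trivial_zeros w \<mu> R)) \<le> w * R + 1"
    "w * R - Re \<mu> - 1 \<le> real (card (trivial_zeros w \<mu> R))"
proof -
  define A where "A = {n::nat. 0 < real n + Re \<mu> \<and> real n + Re \<mu> < w * R}"
  define f where "f = (\<lambda>n::nat. - (of_nat n + \<mu>) / complex_of_real w)"
  have eq: "trivial_zeros w \<mu> R = f ` A"
  proof (intro equalityI subsetI)
    fix s assume s: "s \<in> trivial_zeros w \<mu> R"
    then obtain n where n: "of_real w * s + \<mu> = - of_nat n"
      unfolding trivial_zeros_def by (auto elim!: nonpos_Ints_cases')
    then have "of_real w * s = - (of_nat n + \<mu>)" by (simp add: eq_diff_eq[symmetric])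
    then have "s = f n" using assms(1) by (simp add: f_def eq_divide_eq mult.commute)
    moreover have "w * Re s + Re \<mu> = - real n" using arg_cong[OF n, of Re] by simp
    moreover have "w * Re s < 0" "w * (- R) < w * Re s"
      using s assms(1) mult_strict_left_mono[of "- R" "Re s" w] unfolding trivial_zeros_def
      by (auto intro!: mult_pos_neg)
    ultimately have "n \<in> A" by (simp add: A_def)
    with \<open>s = f n\<close> show "s \<in> f ` A" by blast
  next
    fix s assume "s \<in> f ` A"
    then obtain n where n: "s = f n" "n \<in> A" by auto
    have "of_real w * s + \<mu> = - of_nat n" using assms(1) by (simp add: n f_def)
    moreover have "Re s = - ((real n + Re \<mu>) / w)"
      by (simp add: n f_def Re_divide_of_real minus_divide_left)
    moreover have "(real n + Re \<mu>) / w > 0" "(real n + Re \<mu>) / w < R"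
      using n(2) assms(1) by (auto simp: A_def field_simps)
    ultimately show "s \<in> trivial_zeros w \<mu> R"
      by (simp add: trivial_zeros_def)
  qed
  have inj: "inj_on f A" using assms(1) by (auto simp: inj_on_def f_def)
  have card: "card (trivial_zeros w \<mu> R) = card A" by (simp add: eq card_image[OF inj])
  have sub: "A \<subseteq> {..<nat \<lceil>w * R\<rceil>}"
  proof
    fix n assume "n \<in> A"
    then have "real n < w * R" using assms(2) by (auto simp: A_def)
    then show "n \<in> {..<nat \<lceil>w * R\<rceil>}" by (simp add: less_ceiling_iff zless_nat_eq_int_zless)
  qed
  then have finA: "finite A" by (rule finite_subset) simp
  then show "finite (trivial_zeros w \<mu> R)" by (simp add: eq)
  have "real (card A) \<le> real (nat \<lceil>w * R\<rceil>)" using card_mono[OF _ sub] by simp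
  also have "\<dots> \<le> w * R + 1" using assms by (simp add: of_nat_nat)
  finally show "real (card (trivial_zeros w \<mu> R)) \<le> w * R + 1" by (simp add: card)
  \<comment> \<open>\<open>n = 0\<close> is left out: when \<open>Re \<mu> = 0\<close> it belongs to
    a point with \<open>Re s = 0\<close>, outside the strip.\<close>
  have "{1..<nat \<lceil>w * R - Re \<mu>\<rceil>} \<subseteq> A"
  proof
    fix n assume n: "n \<in> {1..<nat \<lceil>w * R - Re \<mu>\<rceil>}"
    then have "int n < \<lceil>w * R - Re \<mu>\<rceil>" by auto
    then have "real n < w * R - Re \<mu>" by (simp add: less_ceiling_iff)
    then show "n \<in> A" using n assms(2) by (auto simp: A_def)
  qed
  then have "card {1..<nat \<lceil>w * R - Re \<mu>\<rceil>} \<le> card A" by (rule card_mono[OF finA])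
  then show "w * R - Re \<mu> - 1 \<le> real (card (trivial_zeros w \<mu> R))" unfolding card
    by simp linarith
qed

text \<open>Double counting of the pairs \<open>(s, i)\<close>. The set \<open>Z\<close> may contain
  more than the zeros, so that one \<open>Z\<close> can serve a product and both of its
  factors.\<close>

lemma sum_zorder_eq:
  assumes a: "a \<in> selberg_class" and d: "selberg_data a F \<epsilon> Q k w \<mu>" and R: "R > 0"
    and Z: "finite Z" "\<And>s. s \<in> Z \<Longrightarrow> - R < Re s \<and> Re s < 0" "\<And>i. i < k \<Longrightarrow> trivial_zeros (w i) (\<mu> i) R \<subseteq> Z"
  shows "(\<Sum>s\<in>Z. zorder F s) = (\<Sum>i<k. int (card (trivial_zeros (w i) (\<mu> i) R)))"
proof -
  have "(\<Sum>s\<in>Z. zorder F s) = (\<Sum>s\<in>Z. \<Sum>i<k. if of_real (w i) * s + \<mu> i \<in> \<int>\<^sub>\<le>\<^sub>0 then 1 else 0)"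
    using selberg_data_left(3)[OF a d] Z(2)
    by (intro sum.cong refl) (simp add: sum.If_cases Int_def lessThan_def)
  also have "\<dots> = (\<Sum>i<k. \<Sum>s\<in>Z. if of_real (w i) * s + \<mu> i \<in> \<int>\<^sub>\<le>\<^sub>0 then 1 else 0)" by (rule sum.swap)
  also have "\<dots> = (\<Sum>i<k. int (card (trivial_zeros (w i) (\<mu> i) R)))"
  proof (intro sum.cong refl)
    fix i assume "i \<in> {..<k}"
    then have "Z \<inter> {s. of_real (w i) * s + \<mu> i \<in> \<int>\<^sub>\<le>\<^sub>0} = trivial_zeros (w i) (\<mu> i) R"
      using Z(2) Z(3)[of i] unfolding trivial_zeros_def by blast
    then show "(\<Sum>s\<in>Z. if of_real (w i) * s + \<mu> i \<in> \<int>\<^sub>\<le>\<^sub>0 then 1 else 0) = int (card (trivial_zeros (w i) (\<mu> i) R))"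
      using Z(1) by (simp add: sum.If_cases)
  qed
  finally show ?thesis .
qed

lemma continuation_from_right:
  assumes "f holomorphic_on - {1}" "g holomorphic_on - {1}" "\<And>s. Re s > 1 \<Longrightarrow> f s = g s" "s \<noteq> 1"
  shows "f s = g s"
proof (rule analytic_continuation_open[of "{s. Re s > 1}" "- {1}" f g])
  show "open {s. Re s > 1}" by (simp add: open_halfspace_Re_gt)
  show "{s. 1 < Re s} \<noteq> {}" by (auto intro!: exI[of _ 2])
  show "connected (- {1::complex})" by (rule connected_punctured_universe) simp
qed (use assms in auto)

text \<open>The Gamma factors chosen for the product need not be those of the two elements put
  together, so weights are compared through zeros. Orders add in \<open>F = F1 * F2\<close>, and the
  total order in \<open>- R < Re s < 0\<close> is \<open>R\<close> times the weight up to a bounded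
  error; taking \<open>R\<close> large gives the claim.\<close>

lemma selberg_weight_superadditive:
  assumes a: "a \<in> selberg_class" "selberg_data a F \<epsilon> Q k w \<mu>"
    and a1: "a1 \<in> selberg_class" "selberg_data a1 F1 \<epsilon>1 Q1 k1 w1 \<mu>1"
    and a2: "a2 \<in> selberg_class" "selberg_data a2 F2 \<epsilon>2 Q2 k2 w2 \<mu>2"
    and prod: "is_product_of a {#a1, a2#}"
  shows "(\<Sum>i<k1. w1 i) + (\<Sum>i<k2. w2 i) \<le> (\<Sum>i<k. w i)"
proof -
  note d = a(2)[unfolded selberg_data_def] and d1 = a1(2)[unfolded selberg_data_def] and d2 = a2(2)[unfolded selberg_data_def]
  have F: "F s = F1 s * F2 s" if "s \<noteq> 1" for s
    by (rule continuation_from_right[OF _ _ _ that])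
       (use prod d d1 d2 in \<open>auto simp: is_product_of_def intro!: holomorphic_intros\<close>)
  define C where "C = (\<Sum>i<k1. Re (\<mu>1 i) + 1) + (\<Sum>i<k2. Re (\<mu>2 i) + 1) + real k"
  have bound: "((\<Sum>i<k1. w1 i) + (\<Sum>i<k2. w2 i) - (\<Sum>i<k. w i)) * R \<le> C" if R: "R > 0" for R
  proof -
    define Z where "Z = (\<Union>i<k. trivial_zeros (w i) (\<mu> i) R) \<union> (\<Union>i<k1. trivial_zeros (w1 i) (\<mu>1 i) R)
       \<union> (\<Union>i<k2. trivial_zeros (w2 i) (\<mu>2 i) R)"
    have finZ: "finite Z" unfolding Z_def
      using trivial_zeros_card(1) R d d1 d2 by (intro finite_UnI finite_UN_I) auto
    have ZR: "- R < Re s \<and> Re s < 0" if "s \<in> Z" for s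
      using that by (auto simp: Z_def trivial_zeros_def)
    have "(\<Sum>s\<in>Z. zorder F s) = (\<Sum>s\<in>Z. zorder F1 s + zorder F2 s)"
    proof (intro sum.cong refl)
      fix s assume "s \<in> Z"
      then have s: "Re s < 0" using ZR by auto
      have "\<forall>\<^sub>F z in at s. z \<noteq> 1" by (rule eventually_neq_at_within)
      then have ev: "\<forall>\<^sub>F z in at s. F z = F1 z * F2 z" by eventually_elim (rule F)
      have "\<forall>\<^sub>F z in at s. F1 z * F2 z \<noteq> 0"
        using ev selberg_data_left(2)[OF a s] by eventually_elim auto
      from zorder_times_analytic[OF selberg_data_left(1)[OF a1 s] selberg_data_left(1)[OF a2 s] this]
      show "zorder F s = zorder F1 s + zorder F2 s" using zorder_cong[OF ev refl] by simp
    qed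
    also have "\<dots> = (\<Sum>s\<in>Z. zorder F1 s) + (\<Sum>s\<in>Z. zorder F2 s)" by (rule sum.distrib)
    finally have zz: "(\<Sum>s\<in>Z. zorder F s) = (\<Sum>s\<in>Z. zorder F1 s) + (\<Sum>s\<in>Z. zorder F2 s)" .
    have "(\<Sum>i<k. int (card (trivial_zeros (w i) (\<mu> i) R)))
        = (\<Sum>i<k1. int (card (trivial_zeros (w1 i) (\<mu>1 i) R))) + (\<Sum>i<k2. int (card (trivial_zeros (w2 i) (\<mu>2 i) R)))"
    proof -
      have "(\<Sum>s\<in>Z. zorder F s) = (\<Sum>i<k. int (card (trivial_zeros (w i) (\<mu> i) R)))"
        by (rule sum_zorder_eq[OF a R finZ ZR]) (auto simp: Z_def)
      moreover have "(\<Sum>s\<in>Z. zorder F1 s) = (\<Sum>i<k1. int (card (trivial_zeros (w1 i) (\<mu>1 i) R)))"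
        by (rule sum_zorder_eq[OF a1 R finZ ZR]) (auto simp: Z_def)
      moreover have "(\<Sum>s\<in>Z. zorder F2 s) = (\<Sum>i<k2. int (card (trivial_zeros (w2 i) (\<mu>2 i) R)))"
        by (rule sum_zorder_eq[OF a2 R finZ ZR]) (auto simp: Z_def)
      ultimately show ?thesis using zz by simp
    qed
    from arg_cong[OF this, of real_of_int]
    have "(\<Sum>i<k. real (card (trivial_zeros (w i) (\<mu> i) R)))
        = (\<Sum>i<k1. real (card (trivial_zeros (w1 i) (\<mu>1 i) R))) + (\<Sum>i<k2. real (card (trivial_zeros (w2 i) (\<mu>2 i) R)))"
      by simp
    moreover have "(\<Sum>i<k. real (card (trivial_zeros (w i) (\<mu> i) R))) \<le> (\<Sum>i<k. w i * R + 1)"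
      using d R by (intro sum_mono trivial_zeros_card(2)) auto
    moreover have "(\<Sum>i<k1. w1 i * R - Re (\<mu>1 i) - 1) \<le> (\<Sum>i<k1. real (card (trivial_zeros (w1 i) (\<mu>1 i) R)))"
      using d1 R by (intro sum_mono trivial_zeros_card(3)) auto
    moreover have "(\<Sum>i<k2. w2 i * R - Re (\<mu>2 i) - 1) \<le> (\<Sum>i<k2. real (card (trivial_zeros (w2 i) (\<mu>2 i) R)))"
      using d2 R by (intro sum_mono trivial_zeros_card(3)) auto
    ultimately show ?thesis
      unfolding C_def by (simp add: sum.distrib sum_subtractf sum_distrib_right[symmetric] left_diff_distrib distrib_right)
  qed
  show ?thesis
  proof (rule ccontr)
    let ?d = "(\<Sum>i<k1. w1 i) + (\<Sum>i<k2. w2 i) - (\<Sum>i<k. w i)"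
    assume "\<not> ?thesis"
    then have pos: "?d > 0" by simp
    have "?d * ((\<bar>C\<bar> + 1) / ?d) \<le> C" by (rule bound) (use pos in auto)
    then show False using pos by simp
  qed
qed

section \<open>Growth in the left half-plane\<close>


lemma norm_Gamma_le:
  assumes "Re z > 0"
  shows "norm (Gamma z) \<le> Gamma (Re z)"
proof -
  have c: "((\<lambda>t. of_real t powr (z - 1) / of_real (exp t)) has_integral Gamma z) {0..}"
    by (rule Gamma_integral_complex[OF assms])
  have r: "((\<lambda>t. t powr (Re z - 1) / exp t) has_integral Gamma (Re z)) {0..}"
    by (rule Gamma_integral_real[OF assms])
  have "norm (integral {0..} (\<lambda>t. of_real t powr (z - 1) / of_real (exp t) :: complex))
     \<le> integral {0..} (\<lambda>t. t powr (Re z - 1) / exp t)"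
  proof (rule integral_norm_bound_integral)
    fix t :: real assume "t \<in> {0..}"
    then show "norm (of_real t powr (z - 1) / of_real (exp t) :: complex) \<le> t powr (Re z - 1) / exp t"
      by (cases "t = 0") (simp_all add: norm_divide norm_powr_real_powr)
  qed (use c r in \<open>auto simp: has_integral_iff\<close>)
  then show ?thesis using c r by (simp add: has_integral_iff)
qed

text \<open>Log-convexity with \<open>Gamma 1 = Gamma 2 = 1\<close> gives
  \<open>Gamma x \<le> 1\<close> between 1 and 2, and
  \<open>Gamma x = (x - 1) * Gamma (x - 1)\<close> carries the bound to the right.\<close>

lemma Gamma_le_powr_self:
  assumes "(x::real) \<ge> 1"
  shows "Gamma x \<le> x powr x"
proof -
  have base: "Gamma x \<le> 1" if "x \<ge> 1" "x \<le> 2" for x :: real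
  proof -
    have "(ln \<circ> Gamma) ((1 - (x - 1)) *\<^sub>R 1 + (x - 1) *\<^sub>R 2) \<le> (1 - (x - 1)) * (ln \<circ> Gamma) 1 + (x - 1) * (ln \<circ> Gamma) (2::real)"
      by (rule convex_onD[OF log_convex_Gamma_real]) (use that in auto)
    moreover have "Gamma (2::real) = 1" using Gamma_fact[of 1, where 'a = real] by simp
    ultimately have "ln (Gamma x) \<le> 0" by (simp add: algebra_simps)
    moreover have "Gamma x > 0" using that by (intro Gamma_real_pos) auto
    ultimately show ?thesis by simp
  qed
  have "x \<ge> 1 \<Longrightarrow> x \<le> real n + 2 \<Longrightarrow> Gamma x \<le> x powr x" for n x
  proof (induction n arbitrary: x)
    case 0
    then have "Gamma x \<le> 1" by (intro base) auto
    also have "1 \<le> x powr x" using 0 by (intro ge_one_powr_ge_zero) auto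
    finally show ?case .
  next
    case (Suc n)
    show ?case
    proof (cases "x \<le> 2")
      case True
      then have "Gamma x \<le> 1" using Suc by (intro base) auto
      also have "1 \<le> x powr x" using Suc by (intro ge_one_powr_ge_zero) auto
      finally show ?thesis .
    next
      case False
      then have "Gamma (x - 1) \<le> (x - 1) powr (x - 1)" using Suc by (intro Suc.IH) auto
      also have "\<dots> \<le> x powr (x - 1)" using False by (intro powr_mono2) auto
      finally have IH: "Gamma (x - 1) \<le> x powr (x - 1)" .
      have "Gamma x = (x - 1) * Gamma (x - 1)" using Gamma_plus1[of "x - 1"] False
        by (auto simp: nonpos_Ints_def)
      also have "\<dots> \<le> x * x powr (x - 1)" using IH False Gamma_real_pos[of "x - 1"] by (intro mult_mono) auto
      also have "\<dots> = x powr x" using False by (simp add: powr_diff)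
      finally show ?thesis .
    qed
  qed
  from this[of x "nat \<lceil>x\<rceil>"] assms show ?thesis by linarith
qed

lemma norm_sin_le: "norm (sin z :: complex) \<le> exp \<bar>Im z\<bar>"
proof -
  have "norm (sin z) = norm (exp (\<i> * z) - exp (- (\<i> * z))) / 2"
    by (simp add: sin_exp_eq norm_divide norm_mult)
  also have "\<dots> \<le> (norm (exp (\<i> * z)) + norm (exp (- (\<i> * z)))) / 2"
    by (intro divide_right_mono norm_triangle_ineq4) auto
  also have "\<dots> \<le> (exp \<bar>Im z\<bar> + exp \<bar>Im z\<bar>) / 2"
    by (intro divide_right_mono add_mono) auto
  finally show ?thesis by simp
qed

text \<open>By the reflection formula \<open>rGamma z\<close> is
  \<open>Gamma (1 - z) * sin (pi * z) / pi\<close>. The sine is the source of the exponential growth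
  in \<open>Im z\<close>, and hence of the factor \<open>pi\<close> in the later exponents.\<close>

lemma norm_rGamma_le:
  assumes "Re z < 1"
  shows "norm (rGamma z) \<le> Gamma (1 - Re z) * exp (pi * \<bar>Im z\<bar>)"
proof -
  have nz: "1 - z \<notin> \<int>\<^sub>\<le>\<^sub>0" using assms by (intro Re_pos_notin_nonpos_Ints) simp
  have "rGamma z = Gamma (1 - z) * (sin (of_real pi * z) / of_real pi)"
    unfolding rGamma_reflection_complex[symmetric]
    using nz by (simp add: rGamma_inverse_Gamma Gamma_eq_zero_iff)
  also have "norm \<dots> \<le> Gamma (1 - Re z) * (exp (pi * \<bar>Im z\<bar>) / 1)"
    unfolding norm_mult norm_divide
  proof (intro mult_mono frac_le)
    show "norm (Gamma (1 - z)) \<le> Gamma (1 - Re z)" using norm_Gamma_le[of "1 - z"] assms by simp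
    show "norm (sin (of_real pi * z)) \<le> exp (pi * \<bar>Im z\<bar>)"
      using norm_sin_le[of "of_real pi * z"] by (simp add: abs_mult)
    show "1 \<le> norm (complex_of_real pi)" using pi_gt3 by simp
    show "0 \<le> Gamma (1 - Re z)" using Gamma_real_pos[of "1 - Re z"] assms by simp
  qed auto
  finally show ?thesis by simp
qed

text \<open>On \<open>Re s = 1 - T\<close>, after reflection of the reciprocal factor, both Gamma
  functions are bounded by their values at real points between 1 and \<open>w * T + M\<close>. The
  lower bound on \<open>T\<close> secures the left end; together with \<open>w \<le> 1 / 2\<close>
  it also gives \<open>w * T + M \<le> T\<close>, so that
  \<open>x powr x \<le> T powr x\<close>.\<close>

lemma Gamma_ratio_bound:
  assumes w: "w > 0" "w \<le> 1 / 2" and M: "Re \<mu> \<ge> 0" "1 + w + Re \<mu> + \<bar>Im \<mu>\<bar> \<le> M" and T: "2 * M / w \<le> T"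
  shows "norm (Gamma (of_real w * (1 - Complex (1 - T) (T * y)) + cnj \<mu>) * rGamma (of_real w * Complex (1 - T) (T * y) + \<mu>))
     \<le> T powr (2 * (w * T + M)) * exp (pi * (w * T * \<bar>y\<bar> + M))"
proof -
  let ?s = "Complex (1 - T) (T * y)"
  let ?z = "of_real w * (1 - ?s) + cnj \<mu>" and ?z' = "of_real w * ?s + \<mu>"
  have wT: "w * T \<ge> 2 * M" using T w by (simp add: field_simps)
  have M1: "M \<ge> 1" using M w by simp
  have "0 \<le> 2 * M / w" using M1 w by simp
  then have T0: "0 \<le> T" using T by linarith
  then have "w * T \<le> 1 / 2 * T"
    using w by (intro mult_right_mono) auto
  then have T2: "w * T + M \<le> T" using wT T0 by linarith
  have T1: "T \<ge> 1" using T2 wT M1 by linarith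
  have g: "Gamma x \<le> T powr (w * T + M)" if "1 \<le> x" "x \<le> w * T + M" for x
  proof -
    have "Gamma x \<le> x powr x" by (rule Gamma_le_powr_self[OF that(1)])
    also have "\<dots> \<le> T powr x" using that T2 by (intro powr_mono2) auto
    also have "\<dots> \<le> T powr (w * T + M)" using that T1 by (intro powr_mono) auto
    finally show ?thesis .
  qed
  have Rez: "Re ?z = w * T + Re \<mu>" by (simp add: algebra_simps)
  have Rez': "1 - Re ?z' = w * T + 1 - w - Re \<mu>" by (simp add: algebra_simps)
  have Imz': "Im ?z' = w * (T * y) + Im \<mu>" by simp
  have a1: "norm (Gamma ?z) \<le> T powr (w * T + M)"
  proof -
    have "norm (Gamma ?z) \<le> Gamma (Re ?z)" by (rule norm_Gamma_le) (use Rez wT M M1 in linarith)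
    also have "\<dots> \<le> T powr (w * T + M)" unfolding Rez by (rule g) (use wT M M1 w in linarith)+
    finally show ?thesis .
  qed
  have a2: "norm (rGamma ?z') \<le> T powr (w * T + M) * exp (pi * (w * T * \<bar>y\<bar> + M))"
  proof -
    have "norm (rGamma ?z') \<le> Gamma (1 - Re ?z') * exp (pi * \<bar>Im ?z'\<bar>)"
      by (rule norm_rGamma_le) (use Rez' wT M M1 in linarith)
    also have "\<dots> \<le> T powr (w * T + M) * exp (pi * (w * T * \<bar>y\<bar> + M))"
    proof (intro mult_mono)
      show "Gamma (1 - Re ?z') \<le> T powr (w * T + M)" unfolding Rez' by (rule g) (use wT M M1 w in linarith)+
      have "\<bar>Im ?z'\<bar> \<le> \<bar>w * (T * y)\<bar> + \<bar>Im \<mu>\<bar>" unfolding Imz' by (rule abs_triangle_ineq)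
      also have "\<dots> \<le> w * T * \<bar>y\<bar> + M" using w T1 M by (simp add: abs_mult)
      finally show "exp (pi * \<bar>Im ?z'\<bar>) \<le> exp (pi * (w * T * \<bar>y\<bar> + M))" by simp
    qed auto
    finally show ?thesis .
  qed
  have "norm (Gamma ?z * rGamma ?z') \<le> T powr (w * T + M) * (T powr (w * T + M) * exp (pi * (w * T * \<bar>y\<bar> + M)))"
    unfolding norm_mult using a1 a2 by (intro mult_mono) auto
  also have "\<dots> = T powr (2 * (w * T + M)) * exp (pi * (w * T * \<bar>y\<bar> + M))"
    by (simp only: mult.assoc[symmetric] powr_add[symmetric]) (simp only: mult_2)
  finally show ?thesis .
qed

text \<open>The leading exponents involve the Gamma factors only through the total weight.
  \<open>M\<close> bounds the shifts \<open>\<mu> i\<close> for all \<open>i\<close> at once, and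
  \<open>T0\<close> makes the estimate of each Gamma ratio applicable. The height is written
  \<open>T * y\<close> to fit the stretched contour.\<close>

lemma selberg_growth:
  assumes a: "a \<in> selberg_class" and d: "selberg_data a F \<epsilon> Q k w \<mu>" and W: "\<And>i. i < k \<Longrightarrow> w i \<le> 1 / 2"
  shows "\<exists>M\<ge>0. \<exists>T0\<ge>2. \<forall>T\<ge>T0. \<forall>y. norm (F (Complex (1 - T) (T * y))) \<le>
    (Q powr (2 * T - 1) * T powr (2 * ((\<Sum>i<k. w i) * T + real k * M)) * (exp (pi * real k * M) * (\<Sum>n. norm (a n) / real n powr 2)))
      * exp (pi * (\<Sum>i<k. w i) * T * \<bar>y\<bar>)"
proof -
  note d' = d[unfolded selberg_data_def]
  define M where "M = (\<Sum>i<k. 1 + w i + Re (\<mu> i) + \<bar>Im (\<mu> i)\<bar>)"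
  define T0 where "T0 = 2 + (\<Sum>i<k. 2 * M / w i)"
  have pos: "0 \<le> 1 + w i + Re (\<mu> i) + \<bar>Im (\<mu> i)\<bar>" if "i < k" for i using d' that by (simp add: add_nonneg_nonneg less_imp_le)
  have M0: "M \<ge> 0" unfolding M_def by (intro sum_nonneg) (use pos in auto)
  have Mi: "1 + w i + Re (\<mu> i) + \<bar>Im (\<mu> i)\<bar> \<le> M" if "i < k" for i
    unfolding M_def using that pos by (intro member_le_sum) auto
  have pT: "0 \<le> 2 * M / w i" if "i < k" for i using d' M0 that by (simp add: less_imp_le)
  have Ti: "2 * M / w i \<le> T0" if "i < k" for i
  proof -
    have "2 * M / w i \<le> (\<Sum>i<k. 2 * M / w i)" using that pT by (intro member_le_sum) auto
    then show ?thesis by (simp add: T0_def)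
  qed
  have T0: "T0 \<ge> 2" unfolding T0_def using sum_nonneg[of "{..<k}" "\<lambda>i. 2 * M / w i"] pT by auto
  have "norm (F (Complex (1 - T) (T * y))) \<le>
    (Q powr (2 * T - 1) * T powr (2 * ((\<Sum>i<k. w i) * T + real k * M)) * (exp (pi * real k * M) * (\<Sum>n. norm (a n) / real n powr 2)))
      * exp (pi * (\<Sum>i<k. w i) * T * \<bar>y\<bar>)" if T: "T \<ge> T0" for T y
  proof -
    let ?s = "Complex (1 - T) (T * y)"
    have T2: "T \<ge> 2" using T T0 by simp
    let ?P = "\<Prod>i<k. Gamma (of_real (w i) * (1 - ?s) + cnj (\<mu> i)) * rGamma (of_real (w i) * ?s + \<mu> i)"
    have "F ?s = dual_factor a \<epsilon> Q k w \<mu> ?s * (\<Prod>i<k. rGamma (of_real (w i) * ?s + \<mu> i))"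
      using d' T2 by auto
    also have "\<dots> = cnj \<epsilon> / \<epsilon> * of_real Q powr (1 - 2 * ?s) * ?P * dseries (\<lambda>n. cnj (a n)) (1 - ?s)"
      by (simp add: dual_factor_def prod.distrib mult_ac)
    finally have "norm (F ?s) = norm (of_real Q powr (1 - 2 * ?s) :: complex) * norm ?P * norm (dseries (\<lambda>n. cnj (a n)) (1 - ?s))"
      using d' by (simp add: norm_mult norm_divide)
    also have "\<dots> \<le> Q powr (2 * T - 1) * (\<Prod>i<k. T powr (2 * (w i * T + M)) * exp (pi * (w i * T * \<bar>y\<bar> + M))) * (\<Sum>n. norm (a n) / real n powr 2)"
    proof (intro mult_mono)
      show "norm (of_real Q powr (1 - 2 * ?s) :: complex) \<le> Q powr (2 * T - 1)"
        using d' by (simp add: norm_powr_real_powr)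
      show "norm ?P \<le> (\<Prod>i<k. T powr (2 * (w i * T + M)) * exp (pi * (w i * T * \<bar>y\<bar> + M)))"
        unfolding prod_norm[symmetric]
      proof (intro prod_mono conjI)
        fix i assume "i \<in> {..<k}"
        then have i: "i < k" by simp
        show "norm (Gamma (of_real (w i) * (1 - ?s) + cnj (\<mu> i)) * rGamma (of_real (w i) * ?s + \<mu> i))
            \<le> T powr (2 * (w i * T + M)) * exp (pi * (w i * T * \<bar>y\<bar> + M))"
          using d' i W[OF i] Mi[OF i] Ti[OF i] T by (intro Gamma_ratio_bound) auto
      qed simp
      have "abs_conv (\<lambda>n. cnj (a n)) 2" using selberg_abs_conv[OF a, of 2] by (simp add: abs_conv_cnj)
      from norm_dseries_le[OF this, of "1 - ?s"] T2
      show "norm (dseries (\<lambda>n. cnj (a n)) (1 - ?s)) \<le> (\<Sum>n. norm (a n) / real n powr 2)" by simp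
    qed (auto intro!: prod_nonneg mult_nonneg_nonneg)
    also have "(\<Prod>i<k. T powr (2 * (w i * T + M)) * exp (pi * (w i * T * \<bar>y\<bar> + M)))
       = T powr (\<Sum>i<k. 2 * (w i * T + M)) * exp (\<Sum>i<k. pi * (w i * T * \<bar>y\<bar> + M))"
      using T2 by (simp add: prod.distrib exp_sum powr_sum)
    also have "(\<Sum>i<k. 2 * (w i * T + M)) = 2 * ((\<Sum>i<k. w i) * T + real k * M)"
      by (simp add: sum_distrib_left[symmetric] sum_distrib_right[symmetric] sum.distrib)
    also have "(\<Sum>i<k. pi * (w i * T * \<bar>y\<bar> + M)) = pi * real k * M + pi * (\<Sum>i<k. w i) * T * \<bar>y\<bar>"
      by (simp add: sum_distrib_left[symmetric] sum_distrib_right[symmetric] sum.distrib distrib_left mult_ac)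
    finally show ?thesis by (simp add: exp_add mult_ac)
  qed
  with M0 T0 show ?thesis by blast
qed

lemma selberg_coefficient_bound:
  assumes a: "a \<in> selberg_class" and d: "selberg_data a F \<epsilon> Q k w \<mu>" and W: "\<forall>i<k. w i \<le> 1 / 2"
    and G: "G holomorphic_on UNIV" "exp_growth G" "\<forall>s. s \<noteq> 1 \<longrightarrow> G s = (s - 1) ^ m * F s"
  shows "\<exists>c>0. \<exists>K\<ge>0. \<exists>M\<ge>0. \<exists>T0\<ge>2. \<exists>C\<ge>0. \<forall>N>0. \<forall>T\<ge>T0.
    c * norm (a N) \<le> K * (real N ^ 3 * (real N / real (Suc N)) powr (T - 1)
       + real N * (real N powr (- T) * (Q powr (2 * T - 1) * T powr (2 * ((\<Sum>i<k. w i) * T + real k * M)) * C)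
          * exp (pi * (\<Sum>i<k. w i) * T * ln (8 * (pi * (\<Sum>i<k. w i) * T) + 8))))"
proof -
  let ?W = "\<Sum>i<k. w i"
  note d' = d[unfolded selberg_data_def]
  have W0: "?W \<ge> 0" using d' by (intro sum_nonneg) (auto simp: less_imp_le)
  obtain M T0 where M: "M \<ge> 0" "T0 \<ge> 2" and gr: "\<And>T y. T \<ge> T0 \<Longrightarrow> norm (F (Complex (1 - T) (T * y))) \<le>
    (Q powr (2 * T - 1) * T powr (2 * (?W * T + real k * M)) * (exp (pi * real k * M) * (\<Sum>n. norm (a n) / real n powr 2)))
      * exp (pi * ?W * T * \<bar>y\<bar>)"
    using selberg_growth[OF a d] W by blast
  define C where "C = exp (pi * real k * M) * (\<Sum>n. norm (a n) / real n powr 2)"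
  have ac: "abs_conv a 2" by (rule selberg_abs_conv[OF a]) simp
  have C: "C \<ge> 0" unfolding C_def using ac
    by (intro mult_nonneg_nonneg suminf_nonneg) (auto simp: abs_conv_def)
  \<comment> \<open>A second factor \<open>(s - 1) ^ m\<close> makes the exponent even, as the
    isolation of a coefficient demands.\<close>
  define H where "H = (\<lambda>s. (s - 1) ^ m * G s)"
  have H: "H s = (s - 1) ^ (2 * m) * F s" if "s \<noteq> 1" for s
    using G(3) that by (simp add: H_def mult_2 power_add)
  have hH: "H holomorphic_on UNIV" unfolding H_def by (intro holomorphic_intros G)
  have gH: "exp_growth H" unfolding H_def
  proof (intro exp_growth_mult G(2) exp_growth_power)
    show "exp_growth (\<lambda>s. s - 1)" using exp_growth_add[OF exp_growth_ident exp_growth_const[of "- 1"]] by simp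
  qed
  have HF: "\<forall>s. Re s \<ge> 2 \<longrightarrow> H s = (s - 1) ^ (2 * m) * dseries a s"
  proof (intro allI impI)
    fix s :: complex assume "Re s \<ge> 2"
    then show "H s = (s - 1) ^ (2 * m) * dseries a s" using H[of s] d' by (cases "s = 1") auto
  qed
  from coefficient_bound[OF ac hH gH HF]
  obtain c K where cK: "c > 0" "K \<ge> 0" and main: "\<forall>N>0. \<forall>T\<ge>1. \<forall>A\<ge>0. \<forall>D\<ge>0.
    (\<forall>y. norm (H (Complex (1 - T) (T * y))) \<le> T ^ (2 * m) * D * (1 + \<bar>y\<bar>) ^ (2 * m) * exp (A * \<bar>y\<bar>)) \<longrightarrow>
    c * norm (a N) \<le> K * (real N ^ 3 * (real N / real (Suc N)) powr (T - 1)
       + real N * (real N powr (- T) * D * exp (A * ln (8 * A + 8))))"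
    by (elim exE conjE) (rule that; assumption)
  have "c * norm (a N) \<le> K * (real N ^ 3 * (real N / real (Suc N)) powr (T - 1)
       + real N * (real N powr (- T) * (Q powr (2 * T - 1) * T powr (2 * (?W * T + real k * M)) * C)
          * exp (pi * ?W * T * ln (8 * (pi * ?W * T) + 8))))" if N: "N > 0" and T: "T \<ge> T0" for N T
  proof (rule main[rule_format, OF N])
    show "1 \<le> T" "0 \<le> pi * ?W * T" using T M W0 by auto
    show "0 \<le> Q powr (2 * T - 1) * T powr (2 * (?W * T + real k * M)) * C" using C by simp
    fix y
    let ?s = "Complex (1 - T) (T * y)"
    have ne: "?s \<noteq> 1" using T M by (auto simp: complex_eq_iff)
    have "norm (H ?s) = norm (?s - 1) ^ (2 * m) * norm (F ?s)"
      by (simp add: H[OF ne] norm_mult norm_power)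
    also have "\<dots> \<le> (T * (1 + \<bar>y\<bar>)) ^ (2 * m) * ((Q powr (2 * T - 1) * T powr (2 * (?W * T + real k * M)) * C) * exp (pi * ?W * T * \<bar>y\<bar>))"
    proof (intro mult_mono power_mono)
      have "?s - 1 = of_real T * Complex (-1) y" by (simp add: complex_eq_iff)
      then show "norm (?s - 1) \<le> T * (1 + \<bar>y\<bar>)" using norm_Complex_le[of "-1" y] T M by (simp add: norm_mult)
      show "norm (F ?s) \<le> (Q powr (2 * T - 1) * T powr (2 * (?W * T + real k * M)) * C) * exp (pi * ?W * T * \<bar>y\<bar>)"
        unfolding C_def by (rule gr[OF T])
    qed (use T M in auto)
    finally show "norm (H ?s) \<le> T ^ (2 * m) * (Q powr (2 * T - 1) * T powr (2 * (?W * T + real k * M)) * C) * (1 + \<bar>y\<bar>) ^ (2 * m) * exp (pi * ?W * T * \<bar>y\<bar>)"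
      by (simp add: power_mult_distrib mult_ac)
  qed
  then show ?thesis using cK M C by blast
qed

text \<open>With \<open>T = N ^ 2\<close> one has \<open>ln T = 2 * ln N\<close>. The shift gains
  \<open>T * ln N\<close> in the exponent. The Gamma factors cost at most \<open>4 / 100\<close> of
  this, up to a multiple of \<open>ln N\<close>; the stretched kernel costs
  \<open>A * ln (8 * A + 8)\<close> with \<open>A = pi * V * T\<close>, at most
  \<open>8 / 100\<close> of it. More than half of the gain remains, and the power of
  \<open>Q\<close> costs only a multiple of \<open>T\<close>. This choice of \<open>T\<close> also
  makes \<open>(N / Suc N) powr (T - 1)\<close> decay like \<open>exp (- N)\<close>.\<close>

lemma selberg_small_weight_decay:
  assumes a: "a \<in> selberg_class" and d: "selberg_data a F \<epsilon> Q k w \<mu>" and W: "(\<Sum>i<k. w i) \<le> 1 / 100"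
    and G: "G holomorphic_on UNIV" "exp_growth G" "\<forall>s. s \<noteq> 1 \<longrightarrow> G s = (s - 1) ^ m * F s"
  shows "abs_conv a \<sigma>"
proof -
  define V where "V = (\<Sum>i<k. w i)"
  note d' = d[unfolded selberg_data_def]
  have V0: "V \<ge> 0" unfolding V_def using d' by (intro sum_nonneg) (auto simp: less_imp_le)
  have wi: "\<forall>i<k. w i \<le> 1 / 2"
  proof (intro allI impI)
    fix i assume "i < k"
    then have "w i \<le> (\<Sum>i<k. w i)" using d' by (intro member_le_sum) (auto simp: less_imp_le)
    then show "w i \<le> 1 / 2" using W by simp
  qed
  from selberg_coefficient_bound[OF a d wi G]
  obtain c K M T0 C where c: "c > 0" "K \<ge> 0" "M \<ge> 0" "T0 \<ge> 2" "C \<ge> 0" and main: "\<forall>N>0. \<forall>T\<ge>T0.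
    c * norm (a N) \<le> K * (real N ^ 3 * (real N / real (Suc N)) powr (T - 1)
       + real N * (real N powr (- T) * (Q powr (2 * T - 1) * T powr (2 * (V * T + real k * M)) * C)
          * exp (pi * V * T * ln (8 * (pi * V * T) + 8))))"
    unfolding V_def[symmetric]
    by (elim exE conjE) (rule that; assumption)
  define L where "L = \<bar>ln Q\<bar> + 1"
  define E where "E = 4 * real k * M + 1"
  have L: "L > 0" and E: "E > 0" using c by (auto simp: L_def E_def add_nonneg_pos)
  \<comment> \<open>Decay of order \<open>- B\<close> gives absolute convergence to the right of
    \<open>1 - B\<close>, and \<open>1 - B = - \<bar>\<sigma>\<bar> - 1 < \<sigma>\<close>.\<close>
  define B where "B = \<bar>\<sigma>\<bar> + 2"
  have B: "B > 0" by (simp add: B_def)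
  have ev: "\<forall>\<^sub>F N in sequentially. c * norm (a N) \<le> K * (real N ^ 3 * (real N / real (Suc N)) powr (real N ^ 2 - 1)
      + real N * (C * exp (E * ln (real N) + 2 * real N ^ 2 * L - real N ^ 2 * ln (real N) / 2)))"
    using eventually_ge_at_top[of "nat \<lceil>T0\<rceil> + 16"]
  proof eventually_elim
    case (elim N)
    define T where "T = real N ^ 2"
    have N: "real N \<ge> T0" "real N \<ge> 16" using elim by linarith+
    have "real N * 1 \<le> real N * real N" using N by (intro mult_left_mono) auto
    then have TN: "T \<ge> real N" by (simp add: T_def power2_eq_square)
    then have T: "T \<ge> T0" "T \<ge> 16" using N by auto
    have lnN: "ln (real N) > 0" using N by simp
    have lnT: "ln T = 2 * ln (real N)" using N by (simp add: T_def ln_realpow)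
    have m: "c * norm (a N) \<le> K * (real N ^ 3 * (real N / real (Suc N)) powr (T - 1)
       + real N * (real N powr (- T) * (Q powr (2 * T - 1) * T powr (2 * (V * T + real k * M)) * C)
          * exp (pi * V * T * ln (8 * (pi * V * T) + 8))))"
      using main N T(1) by auto
    have V1: "V \<le> 1 / 100" using W by (simp add: V_def)
    have pi4: "pi \<le> 4" by (rule pi_less_4[THEN less_imp_le])
    have piV: "pi * V \<le> 4 * (1 / 100)" using pi4 V1 V0 by (intro mult_mono) auto
    \<comment> \<open>\<open>T \<ge> 16\<close> suffices for
      \<open>32 / 100 * T + 8 \<le> T\<close>.\<close>
    have "8 * (pi * V * T) + 8 \<le> 8 * (4 * (1 / 100) * T) + 8"
      using piV T by (intro add_mono mult_left_mono mult_right_mono) auto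
    also have "\<dots> \<le> T" using T by simp
    finally have "ln (8 * (pi * V * T) + 8) \<le> ln T"
      using V0 T by (intro ln_mono) (auto intro!: add_nonneg_pos)
    then have "pi * V * T * ln (8 * (pi * V * T) + 8) \<le> pi * V * T * (2 * ln (real N))"
      unfolding lnT using V0 T by (intro mult_left_mono) auto
    also have "\<dots> \<le> 4 * (1 / 100) * T * (2 * ln (real N))"
      using piV T lnN by (intro mult_right_mono) auto
    finally have e1: "pi * V * T * ln (8 * (pi * V * T) + 8) \<le> 8 / 100 * (T * ln (real N))" by simp
    have "V * T \<le> 1 / 100 * T" using V1 T by (intro mult_right_mono) auto
    then have "2 * (V * T + real k * M) * (2 * ln (real N)) \<le> 2 * (1 / 100 * T + real k * M) * (2 * ln (real N))"
      using lnN by (intro mult_right_mono) auto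
    then have e2: "2 * (V * T + real k * M) * (2 * ln (real N)) \<le> 4 / 100 * (T * ln (real N)) + (E - 1) * ln (real N)"
      by (simp add: E_def algebra_simps)
    have e3: "(2 * T - 1) * ln Q \<le> 2 * T * L"
    proof -
      have "(2 * T - 1) * ln Q \<le> (2 * T - 1) * L" using T by (intro mult_left_mono) (auto simp: L_def)
      also have "\<dots> \<le> 2 * T * L" using L by (intro mult_right_mono) auto
      finally show ?thesis .
    qed
    have "0 \<le> T * ln (real N)" using T lnN by simp
    then have ex: "- T * ln (real N) + ((2 * T - 1) * ln Q + 2 * (V * T + real k * M) * (2 * ln (real N)))
         + pi * V * T * ln (8 * (pi * V * T) + 8)
       \<le> E * ln (real N) + 2 * T * L - T * ln (real N) / 2"
      using e1 e2 e3 lnN by (simp add: algebra_simps)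
    have "real N powr (- T) * (Q powr (2 * T - 1) * T powr (2 * (V * T + real k * M)) * C) * exp (pi * V * T * ln (8 * (pi * V * T) + 8))
      = C * exp (- T * ln (real N) + ((2 * T - 1) * ln Q + 2 * (V * T + real k * M) * (2 * ln (real N)))
         + pi * V * T * ln (8 * (pi * V * T) + 8))"
    proof -
      have "real N powr (- T) = exp (- T * ln (real N))" "Q powr (2 * T - 1) = exp ((2 * T - 1) * ln Q)"
        "T powr (2 * (V * T + real k * M)) = exp (2 * (V * T + real k * M) * (2 * ln (real N)))"
        using N T d' by (simp_all add: powr_def lnT)
      then show ?thesis by (simp only: exp_add mult_ac)
    qed
    also have "\<dots> \<le> C * exp (E * ln (real N) + 2 * T * L - T * ln (real N) / 2)"
      using c(5) ex by (intro mult_left_mono) auto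
    finally have "K * (real N ^ 3 * (real N / real (Suc N)) powr (T - 1)
       + real N * (real N powr (- T) * (Q powr (2 * T - 1) * T powr (2 * (V * T + real k * M)) * C)
          * exp (pi * V * T * ln (8 * (pi * V * T) + 8))))
       \<le> K * (real N ^ 3 * (real N / real (Suc N)) powr (T - 1)
       + real N * (C * exp (E * ln (real N) + 2 * T * L - T * ln (real N) / 2)))"
      using c(2) by (intro mult_left_mono add_left_mono) auto
    with m show ?case by (simp add: T_def)
  qed
  have o1: "(\<lambda>N::nat. real N ^ 3 * (real N / real (Suc N)) powr (real N ^ 2 - 1)) \<in> O(\<lambda>N. real N powr (- B))"
    using B by real_asymp
  have o2: "(\<lambda>N::nat. real N * (C * exp (E * ln (real N) + 2 * real N ^ 2 * L - real N ^ 2 * ln (real N) / 2))) \<in> O(\<lambda>N. real N powr (- B))"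
  proof -
    have "(\<lambda>N::nat. real N * exp (E * ln (real N) + 2 * real N ^ 2 * L - real N ^ 2 * ln (real N) / 2)) \<in> O(\<lambda>N. real N powr (- B))"
      using B L E by real_asymp
    then have "(\<lambda>N::nat. C * (real N * exp (E * ln (real N) + 2 * real N ^ 2 * L - real N ^ 2 * ln (real N) / 2))) \<in> O(\<lambda>N. real N powr (- B))"
      by (rule landau_o.big.cmult_in_iff'[THEN iffD2, rotated] | simp)+
    then show ?thesis by (simp add: mult_ac)
  qed
  let ?X = "\<lambda>N::nat. K * (real N ^ 3 * (real N / real (Suc N)) powr (real N ^ 2 - 1)
      + real N * (C * exp (E * ln (real N) + 2 * real N ^ 2 * L - real N ^ 2 * ln (real N) / 2)))"
  have "(\<lambda>N. c * norm (a N)) \<in> O(?X)"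
    by (rule bigoI[of _ 1]) (use ev c(1) in \<open>auto elim!: eventually_mono\<close>)
  also have "?X \<in> O(\<lambda>N. real N powr (- B))"
    using sum_in_bigo(1)[OF o1 o2] by (cases "K = 0") simp_all
  finally have "(\<lambda>N. norm (a N)) \<in> O(\<lambda>N. real N powr (- B))" using c(1) by simp
  then show ?thesis by (rule abs_conv_bigo) (auto simp: B_def)
qed

section \<open>Almost periodicity\<close>


lemma dseries_entire:
  assumes "\<And>\<sigma>. abs_conv a \<sigma>"
  shows "dseries a holomorphic_on A"
proof (rule holomorphic_on_subset[of _ UNIV])
  show "dseries a holomorphic_on UNIV"
  proof (rule holomorphic_onI)
    fix s :: complex
    show "dseries a field_differentiable at s within UNIV"
      using dseries_has_field_derivative[OF assms, of "Re s - 1" s] by (auto simp: field_differentiable_def)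
  qed
qed simp

text \<open>Cut the series where its tail of norms is below \<open>e / 4\<close>. Simultaneous
  Dirichlet approximation gives one \<open>\<tau>\<close> for which every
  \<open>\<tau> * ln n / (2 * pi)\<close> with \<open>n < N\<close> is close to an integer, so the
  first terms hardly change under the vertical shift. All estimates are made at abscissa
  \<open>\<sigma>\<close> and are therefore uniform on the half-plane.\<close>

lemma dseries_almost_periodic:
  assumes ac: "abs_conv a \<sigma>" and e: "e > 0" and T0: "T0 \<ge> 0"
  shows "\<exists>\<tau>>T0. \<forall>s. Re s \<ge> \<sigma> \<longrightarrow> norm (dseries a (s + \<i> * of_real \<tau>) - dseries a s) \<le> e"
proof -
  define c where "c = (\<lambda>n. norm (a n) / real n powr \<sigma>)"
  have sc: "summable c" using ac by (simp add: c_def abs_conv_def)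
  have c0: "c n \<ge> 0" for n by (simp add: c_def)
  define S where "S = suminf c"
  have S: "S \<ge> 0" unfolding S_def by (intro suminf_nonneg sc c0)
  obtain N where N: "norm (\<Sum>i. c (i + N)) < e / 4"
    using suminf_exist_split[of "e / 4" c] e sc by auto
  obtain N' :: nat where N': "N' > 0" "2 * pi * S * (1 / real N') < e / 2"
  proof -
    obtain N' :: nat where "(4 * pi * S + 1) / e < real N'" using reals_Archimedean2 by blast
    moreover have "0 < (4 * pi * S + 1) / e" using e S by (intro divide_pos_pos add_nonneg_pos) auto
    ultimately have *: "real N' > 0" "4 * pi * S + 1 < real N' * e" using e by (linarith, simp add: field_simps)
    then have "N' > 0" by simp
    with * have "2 * pi * S * (1 / real N') < e / 2" by (simp add: field_simps)
    then show ?thesis using that \<open>N' > 0\<close> by blast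
  qed
  \<comment> \<open>The frequencies are scaled by \<open>T0 + 1\<close>, so that
    \<open>\<tau> = q * (T0 + 1)\<close> exceeds \<open>T0\<close> for every integer
    \<open>q \<ge> 1\<close>.\<close>
  obtain q p where q: "0 < q" "\<And>i. i < N \<Longrightarrow> \<bar>of_int q * ((T0 + 1) * ln (real i) / (2 * pi)) - of_int (p i)\<bar> < 1 / real N'"
    using Dirichlet_approx_simult[OF N'(1), of N "\<lambda>i. (T0 + 1) * ln (real i) / (2 * pi)"] by blast
  define \<tau> where "\<tau> = of_int q * (T0 + 1)"
  have "1 * (T0 + 1) \<le> of_int q * (T0 + 1)" using q(1) T0 by (intro mult_right_mono) auto
  then have \<tau>: "\<tau> > T0" by (simp add: \<tau>_def)
  let ?f = "\<lambda>n. exp (- (\<i> * of_real (\<tau> * ln (real n)))) - (1::complex)"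
  have f2: "norm (?f n) \<le> 2" for n
    using norm_triangle_ineq4[of "exp (- (\<i> * of_real (\<tau> * ln (real n))))" 1] by simp
  have fs: "norm (?f n) \<le> 2 * pi * (1 / real N')" if "n < N" for n
  proof -
    define \<delta> where "\<delta> = of_int q * ((T0 + 1) * ln (real n) / (2 * pi)) - of_int (p n)"
    have "- (\<tau> * ln (real n)) = - 2 * pi * \<delta> + 2 * pi * of_int (- p n)"
    proof -
      have "2 * pi * \<delta> = of_int q * ((T0 + 1) * ln (real n)) - 2 * pi * of_int (p n)"
        by (simp add: \<delta>_def right_diff_distrib)
      then show ?thesis by (simp add: \<tau>_def)
    qed
    then have "exp (- (\<i> * of_real (\<tau> * ln (real n)))) = exp (\<i> * of_real (- 2 * pi * \<delta> + 2 * pi * of_int (- p n)))"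
      by (metis mult_minus_right of_real_minus)
    also have "\<dots> = exp (\<i> * of_real (- 2 * pi * \<delta>)) * exp (2 * of_int (- p n) * of_real pi * \<i>)"
      by (simp add: exp_add[symmetric] algebra_simps)
    also have "exp (2 * of_int (- p n) * of_real pi * \<i>) = 1"
      by (subst exp_eq_1) (auto intro!: exI[of _ "- p n"])
    finally have "norm (?f n) = norm (exp (\<i> * of_real (- 2 * pi * \<delta>)) - 1)" by simp
    also have "\<dots> = 2 * \<bar>sin (- 2 * pi * \<delta> / 2)\<bar>" by (rule dist_exp_i_1)
    also have "\<dots> \<le> 2 * \<bar>- 2 * pi * \<delta> / 2\<bar>" by (intro mult_left_mono abs_sin_x_le_abs_x) auto
    also have "\<dots> = 2 * pi * \<bar>\<delta>\<bar>" by (simp add: abs_mult)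
    also have "\<dots> \<le> 2 * pi * (1 / real N')" using q(2)[OF that] by (intro mult_left_mono) (auto simp: \<delta>_def)
    finally show ?thesis .
  qed
  have "norm (dseries a (s + \<i> * of_real \<tau>) - dseries a s) \<le> e" if s: "Re s \<ge> \<sigma>" for s
  proof -
    let ?t = "\<lambda>n. a n / of_nat n powr (s + \<i> * of_real \<tau>) - a n / of_nat n powr s"
    have sm1: "summable (\<lambda>n. a n / of_nat n powr (s + \<i> * of_real \<tau>))"
      by (rule abs_conv_summable[OF ac]) (use s in simp)
    have sm2: "summable (\<lambda>n. a n / of_nat n powr s)" by (rule abs_conv_summable[OF ac s])
    have eq: "dseries a (s + \<i> * of_real \<tau>) - dseries a s = suminf ?t"
      unfolding dseries_def by (rule suminf_diff[OF sm1 sm2])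
    have tt: "norm (?t n) \<le> c n * norm (?f n)" for n
    proof (cases "n = 0")
      case False
      have E: "1 / of_nat n powr (\<i> * of_real \<tau>) = exp (- (\<i> * of_real (\<tau> * ln (real n))))"
        using False by (simp add: powr_def exp_minus field_simps Ln_of_nat)
      have "?t n = (a n / of_nat n powr s) * (1 / of_nat n powr (\<i> * of_real \<tau>)) - (a n / of_nat n powr s) * 1"
        by (simp add: powr_add)
      then have "?t n = (a n / of_nat n powr s) * ?f n"
        unfolding E right_diff_distrib[symmetric] .
      then have "norm (?t n) = (norm (a n) / real n powr Re s) * norm (?f n)"
        by (simp only: norm_mult norm_dseries_term)
      also have "\<dots> \<le> c n * norm (?f n)" unfolding c_def
        by (intro mult_right_mono dseries_term_mono[OF s]) auto
      finally show ?thesis .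
    qed (simp add: c0)
    have t1: "norm (?t n) \<le> 2 * pi * (1 / real N') * c n" if "n < N" for n
      using order_trans[OF tt mult_left_mono[OF fs[OF that] c0]] by (simp add: mult_ac)
    have t2: "norm (?t n) \<le> 2 * c n" for n
      using order_trans[OF tt mult_left_mono[OF f2 c0]] by (simp add: mult_ac)
    have snt: "summable (\<lambda>n. norm (?t n))"
      by (rule summable_comparison_test'[OF summable_mult[OF sc, of 2], of 0]) (use t2 in simp)
    have "norm (suminf ?t) \<le> (\<Sum>n. norm (?t n))" by (rule summable_norm[OF snt])
    also have "\<dots> = (\<Sum>n. norm (?t (n + N))) + (\<Sum>n<N. norm (?t n))"
      by (rule suminf_split_initial_segment[OF snt])
    also have "\<dots> \<le> (\<Sum>n. 2 * c (n + N)) + (\<Sum>n<N. 2 * pi * (1 / real N') * c n)"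
    proof (intro add_mono suminf_le sum_mono)
      show "summable (\<lambda>n. norm (?t (n + N)))" using snt by (rule summable_ignore_initial_segment)
      show "summable (\<lambda>n. 2 * c (n + N))" by (intro summable_mult summable_ignore_initial_segment sc)
      show "norm (?t (n + N)) \<le> 2 * c (n + N)" for n by (rule t2)
      show "norm (?t n) \<le> 2 * pi * (1 / real N') * c n" if "n \<in> {..<N}" for n
        by (rule t1) (use that in simp)
    qed
    also have "(\<Sum>n. 2 * c (n + N)) = 2 * (\<Sum>n. c (n + N))"
      by (intro suminf_mult summable_ignore_initial_segment sc)
    also have "(\<Sum>n<N. 2 * pi * (1 / real N') * c n) = 2 * pi * (1 / real N') * (\<Sum>n<N. c n)"
      by (simp add: sum_distrib_left)
    also have "\<dots> \<le> 2 * pi * (1 / real N') * S"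
      unfolding S_def by (intro mult_left_mono sum_le_suminf sc) (auto simp: c0)
    also have "\<dots> < e / 2" using N'(2) by (simp add: mult_ac)
    also have "2 * (\<Sum>n. c (n + N)) < e / 2" using N by simp
    finally show ?thesis using eq by simp
  qed
  with \<tau> show ?thesis by blast
qed

text \<open>If \<open>F\<close> has a Gamma factor it has a zero \<open>s\<^sub>0\<close> with \<open>Re s\<^sub>0 < 0\<close>; a series converging absolutely everywhere is
  almost periodic and repeats this zero at arbitrarily large heights, whereas the zeros with
  negative real part lie on finitely many horizontal lines.\<close>

lemma selberg_small_weight_no_gamma:
  assumes a: "a \<in> selberg_class" and d: "selberg_data a F \<epsilon> Q k w \<mu>" and W: "(\<Sum>i<k. w i) \<le> 1 / 100"
    and G: "G holomorphic_on UNIV" "exp_growth G" "\<forall>s. s \<noteq> 1 \<longrightarrow> G s = (s - 1) ^ m * F s"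
  shows "k = 0"
proof (rule ccontr)
  assume "k \<noteq> 0"
  note d' = d[unfolded selberg_data_def]
  have ac: "abs_conv a \<sigma>" for \<sigma> by (rule selberg_small_weight_decay[OF a d W G])
  define D where "D = dseries a"
  have hD: "D holomorphic_on A" for A unfolding D_def by (rule dseries_entire[OF ac])
  have FD: "F s = D s" if "s \<noteq> 1" for s
    by (rule continuation_from_right[OF _ hD _ that]) (use d' in \<open>simp_all add: D_def\<close>)
  have D2: "D 2 \<noteq> 0" using selberg_dseries_nonzero[OF a, of 2] by (simp add: D_def)
  have w0: "w 0 > 0" "Re (\<mu> 0) \<ge> 0" using d' \<open>k \<noteq> 0\<close> by auto
  \<comment> \<open>The zero belonging to \<open>n = 1\<close>: the one for \<open>n = 0\<close>
    would lie on \<open>Re s = 0\<close> if \<open>Re (\<mu> 0) = 0\<close>.\<close>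
  define s0 where "s0 = - (1 + \<mu> 0) / of_real (w 0)"
  have Re0: "Re s0 < 0" using w0 by (simp add: s0_def Re_divide_of_real divide_neg_pos)
  have "rGamma (of_real (w 0) * s0 + \<mu> 0) = 0"
  proof -
    have "of_real (w 0) * s0 + \<mu> 0 = - of_nat 1" using w0 by (simp add: s0_def)
    then show ?thesis unfolding rGamma_eq_zero_iff by (metis minus_of_nat_in_nonpos_Ints)
  qed
  then have "(\<Prod>i<k. rGamma (of_real (w i) * s0 + \<mu> i)) = 0" using \<open>k \<noteq> 0\<close> by auto
  then have "F s0 = 0" using d' Re0 by auto
  moreover have "s0 \<noteq> 1" using Re0 by (auto simp: complex_eq_iff)
  ultimately have D0: "D s0 = 0" using FD[of s0] by simp
  define B where "B = (\<Sum>i<k. \<bar>Im (\<mu> i)\<bar> / w i)"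
  have zeros: "\<bar>Im s\<bar> \<le> B" if s: "Re s < 0" "D s = 0" for s
  proof -
    have "s \<noteq> 1" using s(1) by (auto simp: complex_eq_iff)
    then have "F s = 0" using FD[of s] s by simp
    then have "(\<Prod>i<k. rGamma (of_real (w i) * s + \<mu> i)) = 0"
      using d' s dual_factor_nonzero[OF a, of \<epsilon> Q k w \<mu> s] by auto
    then obtain i where i: "i < k" "of_real (w i) * s + \<mu> i \<in> \<int>\<^sub>\<le>\<^sub>0" by (auto simp: rGamma_eq_zero_iff)
    then obtain n where "of_real (w i) * s + \<mu> i = of_int n" by (elim nonpos_Ints_cases)
    then have "Im (of_real (w i) * s + \<mu> i) = 0" by (simp only: complex_Im_of_int)
    then have "w i * Im s = - Im (\<mu> i)" by simp
    moreover have wi: "w i > 0" using d' i by auto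
    ultimately have "Im s = - Im (\<mu> i) / w i" by (simp add: field_simps)
    then have "\<bar>Im s\<bar> = \<bar>Im (\<mu> i)\<bar> / w i" using wi by (simp add: abs_divide)
    also have "\<dots> \<le> B" unfolding B_def using i d' by (intro member_le_sum) (auto simp: less_imp_le)
    finally show ?thesis .
  qed
  \<comment> \<open>Half the distance to the imaginary axis keeps the ball and its vertical
    translates inside \<open>Re s < 0\<close>.\<close>
  define r where "r = \<bar>Re s0\<bar> / 2"
  have r: "r > 0" using Re0 by (simp add: r_def)
  let ?S = "ball s0 r"
  have S: "\<bar>Re s - Re s0\<bar> < r" "\<bar>Im s - Im s0\<bar> < r" if "s \<in> ?S" for s
    using that abs_Re_le_cmod[of "s - s0"] abs_Im_le_cmod[of "s - s0"]
    by (auto simp: dist_norm norm_minus_commute)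
  define T0 where "T0 = B + \<bar>Im s0\<bar> + r"
  have "B \<ge> 0" unfolding B_def using d' by (intro sum_nonneg) (auto simp: less_imp_le)
  then have T0: "T0 \<ge> 0" using r by (simp add: T0_def)
  have "\<exists>\<tau>>T0. \<forall>s. Re s \<ge> Re s0 - r \<longrightarrow> norm (D (s + \<i> * of_real \<tau>) - D s) \<le> 1 / real (Suc j)" for j
    unfolding D_def by (rule dseries_almost_periodic[OF ac _ T0]) simp
  then obtain \<tau> where \<tau>: "\<And>j. \<tau> j > T0" "\<And>j s. Re s \<ge> Re s0 - r \<Longrightarrow> norm (D (s + \<i> * of_real (\<tau> j)) - D s) \<le> 1 / real (Suc j)"
    by metis
  \<comment> \<open>Hurwitz's theorem: the translates converge to \<open>D\<close> uniformly on the
    ball, and they have no zeros there because \<open>\<tau> j > T0\<close> lifts the ball above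
    height \<open>B\<close>. A non-constant limit then has no zeros either; it is non-constant since
    otherwise \<open>D\<close> would vanish identically, against
    \<open>D 2 \<noteq> 0\<close>.\<close>
  have "D s0 \<noteq> 0"
  proof (rule Hurwitz_no_zeros[of ?S "\<lambda>j s. D (s + \<i> * of_real (\<tau> j))" D])
    show "(\<lambda>s. D (s + \<i> * of_real (\<tau> j))) holomorphic_on ?S" for j
      by (rule holomorphic_on_compose_gen[OF _ hD[of UNIV], unfolded o_def]) (auto intro!: holomorphic_intros)
    show "uniform_limit K (\<lambda>j s. D (s + \<i> * of_real (\<tau> j))) D sequentially" if K: "compact K" "K \<subseteq> ?S" for K
    proof (rule uniform_limitI)
      fix e :: real assume "e > 0"
      then obtain J where J: "inverse (real (Suc J)) < e" using reals_Archimedean by blast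
      show "\<forall>\<^sub>F j in sequentially. \<forall>s\<in>K. dist (D (s + \<i> * of_real (\<tau> j))) (D s) < e"
        using eventually_ge_at_top[of J]
      proof eventually_elim
        case (elim j)
        show ?case
        proof
          fix s assume "s \<in> K"
          then have "Re s \<ge> Re s0 - r" using S(1)[of s] K(2) by auto
          from \<tau>(2)[OF this, of j] have "dist (D (s + \<i> * of_real (\<tau> j))) (D s) \<le> 1 / real (Suc j)"
            by (simp add: dist_norm)
          also have "\<dots> \<le> 1 / real (Suc J)" using elim by (intro divide_left_mono) auto
          also have "\<dots> < e" using J by (simp add: inverse_eq_divide)
          finally show "dist (D (s + \<i> * of_real (\<tau> j))) (D s) < e" .
        qed
      qed
    qed
    show "\<not> D constant_on ?S"
    proof
      assume "D constant_on ?S"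
      then have z: "D z = 0" if "z \<in> ?S" for z
        using D0 r that unfolding constant_on_def by (metis centre_in_ball)
      have "D 2 = 0"
        by (rule analytic_continuation_open[of ?S UNIV D "\<lambda>_. 0"]) (use r z hD in auto)
      with D2 show False by simp
    qed
    show "D (z + \<i> * of_real (\<tau> j)) \<noteq> 0" if z: "z \<in> ?S" for j z
    proof
      assume "D (z + \<i> * of_real (\<tau> j)) = 0"
      moreover have "Re (z + \<i> * of_real (\<tau> j)) < 0" using S(1)[OF z] Re0 by (simp add: r_def)
      ultimately have "\<bar>Im (z + \<i> * of_real (\<tau> j))\<bar> \<le> B" using zeros by blast
      then show False using S(2)[OF z] \<tau>(1)[of j] by (simp add: T0_def)
    qed
  qed (use r hD in auto)
  with D0 show False by simp
qed

section \<open>Elements without Gamma factors\<close>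


text \<open>With no Gamma factor the loss exponents vanish, and the shifted integral is governed by
  \<open>(Q ^ 2 / N) powr T\<close>. For fixed \<open>N > Q ^ 2\<close> both error terms tend to 0
  as \<open>T\<close> tends to infinity.\<close>

lemma selberg_no_gamma_finite_support:
  assumes a: "a \<in> selberg_class" and d: "selberg_data a F \<epsilon> Q 0 w \<mu>"
    and G: "G holomorphic_on UNIV" "exp_growth G" "\<forall>s. s \<noteq> 1 \<longrightarrow> G s = (s - 1) ^ m * F s"
    and N: "real N > Q\<^sup>2"
  shows "a N = 0"
proof -
  note d' = d[unfolded selberg_data_def]
  have Q: "Q > 0" using d' by simp
  from selberg_coefficient_bound[OF a d _ G]
  obtain c K T0 C where c: "c > 0" "K \<ge> 0" "T0 \<ge> 2" "C \<ge> 0" and main: "\<forall>N>0. \<forall>T\<ge>T0.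
    c * norm (a N) \<le> K * (real N ^ 3 * (real N / real (Suc N)) powr (T - 1)
       + real N * (real N powr (- T) * (Q powr (2 * T - 1) * T powr (2 * (0 * T + 0)) * C) * exp 0))"
    by auto
  have N0: "N > 0" using N by (auto intro: gr0I simp: not_less)
  define q where "q = real N / real (Suc N)"
  have q: "ln q < 0" using N0 by (simp add: q_def)
  define p where "p = Q\<^sup>2 / real N"
  have p: "ln p < 0" using N Q N0 by (simp add: p_def)
  have "\<forall>\<^sub>F T in at_top. c * norm (a N) \<le> K * (real N ^ 3 * exp ((T - 1) * ln q) + real N * (exp (T * ln p) / Q * C))"
    using eventually_ge_at_top[of T0]
  proof eventually_elim
    case (elim T)
    have "T > 0" using elim c(3) by simp
    have "real N powr (- T) * Q powr (2 * T - 1) = exp (T * ln p) / Q"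
    proof -
      have "real N powr (- T) * Q powr (2 * T - 1) = exp (- T * ln (real N) + (2 * T - 1) * ln Q)"
        using N0 Q by (simp add: powr_def flip: exp_add)
      also have "- T * ln (real N) + (2 * T - 1) * ln Q = T * ln p - ln Q"
        using N0 Q by (simp add: p_def ln_div ln_realpow algebra_simps)
      also have "exp \<dots> = exp (T * ln p) / Q" using Q by (simp add: exp_diff)
      finally show ?thesis .
    qed
    moreover have "q powr (T - 1) = exp ((T - 1) * ln q)" using N0 by (simp add: q_def powr_def)
    moreover have "c * norm (a N) \<le> K * (real N ^ 3 * q powr (T - 1)
       + real N * ((real N powr (- T) * Q powr (2 * T - 1)) * C))"
      using main[rule_format, OF N0 elim, folded q_def] \<open>T > 0\<close> by (simp add: mult.assoc)
    ultimately show ?case by simp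
  qed
  moreover have "((\<lambda>T. K * (real N ^ 3 * exp ((T - 1) * ln q) + real N * (exp (T * ln p) / Q * C))) \<longlongrightarrow> K * (real N ^ 3 * 0 + real N * (0 / Q * C))) at_top"
  proof (intro tendsto_mult tendsto_add tendsto_divide tendsto_const)
    show "((\<lambda>T. exp ((T - 1) * ln q)) \<longlongrightarrow> 0) at_top" using q by real_asymp
    show "((\<lambda>T. exp (T * ln p)) \<longlongrightarrow> 0) at_top" using p by real_asymp
  qed (use Q in auto)
  ultimately have "c * norm (a N) \<le> K * (real N ^ 3 * 0 + real N * (0 / Q * C))"
    by (intro tendsto_lowerbound[OF _ _ trivial_limit_at_top_linorder])
  then show ?thesis using c(1) by (simp add: mult_le_0_iff)
qed

lemma finite_support_abs_conv:
  assumes "\<And>n. n > q \<Longrightarrow> a n = 0"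
  shows "abs_conv a \<sigma>" "dseries a s = (\<Sum>n\<le>q. a n / of_nat n powr s)"
proof -
  show "abs_conv a \<sigma>" unfolding abs_conv_def
    by (rule summable_finite[of "{..q}"]) (use assms in auto)
  show "dseries a s = (\<Sum>n\<le>q. a n / of_nat n powr s)" unfolding dseries_def
    by (rule suminf_finite) (use assms in auto)
qed

text \<open>Compare the two sides of the functional equation at \<open>s = - x\<close> for large
  \<open>x\<close>: the Dirichlet polynomial behaves like \<open>a q * q powr x\<close>, the other
  side has modulus close to \<open>Q powr (1 + 2 * x)\<close> because the dual series tends to 1. As
  \<open>q \<le> Q ^ 2\<close>, this forces \<open>norm (a q) \<ge> Q \<ge> sqrt q\<close>.\<close>

lemma selberg_no_gamma_leading:
  assumes a: "a \<in> selberg_class" and d: "selberg_data a F \<epsilon> Q 0 w \<mu>"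
    and G: "G holomorphic_on UNIV" "exp_growth G" "\<forall>s. s \<noteq> 1 \<longrightarrow> G s = (s - 1) ^ m * F s"
  obtains q where "q > 0" "\<And>n. n > q \<Longrightarrow> a n = 0" "norm (a q) \<ge> sqrt (real q)"
proof -
  note d' = d[unfolded selberg_data_def]
  have Q: "Q > 0" using d' by simp
  have a0: "a 0 = 0" using a by (simp add: selberg_class_def)
  have supp: "{n. a n \<noteq> 0} \<subseteq> {..nat \<lceil>Q\<^sup>2\<rceil>}"
  proof
    fix n assume "n \<in> {n. a n \<noteq> 0}"
    then have "real n \<le> Q\<^sup>2" using selberg_no_gamma_finite_support[OF a d G, of n] by force
    then show "n \<in> {..nat \<lceil>Q\<^sup>2\<rceil>}" by simp linarith
  qed
  then have fin: "finite {n. a n \<noteq> 0}" by (rule finite_subset) simp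
  define q where "q = Max {n. a n \<noteq> 0}"
  have ne: "1 \<in> {n. a n \<noteq> 0}" using selberg_coeff_1[OF a] by simp
  have "q \<in> {n. a n \<noteq> 0}" unfolding q_def using fin ne by (intro Max_in) auto
  then have aq: "a q \<noteq> 0" by simp
  then have q0: "q > 0" using a0 by (auto intro: gr0I)
  have big: "a n = 0" if "n > q" for n
    using that Max_ge[OF fin, of n] unfolding q_def by force
  have qQ: "real q \<le> Q\<^sup>2" using selberg_no_gamma_finite_support[OF a d G, of q] aq by force
  define D where "D = dseries a"
  have hD: "D holomorphic_on A" for A
  proof -
    have "(\<lambda>s. a n / of_nat n powr s) holomorphic_on A" for n
      by (cases "n = 0") (auto intro!: holomorphic_intros)
    then have "(\<lambda>s. \<Sum>n\<le>q. a n / of_nat n powr s) holomorphic_on A" by (intro holomorphic_on_sum)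
    moreover have "D = (\<lambda>s. \<Sum>n\<le>q. a n / of_nat n powr s)"
      unfolding D_def by (rule ext) (rule finite_support_abs_conv(2)[OF big])
    ultimately show ?thesis by simp
  qed
  have FD: "F s = D s" if "s \<noteq> 1" for s
    by (rule continuation_from_right[OF _ hD _ that]) (use d' in \<open>simp_all add: D_def\<close>)
  let ?R = "\<lambda>x. dseries (\<lambda>n. cnj (a n)) (1 + of_real x)"
  have lim1: "((\<lambda>x. norm (\<Sum>n\<le>q. a n * of_real ((real n / real q) powr x))) \<longlongrightarrow> norm (a q)) at_top"
  proof -
    have "((\<lambda>x. \<Sum>n\<le>q. a n * of_real ((real n / real q) powr x)) \<longlongrightarrow> (\<Sum>n\<le>q. if n = q then a q else 0)) at_top"
    proof (rule tendsto_sum)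
      fix n assume n: "n \<in> {..q}"
      show "((\<lambda>x. a n * of_real ((real n / real q) powr x)) \<longlongrightarrow> (if n = q then a q else 0)) at_top"
      proof (cases "n = q \<or> n = 0")
        case True
        then show ?thesis using q0 a0 by auto
      next
        case False
        then have "ln (real n / real q) < 0" using n by simp
        then have "((\<lambda>x. exp (x * ln (real n / real q))) \<longlongrightarrow> 0) at_top" by real_asymp
        then have "((\<lambda>x. (real n / real q) powr x) \<longlongrightarrow> 0) at_top" using False q0 by (simp add: powr_def)
        then have "((\<lambda>x. a n * of_real ((real n / real q) powr x)) \<longlongrightarrow> a n * of_real 0) at_top"
          by (intro tendsto_mult tendsto_const tendsto_of_real)
        then show ?thesis using False by simp
      qed
    qed
    then show ?thesis by (auto intro: tendsto_norm)
  qed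
  have lim2: "((\<lambda>x. Q * norm (?R x)) \<longlongrightarrow> Q * 1) at_top"
  proof -
    have "((\<lambda>x. dseries (\<lambda>n. cnj (a n)) (of_real x)) \<longlongrightarrow> cnj (a 1)) at_top"
      by (rule dseries_tendsto_at_1[of _ 2]) (use selberg_abs_conv[OF a, of 2] in \<open>simp add: abs_conv_cnj\<close>)
    moreover have "filterlim (\<lambda>x::real. 1 + x) at_top at_top" by real_asymp
    ultimately have "((\<lambda>x. dseries (\<lambda>n. cnj (a n)) (of_real (1 + x))) \<longlongrightarrow> cnj (a 1)) at_top"
      by (rule filterlim_compose)
    then have "((\<lambda>x. norm (?R x)) \<longlongrightarrow> norm (cnj (a 1))) at_top" by (intro tendsto_norm) simp
    then show ?thesis using selberg_coeff_1[OF a] by (intro tendsto_mult tendsto_const) simp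
  qed
  have "Q * 1 \<le> norm (a q)"
  proof (rule tendsto_le[OF trivial_limit_at_top_linorder lim1 lim2])
    show "\<forall>\<^sub>F x in at_top. Q * norm (?R x) \<le> norm (\<Sum>n\<le>q. a n * of_real ((real n / real q) powr x))"
      using eventually_gt_at_top[of 0]
    proof eventually_elim
      case (elim x)
      have n1: "- complex_of_real x \<noteq> 1" using elim by (auto simp: complex_eq_iff)
      have "norm (F (- of_real x)) = Q powr (1 + 2 * x) * norm (?R x)"
        using d' elim Q by (simp add: dual_factor_def norm_mult norm_divide norm_powr_real_powr)
      then have "Q powr (1 + 2 * x) * norm (?R x) = norm (\<Sum>n\<le>q. a n / of_nat n powr (- of_real x))"
        using FD[OF n1] finite_support_abs_conv(2)[OF big] by (simp add: D_def)
      also have "(\<Sum>n\<le>q. a n / of_nat n powr (- of_real x)) = (\<Sum>n\<le>q. of_real (real q powr x) * (a n * of_real ((real n / real q) powr x)))"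
      proof (intro sum.cong refl)
        fix n
        show "a n / of_nat n powr (- of_real x) = of_real (real q powr x) * (a n * of_real ((real n / real q) powr x))"
        proof (cases "n = 0")
          case False
          have "of_nat n powr (- complex_of_real x) = of_real (real n powr (- x))"
            by (metis of_nat_0_le_iff of_real_minus of_real_of_nat_eq powr_of_real)
          then show ?thesis using False q0 by (simp add: powr_divide powr_minus field_simps)
        qed (simp add: a0)
      qed
      also have "norm \<dots> = real q powr x * norm (\<Sum>n\<le>q. a n * of_real ((real n / real q) powr x))"
        by (simp only: sum_distrib_left[symmetric] norm_mult norm_of_real) simp
      finally have eq: "Q powr (1 + 2 * x) * norm (?R x) = real q powr x * norm (\<Sum>n\<le>q. a n * of_real ((real n / real q) powr x))" .
      have "real q powr x \<le> (Q\<^sup>2) powr x" using qQ elim by (intro powr_mono2) auto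
      also have "\<dots> = Q powr (2 * x)" using Q by (simp add: powr_powr flip: powr_numeral)
      finally have "real q powr x * (Q * norm (?R x)) \<le> Q powr (2 * x) * (Q * norm (?R x))"
        using Q by (intro mult_right_mono) auto
      also have "\<dots> = Q powr (1 + 2 * x) * norm (?R x)" using Q by (simp add: powr_add)
      also note eq
      finally show ?case by (rule mult_left_le_imp_le) (use q0 in simp)
    qed
  qed
  moreover have "sqrt (real q) \<le> Q" using qQ Q by (simp add: real_le_lsqrt)
  ultimately have "sqrt (real q) \<le> norm (a q)" by simp
  with q0 big show ?thesis by (rule that)
qed

text \<open>Differentiating \<open>exp (dseries b s) = dseries a s\<close> expresses the derivative
  of \<open>dseries a\<close> as \<open>dseries a\<close> times the derivative of
  \<open>dseries b\<close>. Comparing coefficients gives the recursion; the logarithms come from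
  differentiating \<open>n powr (- s)\<close>.\<close>

lemma selberg_log_recursion:
  assumes a: "abs_conv a \<sigma>" and b: "abs_conv b \<sigma>" and e: "\<And>s. Re s > \<sigma> \<Longrightarrow> exp (dseries b s) = dseries a s" and n: "n > 0"
  shows "a n * of_real (ln (real n)) = (\<Sum>d | d dvd n. b d * of_real (ln (real d)) * a (n div d))"
proof -
  let ?al = "\<lambda>n. a n * of_real (ln (real n))" and ?bl = "\<lambda>n. b n * of_real (ln (real n))"
  have al: "abs_conv ?al (\<sigma> + 1)" and bl: "abs_conv ?bl (\<sigma> + 1)"
    using abs_conv_mult_ln[OF a] abs_conv_mult_ln[OF b] by auto
  have a1: "abs_conv a (\<sigma> + 1)" using abs_conv_mono[OF a] by simp
  have eq: "dseries ?al s = dseries (conv ?bl a) s" if s: "Re s > \<sigma> + 1" for s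
  proof -
    have 1: "(dseries a has_field_derivative - dseries ?al s) (at s)"
      by (rule dseries_has_field_derivative[OF a]) (use s in simp)
    have "((\<lambda>s. exp (dseries b s)) has_field_derivative exp (dseries b s) * (- dseries ?bl s)) (at s)"
      by (rule DERIV_chain2[OF DERIV_exp dseries_has_field_derivative[OF b]]) (use s in simp)
    moreover have "open {s. Re s > \<sigma>}" by (simp add: open_halfspace_Re_gt)
    ultimately have "(dseries a has_field_derivative exp (dseries b s) * (- dseries ?bl s)) (at s)"
      by (rule has_field_derivative_transform_within_open[where S = "{s. Re s > \<sigma>}"]) (use s e in auto)
    from DERIV_unique[OF 1 this] have "dseries ?al s = dseries a s * dseries ?bl s" using e[of s] s by simp
    also have "\<dots> = dseries (conv ?bl a) s" using dseries_conv(2)[OF bl a1, of s] s by (simp add: mult.commute)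
    finally show ?thesis .
  qed
  have "?al n = conv ?bl a n"
  proof (rule dseries_unique[OF al dseries_conv(1)[OF bl a1, of "of_real (\<sigma> + 1)"] _ n])
    show "\<forall>\<^sub>F x in at_top. dseries ?al (of_real x) = dseries (conv ?bl a) (of_real x)"
      using eventually_gt_at_top[of "\<sigma> + 1"] by eventually_elim (rule eq, simp)
  qed simp
  then show ?thesis by (simp add: conv_def)
qed

text \<open>Induction on \<open>m * n\<close>. A prime power dividing a product of coprime
  \<open>m\<close> and \<open>n\<close> divides one of them, so the recursion at
  \<open>m * n\<close> splits into the recursions at \<open>m\<close> and at \<open>n\<close>, from
  which the induction hypothesis pulls out the other coefficient. The weights recombine as
  \<open>ln m + ln n = ln (m * n)\<close>.\<close>

lemma multiplicative_of_log_recursion: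
  fixes a c :: "nat \<Rightarrow> complex"
  assumes a1: "a 1 = 1" and c: "\<And>n. \<not> primepow n \<Longrightarrow> c n = 0"
    and rec: "\<And>n. n > 0 \<Longrightarrow> a n * of_real (ln (real n)) = (\<Sum>d | d dvd n. c d * a (n div d))"
    and mn: "coprime m n" "m > 0" "n > 0"
  shows "a (m * n) = a m * a n"
  using mn
proof (induction "m * n" arbitrary: m n rule: less_induct)
  case less
  note mn = less.prems
  show ?case
  proof (cases "m * n = 1")
    case False
    \<comment> \<open>As 1 is not a prime power, every nonzero term has a strictly smaller quotient,
      and the common divisor 1 may be counted twice.\<close>
    have c1: "c 1 = 0" by (rule c) simp
    have half: "(\<Sum>d | d dvd x. c d * a (x * y div d)) = (a x * of_real (ln (real x))) * a y"
      if xy: "x * y = m * n" "coprime x y" "x > 0" "y > 0" for x y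
    proof -
      have "(\<Sum>d | d dvd x. c d * a (x * y div d)) = (\<Sum>d | d dvd x. (c d * a (x div d)) * a y)"
      proof (intro sum.cong refl)
        fix d assume "d \<in> {d. d dvd x}"
        then obtain e where e: "x = d * e" by (auto elim: dvdE)
        show "c d * a (x * y div d) = c d * a (x div d) * a y"
        proof (cases "d = 1")
          case False
          have "d > 0" "e > 0" using xy(3) e by auto
          then have d: "d > 1" using False by simp
          have "x * y div d = e * y" using \<open>d > 0\<close> by (simp add: e mult.assoc)
          moreover have "a (e * y) = a e * a y"
          proof (rule less.hyps)
            have "e < x" using d \<open>e > 0\<close> by (simp add: e)
            then show "e * y < m * n" using xy by (metis mult_less_cancel2)
            show "coprime e y" using xy(2) e by simp
          qed (use \<open>e > 0\<close> xy in auto)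
          ultimately show ?thesis using e \<open>d > 0\<close> by simp
        qed (simp add: c1[unfolded One_nat_def])
      qed
      also have "\<dots> = (a x * of_real (ln (real x))) * a y"
        using rec[OF xy(3)] by (simp add: sum_distrib_right)
      finally show ?thesis .
    qed
    have fin: "finite {d. d dvd m}" "finite {d. d dvd n}" using mn by simp_all
    have "a (m * n) * of_real (ln (real (m * n))) = (\<Sum>d | d dvd m * n. c d * a (m * n div d))"
      using mn by (intro rec) simp
    also have "\<dots> = (\<Sum>d\<in>{d. d dvd m} \<union> {d. d dvd n}. c d * a (m * n div d))"
    proof (rule sum.mono_neutral_right)
      show "finite {d. d dvd m * n}" using mn by simp
      show "\<forall>d\<in>{d. d dvd m * n} - ({d. d dvd m} \<union> {d. d dvd n}). c d * a (m * n div d) = 0"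
      proof
        fix d assume d: "d \<in> {d. d dvd m * n} - ({d. d dvd m} \<union> {d. d dvd n})"
        have "\<not> primepow d"
        proof
          assume "primepow d"
          then obtain p k where pk: "prime p" "d = p ^ k" by (auto simp: primepow_def)
          have "coprime (p ^ k) m \<or> coprime (p ^ k) n"
          proof -
            have "\<not> (p dvd m \<and> p dvd n)" using mn(1) pk(1) by (metis coprime_common_divisor not_prime_unit)
            then show ?thesis using pk(1) by (metis coprime_power_left_iff prime_imp_coprime)
          qed
          then have "d dvd n \<or> d dvd m" using d pk(2) by (auto simp: coprime_dvd_mult_right_iff coprime_dvd_mult_left_iff)
          then show False using d by auto
        qed
        then show "c d * a (m * n div d) = 0" by (simp add: c)
      qed
    qed auto
    also have "\<dots> = (\<Sum>d | d dvd m. c d * a (m * n div d)) + (\<Sum>d | d dvd n. c d * a (m * n div d))"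
    proof -
      have "{d. d dvd m} \<inter> {d. d dvd n} = {1}" using mn(1) by (auto simp: coprime_def)
      then show ?thesis using sum.union_inter[OF fin, of "\<lambda>d. c d * a (m * n div d)"] c1 by simp
    qed
    also have "(\<Sum>d | d dvd m. c d * a (m * n div d)) = (a m * of_real (ln (real m))) * a n"
      using half[of m n] mn by simp
    also have "(\<Sum>d | d dvd n. c d * a (m * n div d)) = (a n * of_real (ln (real n))) * a m"
      using half[of n m] mn by (simp add: mult.commute coprime_commute)
    finally have "a (m * n) * of_real (ln (real (m * n))) = a m * a n * of_real (ln (real (m * n)))"
      using mn by (simp add: ln_mult algebra_simps)
    moreover have "ln (real (m * n)) \<noteq> 0"
    proof -
      have "real (m * n) > 1" using False mn by (metis One_nat_def Suc_lessI nat_0_less_mult_iff of_nat_1 of_nat_less_iff)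
      then show ?thesis by (metis ln_gt_zero less_irrefl)
    qed
    ultimately show ?thesis by simp
  qed (use a1 in simp)
qed

text \<open>Since \<open>ln (p ^ j) = j * ln p\<close>, the factor \<open>ln p\<close> cancels. What
  remains is the coefficient form of \<open>x * A' = x * B' * A\<close> for the local power series
  \<open>A\<close> and \<open>B\<close> with coefficients \<open>a (p ^ k)\<close> and
  \<open>b (p ^ k)\<close>.\<close>

lemma prime_power_log_recursion:
  fixes a b :: "nat \<Rightarrow> complex"
  assumes rec: "\<And>n. n > 0 \<Longrightarrow> a n * of_real (ln (real n)) = (\<Sum>d | d dvd n. b d * of_real (ln (real d)) * a (n div d))"
    and p: "prime p"
  shows "of_nat k * a (p ^ k) = (\<Sum>j\<le>k. of_nat j * b (p ^ j) * a (p ^ (k - j)))"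
proof -
  have p1: "p > 1" using p by (rule prime_gt_1_nat)
  have inj: "inj_on (\<lambda>j. p ^ j) {..k}" using p1 by (auto simp: inj_on_def)
  have dv: "{d. d dvd p ^ k} = (\<lambda>j. p ^ j) ` {..k}"
    using divides_primepow_nat[OF p] by auto
  have lnp: "of_real (ln (real p)) \<noteq> (0::complex)" using p1 by simp
  have "a (p ^ k) * of_real (ln (real (p ^ k))) = (\<Sum>j\<le>k. b (p ^ j) * of_real (ln (real (p ^ j))) * a (p ^ k div p ^ j))"
    using rec[of "p ^ k"] p1 unfolding dv by (simp add: sum.reindex[OF inj])
  also have "\<dots> = (\<Sum>j\<le>k. (of_nat j * b (p ^ j) * a (p ^ (k - j))) * of_real (ln (real p)))"
    by (intro sum.cong refl) (use p1 in \<open>simp add: ln_realpow power_diff\<close>)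
  also have "\<dots> = (\<Sum>j\<le>k. of_nat j * b (p ^ j) * a (p ^ (k - j))) * of_real (ln (real p))"
    by (simp add: sum_distrib_right)
  also have "a (p ^ k) * of_real (ln (real (p ^ k))) = (of_nat k * a (p ^ k)) * of_real (ln (real p))"
    using p1 by (simp add: ln_realpow)
  finally show ?thesis using lnp by simp
qed

text \<open>The local factor at \<open>p\<close> is a polynomial in \<open>x = p\<^sup>-\<^sup>s\<close> and equals \<open>exp g\<close> for a power series \<open>g\<close> converging
  for \<open>norm x < r\<close>, so all its roots have modulus at least \<open>r\<close>.\<close>

lemma exp_fps_polynomial_lead_coeff:
  fixes P :: "complex poly" and B :: "complex fps"
  assumes P: "poly P 0 = 1" and r: "r > 0" and B: "fps_conv_radius B \<ge> ereal r"
    and ode: "fps_deriv (fps_of_poly P) = fps_of_poly P * fps_deriv B"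
  shows "norm (lead_coeff P) * r ^ degree P \<le> 1"
proof -
  have nz: "poly P z \<noteq> 0" if z: "norm z < r" for z
  proof -
    \<comment> \<open>By the differential equation this function has derivative 0; it is nonzero at
      0, so \<open>P\<close> has no zero in the disc.\<close>
    define h where "h = (\<lambda>z. poly P z * exp (- eval_fps B z))"
    have dh: "(h has_field_derivative 0) (at z within ball 0 r)" if z: "z \<in> ball 0 r" for z
    proof -
      have zB: "ereal (norm z) < fps_conv_radius B" using z B by (auto intro: less_le_trans[of _ "ereal r"])
      have zB': "ereal (norm z) < fps_conv_radius (fps_deriv B)" using zB fps_conv_radius_deriv less_le_trans by blast
      have "(eval_fps (fps_of_poly P) has_field_derivative eval_fps (fps_deriv (fps_of_poly P)) z) (at z within ball 0 r)"
        by (rule has_field_derivative_eval_fps) simp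
      then have dP: "(poly P has_field_derivative poly P z * eval_fps (fps_deriv B) z) (at z within ball 0 r)"
      proof -
        have "eval_fps (fps_of_poly P) = poly P" by (rule ext) simp
        moreover have "eval_fps (fps_of_poly P * fps_deriv B) z = poly P z * eval_fps (fps_deriv B) z"
          using zB' by (simp add: eval_fps_mult)
        ultimately show "(eval_fps (fps_of_poly P) has_field_derivative eval_fps (fps_deriv (fps_of_poly P)) z) (at z within ball 0 r)
          \<Longrightarrow> ?thesis" unfolding ode by simp
      qed
      have dB: "(eval_fps B has_field_derivative eval_fps (fps_deriv B) z) (at z within ball 0 r)"
        by (rule has_field_derivative_eval_fps[OF zB])
      have "(h has_field_derivative poly P z * eval_fps (fps_deriv B) z * exp (- eval_fps B z)
          + (exp (- eval_fps B z) * (- eval_fps (fps_deriv B) z)) * poly P z) (at z within ball 0 r)"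
        unfolding h_def
        by (rule DERIV_mult[OF dP DERIV_chain2[OF DERIV_exp DERIV_minus[OF dB]]])
      then show ?thesis by (simp add: algebra_simps)
    qed
    obtain c where c: "\<And>z. z \<in> ball 0 r \<Longrightarrow> h z = c"
      using has_field_derivative_zero_constant[OF convex_ball dh] by blast
    have "h z = h 0" using c[of z] c[of 0] z r by simp
    moreover have "h 0 \<noteq> 0" by (simp add: h_def P)
    ultimately show ?thesis by (auto simp: h_def)
  qed
  obtain root where root: "smult (lead_coeff P) (\<Prod>i<degree P. [:- root i, 1:]) = P"
    using complex_poly_decompose' .
  have P_eq: "poly P z = lead_coeff P * (\<Prod>i<degree P. z - root i)" for z
    by (subst root[symmetric]) (simp add: poly_prod)
  have rt: "r \<le> norm (root i)" if "i < degree P" for i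
  proof (rule ccontr)
    assume "\<not> r \<le> norm (root i)"
    then have "poly P (root i) \<noteq> 0" by (intro nz) simp
    moreover have "(\<Prod>j<degree P. root i - root j) = 0" using that by auto
    ultimately show False using P_eq[of "root i"] by simp
  qed
  \<comment> \<open>In modulus, \<open>poly P 0\<close> is the leading coefficient times the product
    of the roots, each of which has modulus at least \<open>r\<close>.\<close>
  have "norm (lead_coeff P) * r ^ degree P = norm (lead_coeff P) * (\<Prod>i<degree P. r)" by simp
  also have "\<dots> \<le> norm (lead_coeff P) * (\<Prod>i<degree P. norm (root i))"
    by (intro mult_left_mono prod_mono) (use rt r in auto)
  also have "\<dots> = norm (poly P 0)" unfolding P_eq[of 0] by (simp add: norm_mult prod_norm[symmetric])
  finally show ?thesis by (simp add: P)
qed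

text \<open>As \<open>b n\<close> is of order \<open>n powr \<theta>\<close>, the series with
  coefficients \<open>b (p ^ k)\<close> converges for \<open>norm x < p powr (- \<theta>)\<close>.
  With this radius as \<open>r\<close>, the bound for the leading coefficient reads
  \<open>norm (a (p ^ v)) * r ^ v \<le> 1\<close>.\<close>

lemma local_factor_lead_coeff:
  fixes a b :: "nat \<Rightarrow> complex"
  assumes rec: "\<And>k. of_nat k * a (p ^ k) = (\<Sum>j\<le>k. of_nat j * b (p ^ j) * a (p ^ (k - j)))"
    and p: "prime p" and a1: "a 1 = 1" and b: "(\<lambda>n. norm (b n)) \<in> O(\<lambda>n. real n powr \<theta>)"
    and v: "a (p ^ v) \<noteq> 0" "\<And>k. k > v \<Longrightarrow> a (p ^ k) = 0"
  shows "norm (a (p ^ v)) \<le> real (p ^ v) powr \<theta>"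
proof -
  have p1: "p > 1" using p by (rule prime_gt_1_nat)
  define P where "P = (\<Sum>k\<le>v. monom (a (p ^ k)) k)"
  have coeff: "coeff P k = a (p ^ k)" for k
    using v(2)[of k] by (auto simp: P_def coeff_sum not_le)
  have deg: "degree P = v"
  proof (rule antisym)
    show "degree P \<le> v" by (rule degree_le) (use v(2) coeff in auto)
    show "v \<le> degree P" by (rule le_degree) (use v(1) coeff in auto)
  qed
  define r where "r = real p powr (- \<theta>)"
  have r: "r > 0" using p1 by (simp add: r_def)
  define B where "B = Abs_fps (\<lambda>k. b (p ^ k))"
  have B: "fps_conv_radius B \<ge> ereal r"
    unfolding fps_conv_radius_def
  proof (rule conv_radius_geI_ex')
    fix x :: real assume x: "0 < x" "ereal x < ereal r"
    obtain C where C: "C > 0" "\<forall>\<^sub>F n in sequentially. norm (b n) \<le> C * real n powr \<theta>"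
      using landau_o.bigE[OF b] by (auto simp: abs_mult)
    then obtain n0 where n0: "\<And>n. n \<ge> n0 \<Longrightarrow> norm (b n) \<le> C * real n powr \<theta>"
      by (auto simp: eventually_at_top_linorder)
    have xr: "real p powr \<theta> * x < 1"
      using x p1 by (simp add: r_def powr_minus field_simps)
    show "summable (\<lambda>k. fps_nth B k * of_real x ^ k)"
    proof (rule summable_comparison_test'[of "\<lambda>k. C * (real p powr \<theta> * x) ^ k" n0])
      show "summable (\<lambda>k. C * (real p powr \<theta> * x) ^ k)"
        by (intro summable_mult summable_geometric) (use xr x p1 in \<open>simp add: abs_mult\<close>)
      fix k assume "k \<ge> n0"
      \<comment> \<open>This turns \<open>k \<ge> n0\<close> into \<open>p ^ k \<ge> n0\<close>, the
        range in which the bound for \<open>b\<close> holds.\<close>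
      moreover have "k < p ^ k" using power_gt_expt[of p k] p1 by simp
      ultimately have "norm (b (p ^ k)) \<le> C * real (p ^ k) powr \<theta>" by (intro n0) simp
      also have "real (p ^ k) powr \<theta> = (real p powr \<theta>) ^ k"
        using p1 by (simp add: powr_power flip: powr_realpow) (simp add: powr_powr mult.commute)
      finally have "norm (b (p ^ k)) * x ^ k \<le> C * (real p powr \<theta>) ^ k * x ^ k"
        using x by (intro mult_right_mono) auto
      then show "norm (fps_nth B k * of_real x ^ k) \<le> C * (real p powr \<theta> * x) ^ k"
        using x by (simp add: B_def norm_mult norm_power power_mult_distrib mult.assoc)
    qed
  qed
  have "fps_deriv (fps_of_poly P) = fps_of_poly P * fps_deriv B"
  proof (rule fps_ext)
    fix n
    have "fps_nth (fps_deriv (fps_of_poly P)) n = of_nat (Suc n) * a (p ^ Suc n)"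
      by (simp add: coeff)
    also have "\<dots> = (\<Sum>j\<le>Suc n. of_nat j * b (p ^ j) * a (p ^ (Suc n - j)))" by (rule rec)
    also have "\<dots> = (\<Sum>j\<le>n. of_nat (Suc j) * b (p ^ Suc j) * a (p ^ (n - j)))"
      by (subst sum.atMost_Suc_shift) simp
    also have "\<dots> = fps_nth (fps_deriv B * fps_of_poly P) n"
      by (simp add: fps_mult_nth B_def coeff atLeast0AtMost)
    finally show "fps_nth (fps_deriv (fps_of_poly P)) n = fps_nth (fps_of_poly P * fps_deriv B) n"
      by (simp add: mult.commute)
  qed
  moreover have "poly P 0 = 1" using coeff[of 0] a1 by (simp add: poly_0_coeff_0)
  ultimately have "norm (lead_coeff P) * r ^ degree P \<le> 1"
    by (intro exp_fps_polynomial_lead_coeff[OF _ r B])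
  then have "norm (a (p ^ v)) * r ^ v \<le> 1" by (simp add: deg coeff)
  moreover have "r ^ v * real (p ^ v) powr \<theta> = 1"
    using p1 by (simp add: r_def powr_minus powr_power power_inverse flip: powr_realpow) (simp add: powr_powr mult.commute)
  ultimately have "norm (a (p ^ v)) * r ^ v \<le> real (p ^ v) powr \<theta> * r ^ v" by (simp add: mult.commute)
  then show ?thesis by (rule mult_right_le_imp_le) (use r in simp)
qed

text \<open>If \<open>p ^ v\<close> exactly divides the last index \<open>q\<close>, then
  \<open>a (p ^ k) = 0\<close> for \<open>k > v\<close>: otherwise \<open>a\<close> would be nonzero
  at \<open>p ^ k * (q div p ^ v)\<close>, which exceeds \<open>q\<close>. The local bound therefore
  applies to each prime power in \<open>q\<close>, and the bounds multiply.\<close>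

lemma multiplicative_leading_bound:
  fixes a :: "nat \<Rightarrow> complex"
  assumes a1: "a 1 = 1" and mult: "\<And>m n. coprime m n \<Longrightarrow> m > 0 \<Longrightarrow> n > 0 \<Longrightarrow> a (m * n) = a m * a n"
    and loc: "\<And>p v. prime p \<Longrightarrow> a (p ^ v) \<noteq> 0 \<Longrightarrow> (\<And>k. k > v \<Longrightarrow> a (p ^ k) = 0) \<Longrightarrow> norm (a (p ^ v)) \<le> real (p ^ v) powr \<theta>"
    and q: "q > 0" "a q \<noteq> 0" "\<And>n. n > q \<Longrightarrow> a n = 0"
  shows "norm (a q) \<le> real q powr \<theta>"
proof -
  \<comment> \<open>Induction over the divisors \<open>m\<close> of \<open>q\<close> that are
    coprime to their cofactor; removing a full prime power from \<open>m\<close> preserves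
    this.\<close>
  have "norm (a m) \<le> real m powr \<theta>" if "m * n = q" "coprime m n" for m n
    using that
  proof (induction m arbitrary: n rule: less_induct)
    case (less m)
    have mn: "m > 0" "n > 0" using less.prems(1) q(1) by (metis gr0I mult_0 mult_0_right less_irrefl)+
    show ?case
    proof (cases "m = 1")
      case False
      then obtain p where p: "prime p" "p dvd m" using prime_factor_nat by blast
      define v where "v = multiplicity p m"
      obtain m' where m': "m = p ^ v * m'" "\<not> p dvd m'"
        unfolding v_def using multiplicity_decompose'[of m p] p(1) mn(1) not_prime_unit by (metis less_irrefl)
      have v: "v > 0" using p mn by (simp add: v_def prime_multiplicity_gt_zero_iff)
      have m'0: "m' > 0" using mn(1) m'(1) by (auto intro: gr0I)
      have pv0: "p ^ v > 0" using prime_gt_0_nat[OF p(1)] by simp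
      have pn: "\<not> p dvd n" using less.prems(2) p by (meson coprime_common_divisor not_prime_unit)
      have cop: "coprime (p ^ k) (m' * n)" for k
        using p(1) m'(2) pn by (metis coprime_power_left_iff prime_imp_coprime prime_dvd_mult_iff)
      have cop': "coprime (p ^ k) m'" for k using cop[of k] by simp
      have qe: "q = p ^ v * (m' * n)" using less.prems(1) m'(1) by (simp add: mult.assoc)
      have aq: "a q = a (p ^ v) * a (m' * n)" unfolding qe by (rule mult[OF cop pv0]) (use m'0 mn in simp)
      have lead: "norm (a (p ^ v)) \<le> real (p ^ v) powr \<theta>"
      proof (rule loc[OF p(1)])
        show "a (p ^ v) \<noteq> 0" using aq q(2) by auto
        fix k assume k: "k > v"
        have "p ^ v < p ^ k" using k prime_gt_1_nat[OF p(1)] by simp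
        then have "q < p ^ k * (m' * n)" unfolding qe using m'0 mn by simp
        then have "a (p ^ k * (m' * n)) = 0" by (rule q(3))
        also have "a (p ^ k * (m' * n)) = a (p ^ k) * a (m' * n)"
          by (rule mult[OF cop]) (use m'0 mn prime_gt_0_nat[OF p(1)] in simp_all)
        finally show "a (p ^ k) = 0" using aq q(2) by auto
      qed
      have "1 < p ^ v" by (rule one_less_power[OF prime_gt_1_nat[OF p(1)] v])
      then have "m' < m" using m'0 by (simp add: m'(1))
      then have IH: "norm (a m') \<le> real m' powr \<theta>"
      proof (rule less.IH)
        show "m' * (p ^ v * n) = q" by (simp add: qe)
        have "coprime m' n" using less.prems(2) m'(1) by simp
        then show "coprime m' (p ^ v * n)" using cop'[of v] by (simp add: coprime_commute)
      qed
      have "norm (a m) = norm (a (p ^ v)) * norm (a m')"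
        unfolding m'(1) by (subst mult[OF cop' pv0 m'0]) (simp add: norm_mult)
      also have "\<dots> \<le> real (p ^ v) powr \<theta> * real m' powr \<theta>" by (intro mult_mono lead IH) auto
      also have "\<dots> = real m powr \<theta>" unfolding m'(1) of_nat_mult by (subst powr_mult) auto
      finally show ?thesis .
    qed (use a1 in simp)
  qed
  from this[of q 1] show ?thesis by simp
qed

lemma selberg_no_gamma_trivial:
  assumes a: "a \<in> selberg_class" and d: "selberg_data a F \<epsilon> Q 0 w \<mu>"
    and G: "G holomorphic_on UNIV" "exp_growth G" "\<forall>s. s \<noteq> 1 \<longrightarrow> G s = (s - 1) ^ m * F s"
  shows "a = one_coeffs"
proof -
  obtain q where q: "q > 0" "\<And>n. n > q \<Longrightarrow> a n = 0" "norm (a q) \<ge> sqrt (real q)"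
    using selberg_no_gamma_leading[OF a d G] by metis
  have a1: "a 1 = 1" by (rule selberg_coeff_1[OF a])
  obtain b \<theta> where b: "\<And>s. Re s > 1 \<Longrightarrow> exp (dseries b s) = dseries a s" "\<And>n. \<not> primepow n \<Longrightarrow> b n = 0"
      "\<theta> < 1 / 2" "(\<lambda>n. norm (b n)) \<in> O(\<lambda>n. real n powr \<theta>)"
    using a unfolding selberg_class_def selberg_euler_product_def by blast
  have ac: "abs_conv a 2" by (rule selberg_abs_conv[OF a]) simp
  have bc: "abs_conv b 2" by (rule abs_conv_bigo[OF b(4)]) (use b(3) in simp)
  have rec: "a n * of_real (ln (real n)) = (\<Sum>d | d dvd n. b d * of_real (ln (real d)) * a (n div d))" if "n > 0" for n
    by (rule selberg_log_recursion[OF ac bc _ that]) (simp add: b(1))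
  have mult: "a (m * n) = a m * a n" if "coprime m n" "m > 0" "n > 0" for m n
    by (rule multiplicative_of_log_recursion[where c = "\<lambda>d. b d * of_real (ln (real d))", OF a1 _ rec that])
       (simp_all add: b(2))
  have "norm (a q) \<le> real q powr \<theta>"
  proof (rule multiplicative_leading_bound[OF a1 mult])
    fix p v assume p: "prime p" and v: "a (p ^ v) \<noteq> 0" "\<And>k. k > v \<Longrightarrow> a (p ^ k) = 0"
    show "norm (a (p ^ v)) \<le> real (p ^ v) powr \<theta>"
      by (rule local_factor_lead_coeff[OF prime_power_log_recursion[OF rec p] p a1 b(4) v])
  next
    show "a q \<noteq> 0" using q(1,3) by auto
  qed (use q in auto)
  with q(3) have le: "real q powr (1 / 2) \<le> real q powr \<theta>" by (simp add: powr_half_sqrt)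
  have "q = 1"
  proof (rule ccontr)
    assume "q \<noteq> 1"
    then have "real q > 1" using q(1) by linarith
    then have "real q powr \<theta> < real q powr (1 / 2)" using b(3) by (intro powr_less_mono) auto
    with le show False by simp
  qed
  show ?thesis
  proof
    fix n
    show "a n = one_coeffs n"
      using q(2)[of n] \<open>q = 1\<close> a1 a by (cases "n = 0"; cases "n = 1") (auto simp: one_coeffs_def selberg_class_def)
  qed
qed

section \<open>Uniqueness\<close>


lemma dseries_one_coeffs: "dseries one_coeffs s = 1" "abs_conv one_coeffs \<sigma>"
proof -
  have "dseries one_coeffs s = (\<Sum>n\<in>{1}. one_coeffs n / of_nat n powr s)"
    unfolding dseries_def by (rule suminf_finite) (auto simp: one_coeffs_def)
  then show "dseries one_coeffs s = 1" by (simp add: one_coeffs_def)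
  show "abs_conv one_coeffs \<sigma>" unfolding abs_conv_def
    by (rule summable_finite[of "{1}"]) (auto simp: one_coeffs_def)
qed

text \<open>Iterated convolution produces \<open>c\<close>. The only divisors of a prime
  \<open>p\<close> are 1 and \<open>p\<close>, and first coefficients are 1, so convolution is
  additive at primes. No membership of \<open>c\<close> in the Selberg class is claimed.\<close>

lemma product_prime_coeffs:
  assumes "\<forall>f\<in>#M. f \<in> selberg_class"
  shows "\<exists>c. abs_conv c 2 \<and> c 1 = 1 \<and> (\<forall>p. prime p \<longrightarrow> c p = (\<Sum>f\<in>#M. f p)) \<and>
    (\<forall>s. Re s \<ge> 2 \<longrightarrow> dseries c s = (\<Prod>f\<in>#M. dseries f s))"
  using assms
proof (induction M)
  case empty
  show ?case
  proof (intro exI[of _ one_coeffs] conjI allI impI)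
    show "one_coeffs 1 = 1" by (simp add: one_coeffs_def)
    show "one_coeffs p = (\<Sum>f\<in>#{#}. f p)" if "prime p" for p
      using prime_gt_1_nat[OF that] by (simp add: one_coeffs_def)
  qed (simp_all add: dseries_one_coeffs)
next
  case (add f M)
  then obtain c where c: "abs_conv c 2" "c 1 = 1" "\<And>p. prime p \<Longrightarrow> c p = (\<Sum>f\<in>#M. f p)"
    "\<And>s. Re s \<ge> 2 \<Longrightarrow> dseries c s = (\<Prod>f\<in>#M. dseries f s)" by auto
  have f: "abs_conv f 2" "f 1 = 1" using add.prems selberg_abs_conv[of f 2] selberg_coeff_1[of f] by auto
  have "conv f c p = f p + c p" if "prime p" for p
  proof -
    have "{d. d dvd p} = {1, p}" using that by (auto simp: prime_nat_iff)
    then show ?thesis using that f(2) c(2) prime_gt_1_nat[OF that] by (simp add: conv_def)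
  qed
  moreover have "conv f c 1 = 1" using c(2) f(2) by (simp add: conv_def)
  ultimately show ?case
    using dseries_conv[OF f(1) c(1), of 2] dseries_conv(2)[OF f(1) c(1)] c(3,4)
    by (intro exI[of _ "conv f c"]) simp
qed

lemma selberg_product_prime_coeffs:
  assumes "a \<in> selberg_class" "\<forall>f\<in>#M. f \<in> selberg_class" "is_product_of a M" "prime p"
  shows "a p = (\<Sum>f\<in>#M. f p)"
proof -
  obtain c where c: "abs_conv c 2" "\<And>p. prime p \<Longrightarrow> c p = (\<Sum>f\<in>#M. f p)"
    "\<And>s. Re s \<ge> 2 \<Longrightarrow> dseries c s = (\<Prod>f\<in>#M. dseries f s)"
    using product_prime_coeffs[OF assms(2)] by blast
  have "a p = c p"
  proof (rule dseries_unique[OF _ c(1)])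
    show "abs_conv a 2" by (rule selberg_abs_conv[OF assms(1)]) simp
    show "\<forall>\<^sub>F x in at_top. dseries a (of_real x) = dseries c (of_real x)"
      using eventually_ge_at_top[of 2]
      by eventually_elim (use assms(3) in \<open>simp add: is_product_of_def c(3)\<close>)
    show "p > 0" using prime_gt_0_nat[OF assms(4)] .
  qed
  with c(2)[OF assms(4)] show ?thesis by simp
qed

lemma sum_mset_count:
  fixes g :: "'a \<Rightarrow> 'b :: comm_semiring_1"
  assumes "finite U" "set_mset M \<subseteq> U"
  shows "(\<Sum>f\<in>#M. g f) = (\<Sum>f\<in>U. of_nat (count M f) * g f)"
  using assms(2)
proof (induction M)
  case (add x M)
  then have x: "x \<in> U" and IH: "(\<Sum>f\<in>#M. g f) = (\<Sum>f\<in>U. of_nat (count M f) * g f)" by auto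
  have "(\<Sum>f\<in>U. of_nat (count (add_mset x M) f) * g f) = (\<Sum>f\<in>U. of_nat (count M f) * g f + (if f = x then g x else 0))"
    by (intro sum.cong refl) (auto simp: algebra_simps)
  also have "\<dots> = (\<Sum>f\<in>#M. g f) + g x" using x assms(1) by (simp add: sum.distrib IH)
  finally show ?case by (simp add: add.commute)
qed simp

lemma prod_mset_count:
  fixes g :: "'a \<Rightarrow> 'b :: comm_semiring_1"
  assumes "finite U" "set_mset M \<subseteq> U"
  shows "(\<Prod>f\<in>#M. g f) = (\<Prod>f\<in>U. g f ^ count M f)"
  using assms(2)
proof (induction M)
  case (add x M)
  then have x: "x \<in> U" and IH: "(\<Prod>f\<in>#M. g f) = (\<Prod>f\<in>U. g f ^ count M f)" by auto
  have "(\<Prod>f\<in>U. g f ^ count (add_mset x M) f) = (\<Prod>f\<in>U. g f ^ count M f * (if f = x then g x else 1))"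
    by (intro prod.cong refl) (auto simp: algebra_simps)
  also have "\<dots> = (\<Prod>f\<in>#M. g f) * g x" using x assms(1) by (simp add: prod.distrib IH)
  finally show ?case by (simp add: mult.commute)
qed simp

text \<open>For large real arguments the values lie in the finite set of \<open>j\<close>-th roots
  of unity and tend to 1, so they are eventually equal to 1; uniqueness of coefficients does the
  rest.\<close>

lemma selberg_root_of_unity:
  assumes f: "f \<in> selberg_class" and j: "j > 0" and pow: "\<And>s. Re s > 1 \<Longrightarrow> dseries f s ^ j = 1"
  shows "f = one_coeffs"
proof -
  have ac: "abs_conv f 2" by (rule selberg_abs_conv[OF f]) simp
  define R where "R = {z::complex. z ^ j = 1} - {1}"
  have "finite R" unfolding R_def using finite_roots_unity[of j] j by simp
  then have oR: "open (- R)" by (simp add: finite_imp_closed open_Compl)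
  have "((\<lambda>x. dseries f (of_real x)) \<longlongrightarrow> 1) at_top"
    using dseries_tendsto_at_1[OF ac] selberg_coeff_1[OF f] by simp
  from topological_tendstoD[OF this oR] have "\<forall>\<^sub>F x in at_top. dseries f (of_real x) \<in> - R"
    by (simp add: R_def)
  then have ev: "\<forall>\<^sub>F x in at_top. dseries f (of_real x) = dseries one_coeffs (of_real x)"
    using eventually_gt_at_top[of 1] by eventually_elim (use pow in \<open>auto simp: R_def dseries_one_coeffs\<close>)
  show ?thesis
  proof
    fix n
    show "f n = one_coeffs n"
    proof (cases "n = 0")
      case True
      then show ?thesis using f by (simp add: selberg_class_def one_coeffs_def)
    next
      case False
      then show ?thesis by (intro dseries_unique[OF ac dseries_one_coeffs(2) ev]) simp
    qed
  qed
qed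

text \<open>Expand the vanishing sum over primes \<open>p \<le> x\<close> of the squared modulus of
  \<open>\<Sum>f\<in>D. e f * f p\<close>, divided by \<open>p\<close>. The diagonal terms give
  \<open>E * ln (ln x)\<close> up to a bounded error, with \<open>E > 0\<close> the sum of the
  squares of the \<open>e f\<close>, and all other terms are bounded.\<close>

lemma orthonormal_independent:
  fixes e :: "(nat \<Rightarrow> complex) \<Rightarrow> int"
  assumes fin: "finite D" and ne: "D \<noteq> {}" and e0: "\<And>f. f \<in> D \<Longrightarrow> e f \<noteq> 0"
    and norm1: "\<And>f. f \<in> D \<Longrightarrow> has_selberg_number f 1"
    and orth: "\<And>f g. f \<in> D \<Longrightarrow> g \<in> D \<Longrightarrow> f \<noteq> g \<Longrightarrow>
        (\<lambda>x::real. \<Sum>p | prime p \<and> real p \<le> x. f p * cnj (g p) / of_nat p) \<in> O[at_top](\<lambda>_. 1)"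
    and rel: "\<And>p. prime p \<Longrightarrow> (\<Sum>f\<in>D. of_int (e f) * f p) = 0"
  shows False
proof -
  define P where "P = (\<lambda>x::real. {p. prime p \<and> real p \<le> x})"
  define T where "T = (\<lambda>f g x. \<Sum>p\<in>P x. f p * cnj (g p) / of_nat p :: complex)"
  define E where "E = (\<Sum>f\<in>D. (real_of_int (e f))\<^sup>2)"
  have E: "E > 0" unfolding E_def using fin ne e0 by (intro sum_pos) auto
  have total: "(\<Sum>f\<in>D. \<Sum>g\<in>D. of_int (e f) * of_int (e g) * T f g x) = 0" for x
  proof -
    have "(\<Sum>f\<in>D. \<Sum>g\<in>D. of_int (e f) * of_int (e g) * T f g x)
        = (\<Sum>f\<in>D. \<Sum>g\<in>D. \<Sum>p\<in>P x. (of_int (e f) * f p) * cnj (of_int (e g) * g p) / of_nat p)"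
      unfolding T_def sum_distrib_left by (intro sum.cong refl) (simp add: mult_ac)
    also have "\<dots> = (\<Sum>f\<in>D. \<Sum>p\<in>P x. \<Sum>g\<in>D. (of_int (e f) * f p) * cnj (of_int (e g) * g p) / of_nat p)"
      by (intro sum.cong refl sum.swap)
    also have "\<dots> = (\<Sum>p\<in>P x. \<Sum>f\<in>D. \<Sum>g\<in>D. (of_int (e f) * f p) * cnj (of_int (e g) * g p) / of_nat p)"
      by (rule sum.swap)
    also have "\<dots> = (\<Sum>p\<in>P x. (\<Sum>f\<in>D. of_int (e f) * f p) * cnj (\<Sum>g\<in>D. of_int (e g) * g p) / of_nat p)"
      by (simp add: sum_product cnj_sum sum_divide_distrib)
    also have "\<dots> = 0" by (intro sum.neutral) (auto simp: P_def rel)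
    finally show ?thesis .
  qed
  have diag: "(\<lambda>x. T f f x - of_real (ln (ln x))) \<in> O[at_top](\<lambda>_. 1)" if "f \<in> D" for f
  proof -
    have "T f f x = of_real (\<Sum>p\<in>P x. (norm (f p))\<^sup>2 / real p)" for x
      unfolding T_def of_real_sum of_real_divide complex_norm_square by simp
    then have eq: "T f f x - of_real (ln (ln x)) = of_real ((\<Sum>p\<in>P x. (norm (f p))\<^sup>2 / real p) - ln (ln x))" for x
      by simp
    have "(\<lambda>x. (\<Sum>p\<in>P x. (norm (f p))\<^sup>2 / real p) - ln (ln x)) \<in> O[at_top](\<lambda>_. 1)"
      using norm1[OF that] by (simp add: has_selberg_number_def P_def)
    then obtain C where "\<forall>\<^sub>F x in at_top. \<bar>(\<Sum>p\<in>P x. (norm (f p))\<^sup>2 / real p) - ln (ln x)\<bar> \<le> C"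
      by (elim landau_o.bigE) simp
    then show ?thesis unfolding eq
      by (intro bigoI[of _ C]) (simp only: norm_of_real real_norm_def norm_one mult_1_right)
  qed
  have decomp: "complex_of_real (E * ln (ln x)) = - (\<Sum>f\<in>D. (of_int (e f))\<^sup>2 * (T f f x - of_real (ln (ln x)))
      + (\<Sum>g\<in>D - {f}. of_int (e f) * of_int (e g) * T f g x))" for x
  proof -
    have "(\<Sum>f\<in>D. (of_int (e f))\<^sup>2 * (T f f x - of_real (ln (ln x))) + (\<Sum>g\<in>D - {f}. of_int (e f) * of_int (e g) * T f g x))
       = (\<Sum>f\<in>D. (\<Sum>g\<in>D. of_int (e f) * of_int (e g) * T f g x) - (of_int (e f))\<^sup>2 * of_real (ln (ln x)))"
    proof (intro sum.cong refl)
      fix f assume "f \<in> D"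
      then show "(of_int (e f))\<^sup>2 * (T f f x - of_real (ln (ln x))) + (\<Sum>g\<in>D - {f}. of_int (e f) * of_int (e g) * T f g x)
        = (\<Sum>g\<in>D. of_int (e f) * of_int (e g) * T f g x) - (of_int (e f))\<^sup>2 * of_real (ln (ln x))"
        using fin by (simp add: sum.remove[of D f] power2_eq_square algebra_simps)
    qed
    also have "\<dots> = - complex_of_real (E * ln (ln x))"
      by (simp add: sum_subtractf total E_def sum_distrib_right)
    finally show ?thesis by simp
  qed
  have "(\<lambda>x. complex_of_real (E * ln (ln x))) \<in> O[at_top](\<lambda>_. 1)"
    unfolding decomp
  proof (intro landau_o.big.uminus_in_iff[THEN iffD2] big_sum_in_bigo sum_in_bigo)
    fix f assume f: "f \<in> D"
    show "(\<lambda>x. (of_int (e f))\<^sup>2 * (T f f x - of_real (ln (ln x)))) \<in> O[at_top](\<lambda>_. 1)"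
      using diag[OF f] by simp
    fix g assume g: "g \<in> D - {f}"
    show "(\<lambda>x. of_int (e f) * of_int (e g) * T f g x) \<in> O[at_top](\<lambda>_. 1)"
      using orth[of f g] f g by (auto simp: T_def P_def)
  qed
  then obtain C where C: "\<forall>\<^sub>F x in at_top. norm (complex_of_real (E * ln (ln x))) \<le> C"
    by (elim landau_o.bigE) simp
  have "filterlim (\<lambda>x::real. E * ln (ln x)) at_top at_top" using E by real_asymp
  then have "\<forall>\<^sub>F x in at_top. E * ln (ln x) > C" by (rule filterlim_at_top_dense[THEN iffD1, rule_format])
  with C have "\<forall>\<^sub>F x::real in at_top. False"
    by eventually_elim (simp only: norm_of_real)
  then show False by simp
qed

lemma selberg_factorization_unique:
  assumes B: "selberg_conjecture_B" and a: "a \<in> selberg_class"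
    and M: "\<forall>f\<in>#M. selberg_primitive f" "is_product_of a M"
    and N: "\<forall>f\<in>#N. selberg_primitive f" "is_product_of a N"
  shows "M = N"
proof (rule ccontr)
  assume "M \<noteq> N"
  define e where "e = (\<lambda>f. int (count M f) - int (count N f))"
  define U where "U = set_mset M \<union> set_mset N"
  define D where "D = {f \<in> U. e f \<noteq> 0}"
  have finU: "finite U" by (simp add: U_def)
  then have finD: "finite D" by (simp add: D_def)
  have prim: "selberg_primitive f" if "f \<in> U" for f using that M N by (auto simp: U_def)
  have sel: "f \<in> selberg_class" if "f \<in> U" for f
    using prim[OF that] unfolding selberg_primitive_def by (elim conjE)
  have DU: "D \<subseteq> U" by (auto simp: D_def)
  have ne: "D \<noteq> {}"
  proof
    assume "D = {}"
    have "count M f = count N f" for f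
    proof (cases "f \<in> U")
      case True
      then have "e f = 0" using \<open>D = {}\<close> by (auto simp: D_def)
      then show ?thesis by (simp add: e_def)
    qed (simp add: U_def not_in_iff)
    then show False using \<open>M \<noteq> N\<close> by (simp add: multiset_eq_iff)
  qed
  \<comment> \<open>A relation with a single \<open>f\<close> is treated apart: conjecture (B)
    speaks of pairs, and \<open>has_selberg_number f 1\<close> is drawn from it here by pairing
    \<open>f\<close> with a second element of \<open>D\<close>.\<close>
  show False
  proof (cases "\<exists>f. D = {f}")
    case True
    then obtain f where f: "D = {f}" by blast
    then have fU: "f \<in> U" and ef: "count M f \<noteq> count N f" using DU by (auto simp: D_def e_def)
    have eq: "count M g = count N g" if "g \<in> U - {f}" for g using that f by (auto simp: D_def e_def)
    \<comment> \<open>Factors of equal multiplicity cancel because series of the class have no zeros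
      for \<open>Re s > 1\<close>.\<close>
    have pw: "dseries f s ^ count M f = dseries f s ^ count N f" if s: "Re s > 1" for s
    proof -
      have "(\<Prod>g\<in>U. dseries g s ^ count M g) = (\<Prod>g\<in>U. dseries g s ^ count N g)"
        using M(2) N(2) s prod_mset_count[OF finU, of M "\<lambda>g. dseries g s"] prod_mset_count[OF finU, of N "\<lambda>g. dseries g s"]
        by (simp add: is_product_of_def U_def)
      moreover have "(\<Prod>g\<in>U - {f}. dseries g s ^ count M g) = (\<Prod>g\<in>U - {f}. dseries g s ^ count N g)"
        by (intro prod.cong refl) (simp add: eq)
      moreover have "(\<Prod>g\<in>U - {f}. dseries g s ^ count N g) \<noteq> 0"
        using finU sel selberg_dseries_nonzero[OF _ s] by auto
      ultimately show ?thesis by (simp add: prod.remove[OF finU fU])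
    qed
    define j where "j = (if count M f < count N f then count N f - count M f else count M f - count N f)"
    have "dseries f s ^ j = 1" if s: "Re s > 1" for s
      using pw[OF s] selberg_dseries_nonzero[OF sel[OF fU] s] ef
      by (simp add: j_def power_diff)
    moreover have "j > 0" using ef by (simp add: j_def)
    ultimately have "f = one_coeffs" by (intro selberg_root_of_unity[OF sel[OF fU]])
    moreover have "f \<noteq> one_coeffs"
      using prim[OF fU] unfolding selberg_primitive_def by (elim conjE)
    ultimately show False by (rule notE[rotated])
  next
    case False
    have two: "\<exists>g\<in>D. g \<noteq> f" for f
    proof (rule ccontr)
      assume "\<not> (\<exists>g\<in>D. g \<noteq> f)"
      then have "D \<subseteq> {f}" by auto
      then have "D = {f}" using ne by (simp add: subset_singleton_iff)
      with False show False by simp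
    qed
    have Bc: "has_selberg_number f 1 \<and> (\<lambda>x::real. \<Sum>p | prime p \<and> real p \<le> x. f p * cnj (g p) / of_nat p) \<in> O[at_top](\<lambda>_. 1)"
      if "f \<in> D" "g \<in> D" "f \<noteq> g" for f g
      using B[unfolded selberg_conjecture_B_def, rule_format, of f g] that prim DU by auto
    show False
    proof (rule orthonormal_independent[OF finD ne, of e])
      show "e f \<noteq> 0" if "f \<in> D" for f using that by (simp add: D_def)
      show "has_selberg_number f 1" if "f \<in> D" for f
      proof -
        obtain g where "g \<in> D" "g \<noteq> f" using two[of f] by (elim bexE)
        then show ?thesis using Bc[OF that, of g] by simp
      qed
      show "(\<lambda>x::real. \<Sum>p | prime p \<and> real p \<le> x. f p * cnj (g p) / of_nat p) \<in> O[at_top](\<lambda>_. 1)"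
        if "f \<in> D" "g \<in> D" "f \<noteq> g" for f g using Bc[OF that] by (elim conjE)
      fix p :: nat assume p: "prime p"
      have "(\<Sum>f\<in>#M. f p) = (\<Sum>f\<in>#N. f p)"
      proof -
        have "\<forall>f\<in>#M. f \<in> selberg_class" "\<forall>f\<in>#N. f \<in> selberg_class" using sel by (auto simp: U_def)
        then show ?thesis
          using selberg_product_prime_coeffs[OF a _ M(2) p] selberg_product_prime_coeffs[OF a _ N(2) p] by simp
      qed
      then have "(\<Sum>f\<in>U. of_nat (count M f) * f p) = (\<Sum>f\<in>U. of_nat (count N f) * f p)"
        using sum_mset_count[OF finU, of M "\<lambda>f. f p"] sum_mset_count[OF finU, of N "\<lambda>f. f p"] by (simp add: U_def)
      then have "(\<Sum>f\<in>U. of_int (e f) * f p) = 0"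
        by (simp add: e_def left_diff_distrib sum_subtractf)
      moreover have "(\<Sum>f\<in>U. of_int (e f) * f p) = (\<Sum>f\<in>D. of_int (e f) * f p)"
        by (rule sum.mono_neutral_right) (use finU in \<open>auto simp: D_def\<close>)
      ultimately show "(\<Sum>f\<in>D. of_int (e f) * f p) = 0" by simp
    qed
  qed
qed

section \<open>Existence\<close>


lemma selberg_small_weight_trivial:
  assumes a: "a \<in> selberg_class" and d: "selberg_data a F \<epsilon> Q k w \<mu>" and W: "(\<Sum>i<k. w i) \<le> 1 / 100"
    and G: "G holomorphic_on UNIV" "exp_growth G" "\<forall>s. s \<noteq> 1 \<longrightarrow> G s = (s - 1) ^ m * F s"
  shows "a = one_coeffs"
proof -
  have "k = 0" by (rule selberg_small_weight_no_gamma[OF a d W G])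
  then show ?thesis using selberg_no_gamma_trivial[OF a _ G] d by simp
qed

text \<open>A relation rather than a function, since the Gamma factors of an element are a choice;
  superadditivity holds for every choice.\<close>

definition selberg_weight :: "(nat \<Rightarrow> complex) \<Rightarrow> real \<Rightarrow> bool" where
  "selberg_weight a W \<longleftrightarrow> (\<exists>F \<epsilon> Q k w \<mu>. selberg_data a F \<epsilon> Q k w \<mu> \<and> W = (\<Sum>i<k. w i))"

lemma selberg_weight_exists:
  assumes "a \<in> selberg_class"
  obtains W where "selberg_weight a W" "a \<noteq> one_coeffs \<Longrightarrow> W > 1 / 100"
proof (rule selberg_class_data[OF assms])
  fix F G m \<epsilon> Q k w \<mu>
  assume G: "G holomorphic_on UNIV" "exp_growth G" "\<And>s. s \<noteq> 1 \<Longrightarrow> G s = (s - 1) ^ m * F s"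
    and d: "selberg_data a F \<epsilon> Q k w \<mu>"
  show thesis
  proof (rule that)
    show "selberg_weight a (\<Sum>i<k. w i)" using d unfolding selberg_weight_def by blast
    show "(\<Sum>i<k. w i) > 1 / 100" if "a \<noteq> one_coeffs"
      using selberg_small_weight_trivial[OF assms d _ G(1,2)] G(3) that by (meson not_le)
  qed
qed

text \<open>Induction on an integer bound \<open>n\<close> for 100 times the weight. In a nontrivial
  splitting both factors have weight above \<open>1 / 100\<close>, so each of them has weight below
  that of the product by more than \<open>1 / 100\<close>.\<close>

lemma selberg_factorization_exists:
  assumes "a \<in> selberg_class"
  shows "\<exists>M. (\<forall>f\<in>#M. selberg_primitive f) \<and> is_product_of a M"
proof -
  have "\<exists>M. (\<forall>f\<in>#M. selberg_primitive f) \<and> is_product_of a M"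
    if "a \<in> selberg_class" "selberg_weight a W" "W \<le> real n / 100" for n a W
    using that
  proof (induction n arbitrary: a W rule: less_induct)
    case (less n)
    note a = less.prems(1)
    show ?case
    proof (cases "a = one_coeffs \<or> selberg_primitive a")
      case True
      then show ?thesis
      proof
        assume "a = one_coeffs"
        then show ?thesis by (intro exI[of _ "{#}"]) (simp add: is_product_of_def dseries_one_coeffs)
      next
        assume "selberg_primitive a"
        then show ?thesis by (intro exI[of _ "{#a#}"]) (simp add: is_product_of_def)
      qed
    next
      case False
      then obtain a1 a2 where a12: "a1 \<in> selberg_class" "a2 \<in> selberg_class" "is_product_of a {#a1, a2#}"
        "a1 \<noteq> one_coeffs" "a2 \<noteq> one_coeffs"
        using a unfolding selberg_primitive_def by blast
      obtain W1 where W1: "selberg_weight a1 W1" "W1 > 1 / 100"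
        using selberg_weight_exists[OF a12(1)] a12(4) by metis
      obtain W2 where W2: "selberg_weight a2 W2" "W2 > 1 / 100"
        using selberg_weight_exists[OF a12(2)] a12(5) by metis
      have "W1 + W2 \<le> W"
        using less.prems(2) W1(1) W2(1) selberg_weight_superadditive[OF a _ a12(1) _ a12(2) _ a12(3)]
        unfolding selberg_weight_def by blast
      \<comment> \<open>The splitting also forces \<open>n > 0\<close>, because
        \<open>W1 + W2 > 2 / 100\<close>.\<close>
      then have le: "W1 \<le> real (n - 1) / 100" "W2 \<le> real (n - 1) / 100" and n: "n - 1 < n"
        using less.prems(3) W1(2) W2(2) by (auto simp: of_nat_diff)
      obtain M1 where M1: "\<forall>f\<in>#M1. selberg_primitive f" "is_product_of a1 M1"
        using less.IH[OF n a12(1) W1(1) le(1)] by blast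
      obtain M2 where M2: "\<forall>f\<in>#M2. selberg_primitive f" "is_product_of a2 M2"
        using less.IH[OF n a12(2) W2(1) le(2)] by blast
      show ?thesis
        using M1 M2 a12(3) by (intro exI[of _ "M1 + M2"]) (auto simp: is_product_of_def)
    qed
  qed
  moreover obtain W where "selberg_weight a W" using selberg_weight_exists[OF assms] by blast
  moreover obtain n :: nat where "W * 100 \<le> real n" using real_arch_simple by blast
  ultimately show ?thesis using assms by (metis le_divide_eq zero_less_numeral)
qed

theorem proposition4p4:
  assumes "selberg_conjecture_A"
    and "selberg_conjecture_B"
    and "selberg_conjecture_C"
  shows "\<forall>F\<in>selberg_class.
           \<exists>!M :: (nat \<Rightarrow> complex) multiset. (\<forall>f\<in>#M. selberg_primitive f) \<and> is_product_of F M"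
proof
  fix F assume F: "F \<in> selberg_class"
  show "\<exists>!M. (\<forall>f\<in>#M. selberg_primitive f) \<and> is_product_of F M"
    by (rule ex_ex1I[OF selberg_factorization_exists[OF F]])
       (elim conjE, rule selberg_factorization_unique[OF assms(2) F])
qed

end
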